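(* Let $(R,\mathfrak m)$ be an excellent local ring of dimension $d$ and let $x\in\mathfrak m$ be a nonzerodivisor. Let $B$ be a big Cohen-Macaulay $R$-algebra. If $R/xR$ is $\mathrm{BCM}_{B/xB}$-rational, then $R$ is $\mathrm{BCM}_B$-rational. In particular, if $R/xR$ is BCM-rational, then so is $R$.
   Context: Local rings are Noetherian. For a local ring $(T,\mathfrak n)$ of dimension $e$, a $T$-algebra $B$ (not necessarily Noetherian) is big Cohen-Macaulay if every system of parameters $x_1,\dots,x_e$ of $T$ is a regular sequence on $B$ (including $B/(x_1,\dots,x_e)B\ne0$). For an excellent local ring $(T,\mathfrak n)$ of dimension $e$ and a big Cohen-Macaulay $T$-algebra $B$, $T$ is $\mathrm{BCM}_B$-rational if $T$ is Cohen-Macaulay and $H^e_{\mathfrak n}(T)\to H^e_{\mathfrak n}(B)$ is injective. $T$ is BCM-rational if it is $\mathrm{BCM}_B$-rational for all big Cohen-Macaulay $T$-algebras $B$. *)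

theory Defs
  imports "HOL-Library.Poly_Mapping" "HOL-Library.Extended_Nat" "HOL-Algebra.Algebra"
begin

text \<open>Conventions: all rings and algebras are commutative with one. A \<open>T\<close>-algebra is a record
  satisfying \<^locale>\<open>algebra\<close>; its structure map is \<open>t \<mapsto> t \<odot> \<one>\<close>.\<close>

section \<open>Local rings, dimension, quotients of algebras\<close>

definition max_ideal :: "('a, 'm) ring_scheme \<Rightarrow> 'a set" where
  "max_ideal R = (THE M. maximalideal M R)"

definition local_ring :: "('a, 'm) ring_scheme \<Rightarrow> bool" where
  "local_ring R \<longleftrightarrow> cring R \<and> noetherian_ring R \<and> (\<exists>!M. maximalideal M R)"

definition krull_dim :: "('a, 'm) ring_scheme \<Rightarrow> enat" where
  "krull_dim R =
     (SUP C \<in> {C. finite C \<and> C \<noteq> {} \<and> subset.chain {P. primeideal P R} C}. enat (card C - 1))"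

definition ideal_radical :: "('a, 'm) ring_scheme \<Rightarrow> 'a set \<Rightarrow> 'a set" where
  "ideal_radical R I = {r \<in> carrier R. \<exists>n::nat. r [^]\<^bsub>R\<^esub> n \<in> I}"

definition ideal_power :: "('a, 'm) ring_scheme \<Rightarrow> 'a set \<Rightarrow> nat \<Rightarrow> 'a set" where
  "ideal_power R I n = ((ideal_prod R I) ^^ n) (carrier R)"

definition nonzerodivisor :: "('a, 'm) ring_scheme \<Rightarrow> 'a \<Rightarrow> bool" where
  "nonzerodivisor R x \<longleftrightarrow>
     x \<in> carrier R \<and> (\<forall>r \<in> carrier R. x \<otimes>\<^bsub>R\<^esub> r = \<zero>\<^bsub>R\<^esub> \<longrightarrow> r = \<zero>\<^bsub>R\<^esub>)"

definition self_algebra :: "('a, 'm) ring_scheme \<Rightarrow> ('a, 'a) module" where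
  "self_algebra R = \<lparr>carrier = carrier R, monoid.mult = (\<otimes>\<^bsub>R\<^esub>), monoid.one = \<one>\<^bsub>R\<^esub>,
     ring.zero = \<zero>\<^bsub>R\<^esub>, ring.add = (\<oplus>\<^bsub>R\<^esub>), smult = (\<otimes>\<^bsub>R\<^esub>)\<rparr>"

definition structure_map :: "('a, 'b, 'm) module_scheme \<Rightarrow> 'a \<Rightarrow> 'b" where
  "structure_map B r = r \<odot>\<^bsub>B\<^esub> \<one>\<^bsub>B\<^esub>"

definition extended_ideal :: "('a, 'b, 'm) module_scheme \<Rightarrow> 'a set \<Rightarrow> 'b set" where
  "extended_ideal B I = Idl\<^bsub>B\<^esub> (structure_map B ` I)"

text \<open>For an \<open>R\<close>-algebra \<open>B\<close> and an ideal \<open>I\<close> of \<open>R\<close>, the algebra \<open>B/IB\<close> over \<open>R Quot I\<close>.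
  As for \<^const>\<open>rcoset_mult\<close>, the union runs over all representatives and is a single coset.\<close>

definition quotient_algebra :: "'a set \<Rightarrow> ('a, 'b) module \<Rightarrow> ('a set, 'b set) module" where
  "quotient_algebra I B = (let J = extended_ideal B I; Q = B Quot J in
     \<lparr>carrier = carrier Q, monoid.mult = (\<otimes>\<^bsub>Q\<^esub>), monoid.one = \<one>\<^bsub>Q\<^esub>,
      ring.zero = \<zero>\<^bsub>Q\<^esub>, ring.add = (\<oplus>\<^bsub>Q\<^esub>),
      smult = (\<lambda>U V. \<Union>u\<in>U. \<Union>v\<in>V. J +>\<^bsub>B\<^esub> (u \<odot>\<^bsub>B\<^esub> v))\<rparr>)"


section \<open>Regular sequences, systems of parameters, Cohen-Macaulay conditions\<close>

definition list_times_module :: "'a list \<Rightarrow> ('a, 'b, 'm) module_scheme \<Rightarrow> 'b set" where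
  "list_times_module xs M =
     {finsum M (\<lambda>i. (xs ! i) \<odot>\<^bsub>M\<^esub> f i) {..<length xs} | f. \<forall>i < length xs. f i \<in> carrier M}"

definition regular_sequence :: "'a list \<Rightarrow> ('a, 'b, 'm) module_scheme \<Rightarrow> bool" where
  "regular_sequence xs M \<longleftrightarrow>
     (\<forall>i < length xs. \<forall>u \<in> carrier M. (xs ! i) \<odot>\<^bsub>M\<^esub> u \<in> list_times_module (take i xs) M \<longrightarrow>
        u \<in> list_times_module (take i xs) M) \<and>
     list_times_module xs M \<noteq> carrier M"

definition system_of_parameters :: "('a, 'm) ring_scheme \<Rightarrow> 'a list \<Rightarrow> bool" where
  "system_of_parameters T xs \<longleftrightarrow>
     enat (length xs) = krull_dim T \<and> set xs \<subseteq> max_ideal T \<and>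
     ideal_radical T (Idl\<^bsub>T\<^esub> (set xs)) = max_ideal T"

definition depth :: "('a, 'm) ring_scheme \<Rightarrow> enat" where
  "depth T = (SUP xs \<in> {xs. set xs \<subseteq> max_ideal T \<and> regular_sequence xs (self_algebra T)}.
     enat (length xs))"

definition Cohen_Macaulay :: "('a, 'm) ring_scheme \<Rightarrow> bool" where
  "Cohen_Macaulay T \<longleftrightarrow> local_ring T \<and> depth T = krull_dim T"

definition big_Cohen_Macaulay :: "('a, 'm) ring_scheme \<Rightarrow> ('a, 'b, 'n) module_scheme \<Rightarrow> bool" where
  "big_Cohen_Macaulay T B \<longleftrightarrow>
     algebra T B \<and> (\<forall>xs. system_of_parameters T xs \<longrightarrow> regular_sequence xs B)"


section \<open>Localization\<close>

definition loc_class ::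
  "('a, 'b, 'm) module_scheme \<Rightarrow> 'a set \<Rightarrow> 'b \<Rightarrow> 'a \<Rightarrow> ('b \<times> 'a) set" where
  "loc_class M S u s = {(v, t). v \<in> carrier M \<and> t \<in> S \<and>
     (\<exists>w \<in> S. w \<odot>\<^bsub>M\<^esub> (t \<odot>\<^bsub>M\<^esub> u) = w \<odot>\<^bsub>M\<^esub> (s \<odot>\<^bsub>M\<^esub> v))}"

text \<open>The localization of \<open>M\<close> at a multiplicative subset \<open>S\<close> of \<open>R\<close>. The additive part is meaningful
  for every \<open>R\<close>-module \<open>M\<close>, multiplication and unit when \<open>M\<close> is an \<open>R\<close>-algebra.
  The unions run over all representatives and give a single class.\<close>

definition localization ::
  "('a, 'r) ring_scheme \<Rightarrow> ('a, 'b, 'm) module_scheme \<Rightarrow> 'a set \<Rightarrow> ('b \<times> 'a) set ring" where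
  "localization R M S =
     \<lparr>carrier = {loc_class M S u s | u s. u \<in> carrier M \<and> s \<in> S},
      monoid.mult = (\<lambda>U V. \<Union>(u, s)\<in>U. \<Union>(v, t)\<in>V. loc_class M S (u \<otimes>\<^bsub>M\<^esub> v) (s \<otimes>\<^bsub>R\<^esub> t)),
      monoid.one = loc_class M S \<one>\<^bsub>M\<^esub> \<one>\<^bsub>R\<^esub>,
      ring.zero = loc_class M S \<zero>\<^bsub>M\<^esub> \<one>\<^bsub>R\<^esub>,
      ring.add = (\<lambda>U V. \<Union>(u, s)\<in>U. \<Union>(v, t)\<in>V.
               loc_class M S ((t \<odot>\<^bsub>M\<^esub> u) \<oplus>\<^bsub>M\<^esub> (s \<odot>\<^bsub>M\<^esub> v)) (s \<otimes>\<^bsub>R\<^esub> t))\<rparr>"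

definition localization_at :: "('a, 'm) ring_scheme \<Rightarrow> 'a set \<Rightarrow> ('a \<times> 'a) set ring" where
  "localization_at R P = localization R (self_algebra R) (carrier R - P)"

definition residue_field :: "('a, 'm) ring_scheme \<Rightarrow> 'a set \<Rightarrow> ('a \<times> 'a) set set ring" where
  "residue_field R P = localization_at R P Quot max_ideal (localization_at R P)"

definition to_residue_field :: "('a, 'm) ring_scheme \<Rightarrow> 'a set \<Rightarrow> 'a \<Rightarrow> ('a \<times> 'a) set set" where
  "to_residue_field R P r =
     max_ideal (localization_at R P) +>\<^bsub>localization_at R P\<^esub>
       loc_class (self_algebra R) (carrier R - P) r \<one>\<^bsub>R\<^esub>"


section \<open>Local cohomology\<close>

text \<open>Local cohomology \<open>H\<^sup>p\<^sub>I(M)\<close> over a Noetherian ring \<open>R\<close>, where \<open>I\<close> is the ideal generated by the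
  list \<open>xs\<close> up to radical, as the cohomology of the (extended, alternating) Cech complex
  with \<open>p\<close>-cochains the product of the localizations \<open>M\<^bsub>x\<^sub>S\<^esub>\<close>, where \<open>S\<close> ranges over
  the \<open>p\<close>-element sets of indices and \<open>x\<^sub>S\<close> is the product of the \<open>x\<^sub>i\<close>, \<open>i \<in> S\<close>. It is realized
  as the localization at the monoid generated by the \<open>x\<^sub>i\<close>, \<open>i \<in> S\<close>, so that
  the restriction maps do not change representatives.\<close>

definition cech_index :: "'a list \<Rightarrow> nat \<Rightarrow> nat set set" where
  "cech_index xs p = {S. S \<subseteq> {..<length xs} \<and> card S = p}"

definition cech_monoid :: "('a, 'r) ring_scheme \<Rightarrow> 'a list \<Rightarrow> nat set \<Rightarrow> 'a set" where
  "cech_monoid R xs S = {finprod R (\<lambda>i. (xs ! i) [^]\<^bsub>R\<^esub> (k i :: nat)) S | k. True}"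

definition cech_loc ::
  "('a, 'r) ring_scheme \<Rightarrow> 'a list \<Rightarrow> ('a, 'b, 'm) module_scheme \<Rightarrow> nat set \<Rightarrow> ('b \<times> 'a) set ring"
  where "cech_loc R xs M S = localization R M (cech_monoid R xs S)"

definition cech_restrict ::
  "('a, 'r) ring_scheme \<Rightarrow> 'a list \<Rightarrow> ('a, 'b, 'm) module_scheme \<Rightarrow> nat set \<Rightarrow>
     ('b \<times> 'a) set \<Rightarrow> ('b \<times> 'a) set" where
  "cech_restrict R xs M S U = (\<Union>(u, s)\<in>U. loc_class M (cech_monoid R xs S) u s)"

text \<open>The additive group of \<open>p\<close>-cochains, in multiplicative notation so that \<^const>\<open>FactGroup\<close>
  applies.\<close>

definition cech_cochains ::
  "('a, 'r) ring_scheme \<Rightarrow> 'a list \<Rightarrow> ('a, 'b, 'm) module_scheme \<Rightarrow> nat \<Rightarrow>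
     (nat set \<Rightarrow> ('b \<times> 'a) set) monoid" where
  "cech_cochains R xs M p =
     \<lparr>carrier = (\<Pi>\<^sub>E S \<in> cech_index xs p. carrier (cech_loc R xs M S)),
      monoid.mult = (\<lambda>b c. \<lambda>S \<in> cech_index xs p. b S \<oplus>\<^bsub>cech_loc R xs M S\<^esub> c S),
      monoid.one = (\<lambda>S \<in> cech_index xs p. \<zero>\<^bsub>cech_loc R xs M S\<^esub>)\<rparr>"

definition cech_differential ::
  "('a, 'r) ring_scheme \<Rightarrow> 'a list \<Rightarrow> ('a, 'b, 'm) module_scheme \<Rightarrow> nat \<Rightarrow>
     (nat set \<Rightarrow> ('b \<times> 'a) set) \<Rightarrow> (nat set \<Rightarrow> ('b \<times> 'a) set)" where
  "cech_differential R xs M p c =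
     (\<lambda>S \<in> cech_index xs (Suc p).
        finsum (cech_loc R xs M S)
          (\<lambda>i. if even (card {j \<in> S. j < i})
               then cech_restrict R xs M S (c (S - {i}))
               else \<ominus>\<^bsub>cech_loc R xs M S\<^esub> cech_restrict R xs M S (c (S - {i})))
          S)"

definition cech_cocycles ::
  "('a, 'r) ring_scheme \<Rightarrow> 'a list \<Rightarrow> ('a, 'b, 'm) module_scheme \<Rightarrow> nat \<Rightarrow>
     (nat set \<Rightarrow> ('b \<times> 'a) set) set" where
  "cech_cocycles R xs M p =
     {c \<in> carrier (cech_cochains R xs M p).
        cech_differential R xs M p c = \<one>\<^bsub>cech_cochains R xs M (Suc p)\<^esub>}"

fun cech_coboundaries ::
  "('a, 'r) ring_scheme \<Rightarrow> 'a list \<Rightarrow> ('a, 'b, 'm) module_scheme \<Rightarrow> nat \<Rightarrow>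
     (nat set \<Rightarrow> ('b \<times> 'a) set) set" where
  "cech_coboundaries R xs M 0 = {\<one>\<^bsub>cech_cochains R xs M 0\<^esub>}"
| "cech_coboundaries R xs M (Suc p) =
     cech_differential R xs M p ` carrier (cech_cochains R xs M p)"

definition local_cohomology ::
  "('a, 'r) ring_scheme \<Rightarrow> 'a list \<Rightarrow> ('a, 'b, 'm) module_scheme \<Rightarrow> nat \<Rightarrow>
     (nat set \<Rightarrow> ('b \<times> 'a) set) set monoid" where
  "local_cohomology R xs M p =
     (cech_cochains R xs M p)\<lparr>carrier := cech_cocycles R xs M p\<rparr> Mod cech_coboundaries R xs M p"

text \<open>The map on \<open>H\<^sup>p\<close> induced by an \<open>R\<close>-linear map \<open>f\<close> from \<open>M\<close> to \<open>N\<close>; it depends on \<open>M\<close> only through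
  the classes it is applied to.\<close>

definition cech_cochain_map ::
  "('a, 'r) ring_scheme \<Rightarrow> 'a list \<Rightarrow> ('a, 'c, 'n) module_scheme \<Rightarrow> nat \<Rightarrow> ('b \<Rightarrow> 'c) \<Rightarrow>
     (nat set \<Rightarrow> ('b \<times> 'a) set) \<Rightarrow> (nat set \<Rightarrow> ('c \<times> 'a) set)" where
  "cech_cochain_map R xs N p f c =
     (\<lambda>S \<in> cech_index xs p. \<Union>(u, s)\<in>c S. loc_class N (cech_monoid R xs S) (f u) s)"

definition local_cohomology_map ::
  "('a, 'r) ring_scheme \<Rightarrow> 'a list \<Rightarrow> ('a, 'c, 'n) module_scheme \<Rightarrow> nat \<Rightarrow> ('b \<Rightarrow> 'c) \<Rightarrow>
     (nat set \<Rightarrow> ('b \<times> 'a) set) set \<Rightarrow> (nat set \<Rightarrow> ('c \<times> 'a) set) set" where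
  "local_cohomology_map R xs N p f K =
     (\<Union>c\<in>K. cech_coboundaries R xs N p #>\<^bsub>cech_cochains R xs N p\<^esub> cech_cochain_map R xs N p f c)"


section \<open>BCM-rationality\<close>

text \<open>\<open>H\<^sup>e\<close> with support in the maximal ideal of \<open>T\<close> is computed from any system of parameters
  (which has \<open>e\<close> elements); it does not depend on the choice, and injectivity is demanded
  for all of them. Both predicates are meant for an excellent local ring \<open>T\<close>, and the first one
  for a big Cohen-Macaulay \<open>T\<close>-algebra \<open>B\<close>.\<close>

definition BCM_rational_wrt :: "('a, 'r) ring_scheme \<Rightarrow> ('a, 'b, 'm) module_scheme \<Rightarrow> bool" where
  "BCM_rational_wrt T B \<longleftrightarrow> Cohen_Macaulay T \<and>
     (\<forall>xs. system_of_parameters T xs \<longrightarrow>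
        inj_on (local_cohomology_map T xs B (length xs) (structure_map B))
               (carrier (local_cohomology T xs (self_algebra T) (length xs))))"

text \<open>``All big Cohen-Macaulay algebras'' are those whose carrier is a set of elements of
  the type \<open>'b\<close>, which plays the role of a universe.\<close>

definition BCM_rational :: "'b itself \<Rightarrow> ('a, 'r) ring_scheme \<Rightarrow> bool" where
  "BCM_rational _ T \<longleftrightarrow>
     (\<forall>B :: ('a, 'b) module. big_Cohen_Macaulay T B \<longrightarrow> BCM_rational_wrt T B)"


section \<open>Excellent rings\<close>

definition regular_local_ring :: "('a, 'm) ring_scheme \<Rightarrow> bool" where
  "regular_local_ring R \<longleftrightarrow> local_ring R \<and>
     (\<exists>G \<subseteq> carrier R. finite G \<and> Idl\<^bsub>R\<^esub> G = max_ideal R \<and> enat (card G) = krull_dim R)"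

definition regular_ring :: "('a, 'm) ring_scheme \<Rightarrow> bool" where
  "regular_ring R \<longleftrightarrow> cring R \<and> noetherian_ring R \<and>
     (\<forall>P. primeideal P R \<longrightarrow> regular_local_ring (localization_at R P))"

definition finitely_generated_algebra ::
  "('a, 'm) ring_scheme \<Rightarrow> ('a \<Rightarrow> 'c) \<Rightarrow> ('c, 'n) ring_scheme \<Rightarrow> bool" where
  "finitely_generated_algebra R \<phi> S \<longleftrightarrow> cring S \<and> \<phi> \<in> ring_hom R S \<and>
     (\<exists>G \<subseteq> carrier S. finite G \<and> generate_ring S (\<phi> ` carrier R \<union> G) = carrier S)"

definition catenary :: "('a, 'm) ring_scheme \<Rightarrow> bool" where
  "catenary R \<longleftrightarrow>
     (\<forall>P Q. primeideal P R \<and> primeideal Q R \<and> P \<subseteq> Q \<longrightarrow>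
        (\<exists>n. \<forall>C. subset.maxchain {N. primeideal N R \<and> P \<subseteq> N \<and> N \<subseteq> Q} C \<longrightarrow>
               finite C \<and> card C = n))"

text \<open>Every finitely generated \<open>R\<close>-algebra is isomorphic to one with carrier in the type
  \<open>nat multiset \<Rightarrow> 'a\<close>: it is a quotient of a polynomial ring in variables indexed by natural
  numbers, and a class can be represented by the coefficient function of one of its members.\<close>

definition universally_catenary :: "('a, 'm) ring_scheme \<Rightarrow> bool" where
  "universally_catenary R \<longleftrightarrow>
     (\<forall>(S :: (nat multiset \<Rightarrow> 'a) ring) \<phi>. finitely_generated_algebra R \<phi> S \<longrightarrow> catenary S)"

text \<open>J-2: the regular locus of every finitely generated \<open>R\<close>-algebra is Zariski open.\<close>

definition J2_ring :: "('a, 'm) ring_scheme \<Rightarrow> bool" where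
  "J2_ring R \<longleftrightarrow>
     (\<forall>(S :: (nat multiset \<Rightarrow> 'a) ring) \<phi>. finitely_generated_algebra R \<phi> S \<longrightarrow>
        (\<exists>D \<subseteq> carrier S. \<forall>P. primeideal P S \<longrightarrow>
           (regular_local_ring (localization_at S P) \<longleftrightarrow> \<not> D \<subseteq> P)))"

text \<open>The \<open>I\<close>-adic completion: the inverse limit of the rings \<open>R/I\<^sup>n\<close>. The inclusion of cosets
  expresses compatibility with the projections.\<close>

definition completion :: "('a, 'm) ring_scheme \<Rightarrow> 'a set \<Rightarrow> (nat \<Rightarrow> 'a set) ring" where
  "completion R I =
     \<lparr>carrier = {f. \<forall>n. f n \<in> carrier (R Quot ideal_power R I n) \<and> f (Suc n) \<subseteq> f n},
      monoid.mult = (\<lambda>f g n. f n \<otimes>\<^bsub>R Quot ideal_power R I n\<^esub> g n),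
      monoid.one = (\<lambda>n. \<one>\<^bsub>R Quot ideal_power R I n\<^esub>),
      ring.zero = (\<lambda>n. \<zero>\<^bsub>R Quot ideal_power R I n\<^esub>),
      ring.add = (\<lambda>f g n. f n \<oplus>\<^bsub>R Quot ideal_power R I n\<^esub> g n)\<rparr>"

definition to_completion :: "('a, 'm) ring_scheme \<Rightarrow> 'a set \<Rightarrow> 'a \<Rightarrow> (nat \<Rightarrow> 'a set)" where
  "to_completion R I r = (\<lambda>n. ideal_power R I n +>\<^bsub>R\<^esub> r)"

text \<open>The tensor product of two \<open>R\<close>-algebras \<open>A\<close> and \<open>B\<close> (with structure maps \<open>\<phi>\<close> and \<open>\<psi>\<close>) is the free
  abelian group on the pairs, with product \<open>(a,b)(a',b') = (aa',bb')\<close>, modulo the bilinearity relations.\<close>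

definition pair_ring ::
  "('b, 'm) ring_scheme \<Rightarrow> ('c, 'n) ring_scheme \<Rightarrow> ('b \<times> 'c \<Rightarrow>\<^sub>0 int) ring" where
  "pair_ring A B =
     \<lparr>carrier = {f. Poly_Mapping.keys f \<subseteq> carrier A \<times> carrier B},
      monoid.mult = (\<lambda>f g. \<Sum>u \<in> Poly_Mapping.keys f. \<Sum>v \<in> Poly_Mapping.keys g.
                Poly_Mapping.single (fst u \<otimes>\<^bsub>A\<^esub> fst v, snd u \<otimes>\<^bsub>B\<^esub> snd v)
                  (Poly_Mapping.lookup f u * Poly_Mapping.lookup g v)),
      monoid.one = Poly_Mapping.single (\<one>\<^bsub>A\<^esub>, \<one>\<^bsub>B\<^esub>) 1,
      ring.zero = 0,
      ring.add = (+)\<rparr>"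

definition tensor_relations ::
  "('a, 'r) ring_scheme \<Rightarrow> ('a \<Rightarrow> 'b) \<Rightarrow> ('b, 'm) ring_scheme \<Rightarrow>
     ('a \<Rightarrow> 'c) \<Rightarrow> ('c, 'n) ring_scheme \<Rightarrow> ('b \<times> 'c \<Rightarrow>\<^sub>0 int) set" where
  "tensor_relations R \<phi> A \<psi> B = (let pr = (\<lambda>a b. Poly_Mapping.single (a, b) (1::int)) in
     {pr (a \<oplus>\<^bsub>A\<^esub> a') b - pr a b - pr a' b | a a' b.
        a \<in> carrier A \<and> a' \<in> carrier A \<and> b \<in> carrier B} \<union>
     {pr a (b \<oplus>\<^bsub>B\<^esub> b') - pr a b - pr a b' | a b b'.
        a \<in> carrier A \<and> b \<in> carrier B \<and> b' \<in> carrier B} \<union>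
     {pr (\<phi> r \<otimes>\<^bsub>A\<^esub> a) b - pr a (\<psi> r \<otimes>\<^bsub>B\<^esub> b) | r a b.
        r \<in> carrier R \<and> a \<in> carrier A \<and> b \<in> carrier B})"

definition tensor_ideal ::
  "('a, 'r) ring_scheme \<Rightarrow> ('a \<Rightarrow> 'b) \<Rightarrow> ('b, 'm) ring_scheme \<Rightarrow>
     ('a \<Rightarrow> 'c) \<Rightarrow> ('c, 'n) ring_scheme \<Rightarrow> ('b \<times> 'c \<Rightarrow>\<^sub>0 int) set" where
  "tensor_ideal R \<phi> A \<psi> B = Idl\<^bsub>pair_ring A B\<^esub> (tensor_relations R \<phi> A \<psi> B)"

definition tensor_ring ::
  "('a, 'r) ring_scheme \<Rightarrow> ('a \<Rightarrow> 'b) \<Rightarrow> ('b, 'm) ring_scheme \<Rightarrow>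
     ('a \<Rightarrow> 'c) \<Rightarrow> ('c, 'n) ring_scheme \<Rightarrow> ('b \<times> 'c \<Rightarrow>\<^sub>0 int) set ring" where
  "tensor_ring R \<phi> A \<psi> B = pair_ring A B Quot tensor_ideal R \<phi> A \<psi> B"

definition tensor_right ::
  "('a, 'r) ring_scheme \<Rightarrow> ('a \<Rightarrow> 'b) \<Rightarrow> ('b, 'm) ring_scheme \<Rightarrow>
     ('a \<Rightarrow> 'c) \<Rightarrow> ('c, 'n) ring_scheme \<Rightarrow> 'c \<Rightarrow> ('b \<times> 'c \<Rightarrow>\<^sub>0 int) set" where
  "tensor_right R \<phi> A \<psi> B b =
     tensor_ideal R \<phi> A \<psi> B +>\<^bsub>pair_ring A B\<^esub> Poly_Mapping.single (\<one>\<^bsub>A\<^esub>, b) 1"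

definition finite_field_extension ::
  "('k, 'm) ring_scheme \<Rightarrow> ('k \<Rightarrow> 'l) \<Rightarrow> ('l, 'n) ring_scheme \<Rightarrow> bool" where
  "finite_field_extension k \<psi> L \<longleftrightarrow> field L \<and> \<psi> \<in> ring_hom k L \<and>
     (\<exists>G \<subseteq> carrier L. finite G \<and>
        carrier L = {finsum L (\<lambda>b. \<psi> (c b) \<otimes>\<^bsub>L\<^esub> b) G | c. c \<in> G \<rightarrow> carrier k})"

text \<open>A finite extension of \<open>k\<close> is isomorphic, via coordinates, to a field with carrier in
  the type \<open>nat \<Rightarrow> 'k\<close>.\<close>

definition geometrically_regular ::
  "('k, 'm) ring_scheme \<Rightarrow> ('k \<Rightarrow> 'f) \<Rightarrow> ('f, 'n) ring_scheme \<Rightarrow> bool" where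
  "geometrically_regular k \<phi> F \<longleftrightarrow>
     (\<forall>(L :: (nat \<Rightarrow> 'k) ring) \<psi>. finite_field_extension k \<psi> L \<longrightarrow>
        regular_ring (tensor_ring k \<phi> F \<psi> L))"

definition formal_fibres_geometrically_regular :: "('a, 'm) ring_scheme \<Rightarrow> bool" where
  "formal_fibres_geometrically_regular A \<longleftrightarrow>
     (\<forall>Q. primeideal Q A \<longrightarrow>
        (let m = max_ideal A; k = residue_field A Q in
         geometrically_regular k
           (tensor_right A (to_completion A m) (completion A m) (to_residue_field A Q) k)
           (tensor_ring A (to_completion A m) (completion A m) (to_residue_field A Q) k)))"

definition G_ring :: "('a, 'm) ring_scheme \<Rightarrow> bool" where
  "G_ring R \<longleftrightarrow>
     (\<forall>P. primeideal P R \<longrightarrow> formal_fibres_geometrically_regular (localization_at R P))"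

definition excellent_ring :: "('a, 'm) ring_scheme \<Rightarrow> bool" where
  "excellent_ring R \<longleftrightarrow> cring R \<and> noetherian_ring R \<and> universally_catenary R \<and> G_ring R \<and> J2_ring R"

end

theory Submission
  imports Defs
begin

text \<open>Let \<open>x\<^sub>1, \<dots>, x\<^sub>e\<close> be a system of parameters that is regular on \<open>R\<close> and on \<open>B\<close>. The class of
  \<open>u/(x\<^sub>1\<cdots>x\<^sub>e)\<^sup>t\<close> in top local cohomology vanishes iff \<open>u\<close> lies in the ideal \<open>(x\<^sub>1\<^sup>t, \<dots>, x\<^sub>e\<^sup>t)\<close>,
  and likewise over \<open>B\<close>; so injectivity means \<open>IB \<inter> R = I\<close> for these ideals \<open>I\<close>.
  This equality for a maximal regular sequence of \<open>R/xR\<close> lifts to \<open>I = (x, z\<^sub>1, \<dots>, z\<^sub>e)\<close>. It then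
  spreads, together with regularity, to all systems of parameters of \<open>R\<close>, because any two of them
  are connected by exchanging one element at a time. The dimension theory behind this is Krull's
  height theorem, proved with saturated ideals instead of localizations.\<close>

section \<open>Prime ideals and saturation\<close>

text \<open>The two directions of the dictionary use regularity on different sides: contraction is
  deduced from injectivity by cancelling \<open>x_1 ... x_e\<close> in the ring, injectivity from
  contraction by cancelling it in the algebra. The second is possible although \<open>B\<close> need
  not be Noetherian. Nakayama's lemma, and with it the permutability of regular sequences and the
  passage to powers, is available in the ring only; on \<open>B\<close>, the regularity of a
  parameter modulo powers of the others is read off from the big Cohen-Macaulay hypothesis, which
  covers every system of parameters in every order. Injectivity for one system of parameters already
  concerns the ideals \<open>(x_1^t, ..., x_e^t)\<close> for all \<open>t > 0\<close>, and it is
  required for all systems; hence contraction of the single ideal \<open>(x, z_1, ..., z_e)\<close>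
  has to be spread that far. No long exact sequence of cohomology enters. Dimension theory serves to
  show that \<open>x, z_1, ..., z_e\<close> has the right length and to connect systems of
  parameters.\<close>

locale noetherian_cring = cring R + noetherian_ring R for R (structure)

section \<open>Noetherian induction and the ideals I + (a)\<close>

lemma (in noetherian_cring) ideal_noetherian_induct [consumes 1, case_names step]:
  assumes "ideal I R"
    and step: "\<And>I. ideal I R \<Longrightarrow> (\<And>J. ideal J R \<Longrightarrow> I \<subset> J \<Longrightarrow> P J) \<Longrightarrow> P I"
  shows "P I"
proof (rule ccontr)
  assume "\<not> P I"
  define A where "A = {I. ideal I R \<and> \<not> P I}"
  have "A \<noteq> {}" using \<open>\<not> P I\<close> assms(1) A_def by auto
  moreover have "\<Union>C \<in> A" if "C \<noteq> {}" "subset.chain A C" for C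
  proof -
    have "subset.chain {I. ideal I R} C"
      using that(2) unfolding subset.chain_def A_def by auto
    then have "\<Union>C \<in> C" using ideal_chain_is_trivial that(1) by blast
    then show ?thesis using that(2) unfolding subset.chain_def by auto
  qed
  ultimately obtain M where "M \<in> A" "\<forall>J\<in>A. M \<subseteq> J \<longrightarrow> J = M"
    using subset_Zorn_nonempty[of A] by blast
  then show False using step[of M] unfolding A_def by blast
qed

lemma (in noetherian_cring) ideal_maximal_element:
  assumes "\<forall>I\<in>A. ideal I R" and "I \<in> A"
  shows "\<exists>M\<in>A. I \<subseteq> M \<and> (\<forall>J\<in>A. M \<subseteq> J \<longrightarrow> J = M)"
proof -
  have "ideal I R" using assms by blast
  then have "I \<in> A \<longrightarrow> (\<exists>M\<in>A. I \<subseteq> M \<and> (\<forall>J\<in>A. M \<subseteq> J \<longrightarrow> J = M))"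
  proof (induction rule: ideal_noetherian_induct)
    case (step I)
    show ?case
    proof (cases "\<exists>J\<in>A. I \<subset> J")
      case True
      then obtain J where J: "J \<in> A" "I \<subset> J" by blast
      then show ?thesis using step.IH[of J] assms(1) by (meson order_trans psubset_imp_subset)
    next
      case False
      then show ?thesis by blast
    qed
  qed
  then show ?thesis using assms(2) by simp
qed

lemma (in cring) mem_add_PIdl:
  "c \<in> set_add R I (PIdl a) \<longleftrightarrow> (\<exists>i\<in>I. \<exists>r\<in>carrier R. c = i \<oplus> r \<otimes> a)"
  unfolding set_add_def' cgenideal_def by auto

lemma (in cring) ideal_add_PIdl:
  assumes "ideal I R" "a \<in> carrier R"
  shows "ideal (set_add R I (PIdl a)) R" "I \<subseteq> set_add R I (PIdl a)" "a \<in> set_add R I (PIdl a)"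
proof -
  interpret I: ideal I R by fact
  show "ideal (set_add R I (PIdl a)) R" using add_ideals assms cgenideal_ideal by blast
  show "I \<subseteq> set_add R I (PIdl a)"
  proof
    fix i assume "i \<in> I"
    then have "i = i \<oplus> \<zero> \<otimes> a" using assms(2) I.Icarr by simp
    then show "i \<in> set_add R I (PIdl a)" using mem_add_PIdl \<open>i \<in> I\<close> zero_closed by blast
  qed
  have "a = \<zero> \<oplus> \<one> \<otimes> a" using assms(2) by simp
  then show "a \<in> set_add R I (PIdl a)" using mem_add_PIdl I.zero_closed one_closed by blast
qed

lemma (in cring) add_PIdl_subset:
  assumes "ideal J R" "I \<subseteq> J" "a \<in> J"
  shows "set_add R I (PIdl a) \<subseteq> J"
proof -
  interpret J: ideal J R by fact
  show ?thesis
  proof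
    fix c assume "c \<in> set_add R I (PIdl a)"
    then obtain i r where "i \<in> I" "r \<in> carrier R" "c = i \<oplus> r \<otimes> a" unfolding mem_add_PIdl by auto
    then show "c \<in> J" using assms J.a_closed[of i "r \<otimes> a"] J.I_l_closed[OF assms(3)] by auto
  qed
qed

lemma (in primeideal) one_notin: "\<one> \<notin> I"
  using I_notcarr one_imp_carrier by blast

lemma (in primeideal) pow_mem_imp_mem:
  assumes "a \<in> carrier R" "a [^] (n::nat) \<in> I"
  shows "a \<in> I"
  using assms(2)
proof (induction n)
  case 0
  then show ?case using one_notin by simp
next
  case (Suc n)
  then show ?case using I_prime[of "a [^] n" a] assms(1) by auto
qed

lemma (in ideal) pow_mem:
  assumes "a \<in> I" "n > 0" shows "a [^] (n::nat) \<in> I"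
proof -
  obtain k where "n = Suc k" using assms(2) gr0_implies_Suc by blast
  then show ?thesis using assms(1) I_l_closed[OF assms(1), of "a [^] k"] by (simp add: Icarr)
qed

text \<open>An ideal that is maximal among those disjoint from \<open>S\<close> is prime: if neither
  \<open>a\<close> nor \<open>b\<close> lay in it, both enlargements would meet \<open>S\<close>,
  and the product of the two meeting elements would lie in the ideal and in \<open>S\<close> as soon
  as \<open>a b\<close> did.\<close>

lemma (in noetherian_cring) prime_avoiding_submonoid:
  assumes I: "ideal I R" and S: "S \<subseteq> carrier R" "\<one> \<in> S" "\<And>s t. s \<in> S \<Longrightarrow> t \<in> S \<Longrightarrow> s \<otimes> t \<in> S"
    and disj: "I \<inter> S = {}"
  obtains P where "primeideal P R" "I \<subseteq> P" "P \<inter> S = {}"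
proof -
  let ?A = "{J. ideal J R \<and> J \<inter> S = {}}"
  obtain P where P: "P \<in> ?A" "I \<subseteq> P" and max: "\<And>J. J \<in> ?A \<Longrightarrow> P \<subseteq> J \<Longrightarrow> J = P"
    using ideal_maximal_element[of ?A I] I disj by auto
  have Pid: "ideal P R" using P by simp
  interpret P: ideal P R by fact
  have meet: "\<exists>i\<in>P. \<exists>r\<in>carrier R. i \<oplus> r \<otimes> a \<in> S" if "a \<in> carrier R" "a \<notin> P" for a
  proof -
    have "set_add R P (PIdl a) \<noteq> P" using ideal_add_PIdl[OF Pid that(1)] that(2) by blast
    moreover have "set_add R P (PIdl a) \<in> ?A" if "set_add R P (PIdl a) \<inter> S = {}"
      using ideal_add_PIdl(1)[OF Pid \<open>a \<in> carrier R\<close>] that by simp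
    ultimately have "set_add R P (PIdl a) \<inter> S \<noteq> {}"
      using max[of "set_add R P (PIdl a)"] ideal_add_PIdl(2)[OF Pid that(1)] by auto
    then obtain c where c: "c \<in> set_add R P (PIdl a)" "c \<in> S" by auto
    from c(1) obtain i r where "i \<in> P" "r \<in> carrier R" "c = i \<oplus> r \<otimes> a" unfolding mem_add_PIdl by auto
    then show ?thesis using c(2) by auto
  qed
  have "primeideal P R"
  proof (rule primeidealI[OF Pid is_cring])
    show "carrier R \<noteq> P" using P S(2) by blast
    fix a b assume ab: "a \<in> carrier R" "b \<in> carrier R" "a \<otimes> b \<in> P"
    show "a \<in> P \<or> b \<in> P"
    proof (rule ccontr)
      assume "\<not> (a \<in> P \<or> b \<in> P)"
      then obtain i r j t where ir: "i \<in> P" "r \<in> carrier R" "i \<oplus> r \<otimes> a \<in> S"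
        and jt: "j \<in> P" "t \<in> carrier R" "j \<oplus> t \<otimes> b \<in> S"
        using meet[of a] meet[of b] ab by blast
      have [simp]: "i \<in> carrier R" "j \<in> carrier R" using ir jt P.Icarr by auto
      have "(i \<oplus> r \<otimes> a) \<otimes> (j \<oplus> t \<otimes> b) = (j \<oplus> t \<otimes> b) \<otimes> i \<oplus> ((r \<otimes> a) \<otimes> j \<oplus> (r \<otimes> t) \<otimes> (a \<otimes> b))"
        using ab ir(2) jt(2) \<open>i \<in> carrier R\<close> \<open>j \<in> carrier R\<close> by algebra
      also have "\<dots> \<in> P"
        using ab ir jt P.I_l_closed[OF ab(3), of "r \<otimes> t"] P.I_l_closed[of j "r \<otimes> a"]
        by (intro P.a_closed) (auto intro: P.I_l_closed)
      finally show False using S(3)[OF ir(3) jt(3)] P by blast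
    qed
  qed
  then show ?thesis using that P by blast
qed

definition min_prime_over :: "('a, 'm) ring_scheme \<Rightarrow> 'a set \<Rightarrow> 'a set \<Rightarrow> bool" where
  "min_prime_over R I P \<longleftrightarrow> primeideal P R \<and> I \<subseteq> P \<and>
     (\<forall>Q. primeideal Q R \<and> I \<subseteq> Q \<and> Q \<subseteq> P \<longrightarrow> Q = P)"

text \<open>The multiplicative set consists of the products \<open>s x^n\<close> with
  \<open>s\<close> outside \<open>P\<close>. Avoiding the elements with \<open>n = 0\<close> keeps
  \<open>Q\<close> inside \<open>P\<close>, avoiding \<open>x\<close> itself keeps \<open>x\<close>
  out of \<open>Q\<close>. It is used whenever a prime has to be found one step lower.\<close>

lemma (in noetherian_cring) prime_below_avoiding:
  assumes I: "ideal I R" and P: "primeideal P R" and x: "x \<in> carrier R"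
    and ne: "\<And>s n. s \<in> carrier R - P \<Longrightarrow> s \<otimes> x [^] (n::nat) \<notin> I"
  obtains Q where "primeideal Q R" "I \<subseteq> Q" "Q \<subseteq> P" "x \<notin> Q"
proof -
  interpret P: primeideal P R by fact
  let ?S = "{s \<otimes> x [^] n | s n. s \<in> carrier R - P \<and> n \<in> (UNIV :: nat set)}"
  have in_S: "s \<otimes> x [^] n \<in> ?S" if "s \<in> carrier R - P" for s and n :: nat using that by blast
  have "\<one> \<in> ?S" using in_S[of \<one> 0] P.one_notin x by simp
  moreover have "a \<otimes> b \<in> ?S" if ab: "a \<in> ?S" "b \<in> ?S" for a b
  proof -
    obtain s n t k where st: "s \<in> carrier R - P" "t \<in> carrier R - P"
      "a = s \<otimes> x [^] (n::nat)" "b = t \<otimes> x [^] (k::nat)" using ab by blast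
    have "a \<otimes> b = (s \<otimes> t) \<otimes> x [^] (n + k)"
      unfolding st nat_pow_mult[symmetric, OF x] using st x by (simp add: m_ac)
    moreover have "s \<otimes> t \<in> carrier R - P" using st P.I_prime by blast
    ultimately show ?thesis using in_S by simp
  qed
  moreover have "I \<inter> ?S = {}" using ne by blast
  ultimately obtain Q where Q: "primeideal Q R" "I \<subseteq> Q" "Q \<inter> ?S = {}"
    using prime_avoiding_submonoid[OF I, of ?S] x by blast
  interpret Q: primeideal Q R by fact
  have "Q \<subseteq> P"
  proof
    fix s assume s: "s \<in> Q"
    then have "s \<otimes> x [^] (0::nat) \<notin> ?S" using Q(3) Q.Icarr x by auto
    then show "s \<in> P" using in_S s Q.Icarr by blast
  qed
  moreover have "x \<notin> Q" using in_S[of \<one> 1] Q(3) P.one_notin x by auto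
  ultimately show ?thesis using that Q by blast
qed

text \<open>In the localization at \<open>P\<close>, minimality makes the maximal ideal the radical
  of the extension of \<open>I\<close>; the factor \<open>s\<close> is a denominator that has been
  cleared.\<close>

lemma (in noetherian_cring) min_prime_over_pow:
  assumes "ideal I R" "min_prime_over R I P" "a \<in> P"
  obtains s n where "s \<in> carrier R - P" "s \<otimes> a [^] (n::nat) \<in> I"
proof (rule ccontr)
  assume "\<not> thesis"
  then have ne: "\<And>s n. s \<in> carrier R - P \<Longrightarrow> s \<otimes> a [^] (n::nat) \<notin> I" using that by blast
  have P: "primeideal P R" using assms(2) min_prime_over_def by blast
  have "a \<in> carrier R" using P assms(3) by (meson ideal.Icarr primeideal.axioms(1))
  then obtain Q where "primeideal Q R" "I \<subseteq> Q" "Q \<subseteq> P" "a \<notin> Q"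
    using prime_below_avoiding[OF assms(1) P _ ne] by blast
  then show False using assms unfolding min_prime_over_def by blast
qed

text \<open>The contraction to \<open>R\<close> of the extension of \<open>I\<close> to the
  localization at \<open>P\<close>. Inclusions between ideals of that localization become inclusions
  between saturations.\<close>

definition saturation :: "('a, 'm) ring_scheme \<Rightarrow> 'a set \<Rightarrow> 'a set \<Rightarrow> 'a set" where
  "saturation R P I = {a \<in> carrier R. \<exists>s \<in> carrier R - P. s \<otimes>\<^bsub>R\<^esub> a \<in> I}"

lemma (in cring) saturation_ideal:
  assumes P: "primeideal P R" and I: "ideal I R"
  shows "ideal (saturation R P I) R"
proof -
  interpret P: primeideal P R by fact
  interpret I: ideal I R by fact
  show ?thesis
  proof (rule idealI[OF ring_axioms])
    show "subgroup (saturation R P I) (add_monoid R)"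
    proof (rule add.subgroupI)
      show "saturation R P I \<subseteq> carrier R" by (auto simp: saturation_def)
      have "\<zero> \<in> saturation R P I" using P.one_notin by (auto simp: saturation_def intro!: bexI[of _ \<one>])
      then show "saturation R P I \<noteq> {}" by blast
    next
      fix a assume "a \<in> saturation R P I"
      then obtain s where s: "a \<in> carrier R" "s \<in> carrier R - P" "s \<otimes> a \<in> I" by (auto simp: saturation_def)
      then have "s \<otimes> (\<ominus> a) \<in> I" using I.a_inv_closed[OF s(3)] by (simp add: r_minus)
      then show "\<ominus> a \<in> saturation R P I" using s by (auto simp: saturation_def)
    next
      fix a b assume "a \<in> saturation R P I" "b \<in> saturation R P I"
      then obtain s t where s: "a \<in> carrier R" "s \<in> carrier R - P" "s \<otimes> a \<in> I"
         and t: "b \<in> carrier R" "t \<in> carrier R - P" "t \<otimes> b \<in> I" by (auto simp: saturation_def)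
      have "(s \<otimes> t) \<otimes> (a \<oplus> b) = t \<otimes> (s \<otimes> a) \<oplus> s \<otimes> (t \<otimes> b)"
        using s(1,2) t(1,2) by (simp add: r_distr m_ac)
      then have "(s \<otimes> t) \<otimes> (a \<oplus> b) \<in> I" using s t I.I_l_closed by auto
      moreover have "s \<otimes> t \<in> carrier R - P" using s t P.I_prime by blast
      ultimately show "a \<oplus> b \<in> saturation R P I" using s t by (auto simp: saturation_def)
    qed
    fix a r assume "a \<in> saturation R P I" and r: "r \<in> carrier R"
    then obtain s where s: "a \<in> carrier R" "s \<in> carrier R - P" "s \<otimes> a \<in> I" by (auto simp: saturation_def)
    have "s \<otimes> (r \<otimes> a) \<in> I" using I.I_l_closed[OF s(3) r] s r by (simp add: m_ac)
    then show "r \<otimes> a \<in> saturation R P I" using s r by (auto simp: saturation_def)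
    then show "a \<otimes> r \<in> saturation R P I" using s r by (simp add: m_comm)
  qed
qed

lemma (in cring) saturation_increasing:
  assumes "primeideal P R" "ideal I R"
  shows "I \<subseteq> saturation R P I"
proof -
  interpret P: primeideal P R by fact
  interpret I: ideal I R by fact
  show ?thesis using P.one_notin I.Icarr by (auto simp: saturation_def intro!: bexI[of _ \<one>])
qed

lemma saturation_mono: "I \<subseteq> J \<Longrightarrow> saturation R P I \<subseteq> saturation R P J"
  unfolding saturation_def by blast

lemma saturation_anti: "Q \<subseteq> P \<Longrightarrow> saturation R P I \<subseteq> saturation R Q I"
  unfolding saturation_def by blast

lemma (in cring) saturation_idem:
  assumes P: "primeideal P R"
  shows "saturation R P (saturation R P I) \<subseteq> saturation R P I"
proof
  interpret P: primeideal P R by fact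
  fix a assume "a \<in> saturation R P (saturation R P I)"
  then obtain s t where s: "a \<in> carrier R" "s \<in> carrier R - P" "t \<in> carrier R - P" "t \<otimes> (s \<otimes> a) \<in> I"
    unfolding saturation_def by blast
  have "(t \<otimes> s) \<otimes> a \<in> I" using s by (simp add: m_assoc)
  moreover have "t \<otimes> s \<in> carrier R - P" using s P.I_prime by blast
  ultimately show "a \<in> saturation R P I" using s unfolding saturation_def by blast
qed

text \<open>Nakayama's lemma for the localization at \<open>P\<close>, stated without localizing.\<close>

lemma (in noetherian_cring) nakayama_saturation:
  assumes P: "primeideal P R" and I: "ideal I R" and K: "ideal K R" and z: "z \<in> P"
    and sub: "\<And>k. k \<in> K \<Longrightarrow> \<exists>s \<in> carrier R - P. \<exists>i \<in> I. \<exists>k' \<in> K. s \<otimes> k = i \<oplus> z \<otimes> k'"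
  shows "K \<subseteq> saturation R P I"
proof -
  interpret P: primeideal P R by fact
  interpret I: ideal I R by fact
  interpret K: ideal K R by fact
  have zR: "z \<in> carrier R" using z P.Icarr by blast
  obtain F0 where F0: "F0 \<subseteq> carrier R" "finite F0" "K = Idl F0" using finetely_gen[OF K] by blast
  \<comment> \<open>Locally at \<open>P\<close>, the ideal \<open>K\<close> is generated by
    \<open>I\<close> and \<open>F\<close>. An \<open>F\<close> of least cardinality will turn out to
    be empty.\<close>
  let ?Q = "\<lambda>F. finite F \<and> F \<subseteq> K \<and> K \<subseteq> saturation R P (Idl (I \<union> F))"
  have "K \<subseteq> Idl (I \<union> F0)" using F0 subset_Idl_subset[of "I \<union> F0" F0] I.a_subset by auto
  moreover have "ideal (Idl (I \<union> F0)) R" using F0 I.a_subset by (intro genideal_ideal) auto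
  ultimately have "?Q F0" using F0 saturation_increasing[OF P] genideal_self[of F0] by blast
  then obtain F where F: "?Q F" and min: "\<And>F'. ?Q F' \<Longrightarrow> card F \<le> card F'"
    using exists_least_iff[of "\<lambda>n. \<exists>F. ?Q F \<and> card F = n"] by (metis not_less)
  show ?thesis
  proof (cases "F = {}")
    case True
    have "Idl I \<subseteq> I" using genideal_minimal[OF I] by blast
    then show ?thesis using F True saturation_mono by fastforce
  next
    case False
    then obtain g where g: "g \<in> F" by blast
    define G where "G = F - {g}"
    have Gc: "I \<union> G \<subseteq> carrier R" "g \<in> carrier R" "I \<union> F \<subseteq> carrier R"
      using F K.a_subset I.a_subset g G_def by auto
    define J where "J = Idl (I \<union> G)"
    have J: "ideal J R" unfolding J_def using genideal_ideal Gc by blast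
    interpret J: ideal J R by fact
    have IJ: "I \<subseteq> J" using genideal_self[OF Gc(1)] J_def by blast
    have JF: "Idl (I \<union> F) \<subseteq> set_add R J (PIdl g)"
      using genideal_self[OF Gc(1)] ideal_add_PIdl[OF J Gc(2)] F
      by (intro genideal_minimal) (auto simp: J_def G_def)
    obtain s i k' where s: "s \<in> carrier R - P" "i \<in> I" "k' \<in> K" "s \<otimes> g = i \<oplus> z \<otimes> k'"
      using sub[of g] F g by blast
    obtain t where t: "t \<in> carrier R - P" "t \<otimes> k' \<in> set_add R J (PIdl g)"
      using F s(3) JF unfolding saturation_def by blast
    obtain j r where jr: "j \<in> J" "r \<in> carrier R" "t \<otimes> k' = j \<oplus> r \<otimes> g"
      using t(2) mem_add_PIdl by blast
    note c = s(1,3) t(1) jr(1,2) Gc(2) zR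
    have carr: "s \<in> carrier R" "t \<in> carrier R" "k' \<in> carrier R" "j \<in> carrier R" "i \<in> carrier R"
      using c s(2) K.Icarr J.Icarr I.Icarr by auto
    \<comment> \<open>Solving the two relations for \<open>g\<close>: its coefficient is outside
      \<open>P\<close>, since \<open>s\<close> and \<open>t\<close> are outside and \<open>z\<close>
      is inside. So \<open>g\<close> is redundant locally at \<open>P\<close>, against the
      minimality of \<open>F\<close>.\<close>
    have "(t \<otimes> s \<ominus> z \<otimes> r) \<otimes> g = t \<otimes> (s \<otimes> g) \<ominus> z \<otimes> (r \<otimes> g)"
      using carr jr(2) Gc(2) zR by algebra
    also have "\<dots> = t \<otimes> i \<oplus> z \<otimes> (t \<otimes> k') \<ominus> z \<otimes> (r \<otimes> g)"
      unfolding s(4) using carr jr(2) Gc(2) zR by algebra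
    also have "\<dots> = t \<otimes> i \<oplus> z \<otimes> j"
      unfolding jr(3) using carr jr(2) Gc(2) zR by algebra
    also have "\<dots> \<in> J" using s(2) IJ jr(1) carr zR by (intro J.a_closed J.I_l_closed) auto
    finally have gJ: "(t \<otimes> s \<ominus> z \<otimes> r) \<otimes> g \<in> J" .
    have "t \<otimes> s \<ominus> z \<otimes> r \<notin> P"
    proof
      assume "t \<otimes> s \<ominus> z \<otimes> r \<in> P"
      then have "(t \<otimes> s \<ominus> z \<otimes> r) \<oplus> r \<otimes> z \<in> P" using P.a_closed P.I_l_closed[OF z jr(2)] by blast
      moreover have "(t \<otimes> s \<ominus> z \<otimes> r) \<oplus> r \<otimes> z = t \<otimes> s" using carr jr(2) zR by algebra
      ultimately show False using s(1) t(1) P.I_prime by auto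
    qed
    then have "g \<in> saturation R P J" using gJ carr jr(2) zR Gc(2) unfolding saturation_def by blast
    then have "set_add R J (PIdl g) \<subseteq> saturation R P J"
      using add_PIdl_subset[OF saturation_ideal[OF P J] saturation_increasing[OF P J]] by blast
    then have "saturation R P (Idl (I \<union> F)) \<subseteq> saturation R P J"
      using saturation_mono[OF order_trans[OF JF]] saturation_idem[OF P] by blast
    then have "?Q G" using F G_def J_def by auto
    then show ?thesis using min[of G] F g G_def by (metis card_Diff1_less not_less)
  qed
qed

section \<open>Krull's height theorem\<close>

lemma (in cring) colon_ideal:
  assumes "ideal K R" "a \<in> carrier R"
  shows "ideal {r \<in> carrier R. r \<otimes> a \<in> K} R"
proof -
  have "{r \<in> carrier R. r \<otimes> a \<in> K} = {r \<in> carrier R. a \<otimes> r \<in> K}"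
    using assms(2) m_comm by auto
  then show ?thesis using ideal.helper_max_prime[OF assms(1) is_cring assms(2)] by simp
qed

text \<open>The localization at \<open>P\<close> modulo \<open>K\<^sub>0\<close> is Artinian; its ideals are
  the \<open>P\<close>-saturated ideals of \<open>R\<close> that contain \<open>K\<^sub>0\<close>.\<close>

lemma (in noetherian_cring) saturated_descending_chain_stops:
  fixes L :: "nat \<Rightarrow> 'a set"
  assumes "ideal K R" and P: "min_prime_over R K\<^sub>0 P" and "K\<^sub>0 \<subseteq> K"
    and "\<And>n. ideal (L n) R" "\<And>n. saturation R P (L n) \<subseteq> L n" "\<And>n. L (Suc n) \<subseteq> L n" "\<And>n. K \<subseteq> L n"
  shows "\<exists>n. L (Suc n) = L n"
  using assms(1,3-)
proof (induction arbitrary: L rule: ideal_noetherian_induct)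
  case (step K)
  have Pp: "primeideal P R" using P min_prime_over_def by blast
  interpret P: primeideal P R by fact
  interpret K: ideal K R using step by blast
  have Lsub: "L n \<subseteq> carrier R" for n 
    using additive_subgroup.a_subset[OF ideal.axioms(1)[OF step.prems(2)]] .
  consider (unit) "\<not> K \<subseteq> P" | (unsat) "\<not> saturation R P K \<subseteq> K" | (sat) "K \<subseteq> P" "saturation R P K \<subseteq> K"
    by blast
  then show ?case
  proof cases
    case unit
    then obtain s where s: "s \<in> K" "s \<notin> P" by blast
    have "L n = carrier R" for n
    proof -
      interpret L: ideal "L n" R using step.prems by blast
      have "carrier R \<subseteq> saturation R P (L n)"
        using s step.prems(5)[of n] K.Icarr L.I_r_closed unfolding saturation_def by blast
      then show ?thesis using step.prems(3)[of n] Lsub[of n] by blast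
    qed
    then show ?thesis by blast
  next
    case unsat
    have "K \<subset> saturation R P K" using saturation_increasing[OF Pp step.hyps] unsat by blast
    moreover have "saturation R P K \<subseteq> L n" for n
      using saturation_mono[OF step.prems(5)[of n], of R P] step.prems(3)[of n] by blast
    ultimately show ?thesis
      using step.IH[OF saturation_ideal[OF Pp step.hyps], of L] step.prems(1-4) by blast
  next
    case sat
    \<comment> \<open>An associated prime of \<open>R/K\<close>: a colon ideal
      \<open>(K : a)\<close> with \<open>a\<close> outside \<open>K\<close> that is maximal among
      such ideals is prime. It lies in \<open>P\<close> because \<open>K\<close> is saturated, and
      contains \<open>K\<^sub>0\<close>, so it equals \<open>P\<close>. Hence \<open>K + (a)\<close>
      is only one simple module larger than \<open>K\<close>, locally at \<open>P\<close>.\<close>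
    let ?col = "\<lambda>a. {r \<in> carrier R. r \<otimes> a \<in> K}"
    let ?A = "?col ` (carrier R - K)"
    define A where "A = ?A"
    have one: "?col \<one> \<in> A" unfolding A_def using sat P.one_notin by blast
    have Aid: "\<forall>J\<in>A. ideal J R" using colon_ideal[OF step.hyps] by (auto simp: A_def)
    obtain N where N: "N \<in> A" and Nmax': "\<forall>J\<in>A. N \<subseteq> J \<longrightarrow> J = N"
      using ideal_maximal_element[OF Aid one] by metis
    have Nmax: "?col b = N" if "b \<in> carrier R - K" "N \<subseteq> ?col b" for b
      using Nmax' that unfolding A_def by simp
    obtain a where a: "a \<in> carrier R" "a \<notin> K" "N = ?col a" using N A_def by blast
    have Nid: "ideal N R" unfolding a(3) using colon_ideal[OF step.hyps a(1)] .
    have "primeideal N R"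
    proof (rule primeidealI[OF Nid is_cring])
      have "\<one> \<notin> N" using a by simp
      then show "carrier R \<noteq> N" using one_closed by blast
      fix r s assume rs: "r \<in> carrier R" "s \<in> carrier R" "r \<otimes> s \<in> N"
      show "r \<in> N \<or> s \<in> N"
      proof (rule disjCI)
        assume "s \<notin> N"
        then have "s \<otimes> a \<in> carrier R - K" using a rs by auto
        moreover have "N \<subseteq> ?col (s \<otimes> a)"
        proof
          fix n assume "n \<in> N"
          then have n: "n \<in> carrier R" "n \<otimes> a \<in> K" using a by auto
          have "n \<otimes> (s \<otimes> a) = s \<otimes> (n \<otimes> a)" using n a rs by (simp add: m_lcomm)
          then show "n \<in> ?col (s \<otimes> a)" using n K.I_l_closed[OF n(2) rs(2)] by simp
        qed
        ultimately have "?col (s \<otimes> a) = N" by (rule Nmax)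
        moreover have "r \<in> ?col (s \<otimes> a)" using rs a by (simp add: m_assoc)
        ultimately show "r \<in> N" by simp
      qed
    qed
    moreover have "N \<subseteq> P"
      using a sat(2) unfolding saturation_def by blast
    moreover have "K\<^sub>0 \<subseteq> N" using step.prems(1) a(1) K.Icarr K.I_r_closed unfolding a(3) by blast
    ultimately have NP: "N = P" using P unfolding min_prime_over_def by blast
    define K1 where "K1 = set_add R K (PIdl a)"
    have K1: "ideal K1 R" "K \<subset> K1"
      using ideal_add_PIdl[OF step.hyps a(1)] a(2) K1_def by auto
    show ?thesis
    proof (cases "\<forall>n. a \<in> L n")
      case True
      then have "K1 \<subseteq> L n" for n
        using add_PIdl_subset step.prems(2,5) K1_def by blast
      then show ?thesis using step.IH[OF K1, of L] step.prems(1-4) K1(2) by blast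
    next
      case False
      then obtain N0 where N0: "a \<notin> L N0" by blast
      have "L (N0 + n) \<subseteq> L N0" for n
        by (induction n) (use step.prems(4) in auto)
      then have aL: "a \<notin> L (N0 + n)" for n using N0 by blast
      \<comment> \<open>The saturations of \<open>L n + (a)\<close> contain \<open>K1\<close>, so
        the induction hypothesis applies to them. Equality of two consecutive ones descends to
        \<open>L\<close>: an element \<open>b\<close> of the larger ideal is locally
        \<open>l + r a\<close> with \<open>l\<close> in the smaller one; then \<open>r a\<close> is
        in the larger one, which is saturated and misses \<open>a\<close>, so \<open>r\<close> is in
        \<open>P\<close> and \<open>r a\<close> is in \<open>K\<close>.\<close>
      define L' where "L' n = saturation R P (set_add R (L (N0 + n)) (PIdl a))" for n
      have sid: "ideal (set_add R (L (N0 + n)) (PIdl a)) R" for n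
        using ideal_add_PIdl(1)[OF step.prems(2) a(1)] .
      have "ideal (L' n) R" for n unfolding L'_def using saturation_ideal[OF Pp sid] .
      moreover have "saturation R P (L' n) \<subseteq> L' n" for n
        unfolding L'_def using saturation_idem[OF Pp] .
      moreover have "L' (Suc n) \<subseteq> L' n" for n
      proof -
        have "set_add R (L (N0 + Suc n)) (PIdl a) \<subseteq> set_add R (L (N0 + n)) (PIdl a)"
          using step.prems(4)[of "N0 + n"] unfolding set_add_def' by auto
        then show ?thesis unfolding L'_def by (rule saturation_mono)
      qed
      moreover have "K1 \<subseteq> L' n" for n
      proof -
        have "K1 \<subseteq> set_add R (L (N0 + n)) (PIdl a)"
          using step.prems(5)[of "N0 + n"] unfolding K1_def set_add_def' by auto
        then show ?thesis unfolding L'_def using saturation_increasing[OF Pp sid] by blast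
      qed
      moreover have "K\<^sub>0 \<subseteq> K1" using step.prems(1) K1 by blast
      ultimately obtain n where n: "L' (Suc n) = L' n" using step.IH[OF K1, of L'] by blast
      interpret L: ideal "L (N0 + n)" R using step.prems(2) .
      interpret L1: ideal "L (Suc (N0 + n))" R using step.prems(2) .
      have "L (N0 + n) \<subseteq> L (Suc (N0 + n))"
      proof
        fix b assume b: "b \<in> L (N0 + n)"
        have "b \<in> L' n"
          unfolding L'_def using saturation_increasing[OF Pp sid] ideal_add_PIdl(2)[OF step.prems(2) a(1)] b by blast
        then have "b \<in> L' (Suc n)" using n by simp
        then obtain s where s: "b \<in> carrier R" "s \<in> carrier R - P" "s \<otimes> b \<in> set_add R (L (Suc (N0 + n))) (PIdl a)"
          unfolding L'_def saturation_def by auto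
        then obtain l r where lr: "l \<in> L (Suc (N0 + n))" "r \<in> carrier R" "s \<otimes> b = l \<oplus> r \<otimes> a"
          unfolding mem_add_PIdl by blast
        have l: "l \<in> L (N0 + n)" "l \<in> carrier R" using lr step.prems(4) L1.Icarr by auto
        have "r \<otimes> a = s \<otimes> b \<oplus> \<ominus> l" unfolding lr(3) using l(2) lr(2) a(1) by algebra
        then have ra: "r \<otimes> a \<in> L (N0 + n)"
          using L.I_l_closed[OF b, of s] L.a_inv_closed[OF l(1)] s(2) by auto
        have "r \<in> P"
        proof (rule ccontr)
          assume "r \<notin> P"
          then have "a \<in> saturation R P (L (N0 + n))" using ra lr(2) a(1) unfolding saturation_def by blast
          then show False using step.prems(3) aL by blast
        qed
        then have "r \<otimes> a \<in> K" using NP a(3) by blast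
        then have "s \<otimes> b \<in> L (Suc (N0 + n))" unfolding lr(3) using lr(1) step.prems(5) L1.a_closed by blast
        then have "b \<in> saturation R P (L (Suc (N0 + n)))" using s(1,2) unfolding saturation_def by blast
        then show "b \<in> L (Suc (N0 + n))" using step.prems(3) by blast
      qed
      then show ?thesis using step.prems(4) by blast
    qed
  qed
qed

text \<open>For \<open>y \<in> Q - Q\<^sub>0\<close> let \<open>I n\<close> be the \<open>Q\<close>-saturation of \<open>Q\<^sub>0 + (y\<^sup>n)\<close>, a substitute for the symbolic
  powers of \<open>Q\<close>. Locally at \<open>P\<close> the chain condition gives \<open>I n = I (n + 1) + x I n\<close> for some \<open>n\<close>,
  so \<open>I n = I (n + 1)\<close> by Nakayama's lemma, which forces \<open>y \<in> Q\<^sub>0\<close>.\<close>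

theorem (in noetherian_cring) krull_principal_ideal:
  assumes Q0: "primeideal Q\<^sub>0 R" and Q: "primeideal Q R" and "Q\<^sub>0 \<subset> Q" "Q \<subset> P"
    and x: "x \<in> P" and P: "min_prime_over R (insert x Q\<^sub>0) P"
  shows False
proof -
  interpret Q0: primeideal Q\<^sub>0 R by fact
  interpret Q: primeideal Q R by fact
  have Pp: "primeideal P R" using P min_prime_over_def by blast
  interpret P: primeideal P R by fact
  have xR: "x \<in> carrier R" using x P.Icarr by blast
  have xQ: "x \<notin> Q"
  proof
    assume "x \<in> Q"
    then have "insert x Q\<^sub>0 \<subseteq> Q" "Q \<subseteq> P" using assms(3,4) by auto
    then have "Q = P" using P Q unfolding min_prime_over_def by simp
    then show False using assms(4) by simp
  qed
  obtain y where y: "y \<in> Q" "y \<notin> Q\<^sub>0" using assms(3) by blast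
  have yR: "y \<in> carrier R" using y Q.Icarr by blast
  define I where "I n = saturation R Q (set_add R Q\<^sub>0 (PIdl (y [^] n)))" for n :: nat
  have sid: "ideal (set_add R Q\<^sub>0 (PIdl (y [^] n))) R" for n :: nat
    using ideal_add_PIdl(1)[OF Q0.is_ideal] yR by simp
  have I: "ideal (I n) R" for n unfolding I_def using saturation_ideal[OF Q sid] .
  have IQ0: "Q\<^sub>0 \<subseteq> I n" for n
    using ideal_add_PIdl(2)[OF Q0.is_ideal, of "y [^] n"] saturation_increasing[OF Q sid] yR unfolding I_def by blast
  have Imono: "I (Suc n) \<subseteq> I n" for n
  proof -
    have "PIdl (y [^] Suc n) \<subseteq> PIdl (y [^] n)"
    proof (rule cgenideal_minimal)
      show "ideal (PIdl (y [^] n)) R" using cgenideal_ideal yR by simp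
      show "y [^] Suc n \<in> PIdl (y [^] n)" using yR unfolding cgenideal_def by (auto simp: m_comm)
    qed
    then have "set_add R Q\<^sub>0 (PIdl (y [^] Suc n)) \<subseteq> set_add R Q\<^sub>0 (PIdl (y [^] n))"
      unfolding set_add_def' by auto
    then show ?thesis unfolding I_def by (rule saturation_mono)
  qed
  define L where "L n = saturation R P (set_add R (I n) (PIdl x))" for n
  have sidL: "ideal (set_add R (I n) (PIdl x)) R" for n using ideal_add_PIdl(1)[OF I xR] .
  have "\<exists>n. L (Suc n) = L n"
  proof (rule saturated_descending_chain_stops[OF _ P])
    show "ideal (set_add R Q\<^sub>0 (PIdl x)) R" using ideal_add_PIdl(1)[OF Q0.is_ideal xR] .
    show "insert x Q\<^sub>0 \<subseteq> set_add R Q\<^sub>0 (PIdl x)" using ideal_add_PIdl(2,3)[OF Q0.is_ideal xR] by blast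
    show "ideal (L n) R" for n unfolding L_def using saturation_ideal[OF Pp sidL] .
    show "saturation R P (L n) \<subseteq> L n" for n unfolding L_def using saturation_idem[OF Pp] .
    show "L (Suc n) \<subseteq> L n" for n
      unfolding L_def using Imono[of n] by (intro saturation_mono) (auto simp: set_add_def')
    show "set_add R Q\<^sub>0 (PIdl x) \<subseteq> L n" for n
    proof -
      have "set_add R Q\<^sub>0 (PIdl x) \<subseteq> set_add R (I n) (PIdl x)" using IQ0[of n] by (auto simp: set_add_def')
      then show ?thesis unfolding L_def using saturation_increasing[OF Pp sidL] by blast
    qed
  qed
  then obtain n where n: "L (Suc n) = L n" by blast
  interpret In: ideal "I n" R using I .
  interpret I1: ideal "I (Suc n)" R using I .
  have "I n \<subseteq> saturation R P (I (Suc n))"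
  proof (rule nakayama_saturation[OF Pp I I x])
    fix k assume k: "k \<in> I n"
    have "k \<in> L n" using k ideal_add_PIdl(2)[OF I xR] saturation_increasing[OF Pp sidL] L_def by blast
    then have "k \<in> L (Suc n)" using n by simp
    then obtain s where s: "s \<in> carrier R - P" "s \<otimes> k \<in> set_add R (I (Suc n)) (PIdl x)"
      unfolding L_def saturation_def by auto
    then obtain i r where ir: "i \<in> I (Suc n)" "r \<in> carrier R" "s \<otimes> k = i \<oplus> r \<otimes> x"
      unfolding mem_add_PIdl by blast
    have c: "i \<in> carrier R" "k \<in> carrier R" using ir k I1.Icarr In.Icarr by auto
    have "r \<otimes> x = s \<otimes> k \<oplus> \<ominus> i" unfolding ir(3) using c ir(2) xR by algebra
    then have "r \<otimes> x \<in> I n"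
      using In.I_l_closed[OF k, of s] In.a_inv_closed[of i] ir(1) Imono s(1) by auto
    \<comment> \<open>The cofactor \<open>r\<close> of \<open>x\<close> is itself in
      \<open>I n\<close>, because \<open>I n\<close> is saturated at \<open>Q\<close> and
      \<open>x\<close> is outside \<open>Q\<close>.\<close>
    then obtain t where t: "t \<in> carrier R - Q" "t \<otimes> (r \<otimes> x) \<in> set_add R Q\<^sub>0 (PIdl (y [^] n))"
      unfolding I_def saturation_def by auto
    have "(t \<otimes> x) \<otimes> r \<in> set_add R Q\<^sub>0 (PIdl (y [^] n))" using t ir(2) xR by (simp add: m_ac)
    moreover have "t \<otimes> x \<in> carrier R - Q" using t xR xQ Q.I_prime by auto
    ultimately have "r \<in> I n" using ir(2) unfolding I_def saturation_def by blast
    then show "\<exists>s\<in>carrier R - P. \<exists>i\<in>I (Suc n). \<exists>k'\<in>I n. s \<otimes> k = i \<oplus> x \<otimes> k'"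
      using s ir xR m_comm by metis
  qed
  also have "\<dots> \<subseteq> saturation R Q (I (Suc n))" using assms(4) by (intro saturation_anti) blast
  also have "\<dots> \<subseteq> I (Suc n)" unfolding I_def using saturation_idem[OF Q] .
  finally have sub: "I n \<subseteq> I (Suc n)" .
  have "y [^] n \<in> I n"
    using ideal_add_PIdl(3)[OF Q0.is_ideal, of "y [^] n"] saturation_increasing[OF Q sid] yR I_def by auto
  then obtain s where s: "s \<in> carrier R - Q" "s \<otimes> y [^] n \<in> set_add R Q\<^sub>0 (PIdl (y [^] Suc n))"
    using sub unfolding I_def saturation_def by auto
  then obtain q r where qr: "q \<in> Q\<^sub>0" "r \<in> carrier R" "s \<otimes> y [^] n = q \<oplus> r \<otimes> y [^] Suc n"
    unfolding mem_add_PIdl by blast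
  have c: "q \<in> carrier R" "y [^] n \<in> carrier R" "s \<in> carrier R" using qr Q0.Icarr yR s by auto
  \<comment> \<open>Up to the factor \<open>s\<close> outside \<open>Q\<close>, the power
    \<open>y^n\<close> is a multiple of \<open>y^(n+1)\<close> modulo \<open>Q\<^sub>0\<close>.
    Cancelling \<open>y^n\<close> in the domain \<open>R/Q\<^sub>0\<close> makes \<open>s\<close> a
    multiple of \<open>y\<close> modulo \<open>Q\<^sub>0\<close>, hence an element of
    \<open>Q\<close>.\<close>
  have "y [^] n \<otimes> (s \<ominus> r \<otimes> y) = s \<otimes> y [^] n \<ominus> r \<otimes> (y [^] n \<otimes> y)"
    using c qr(2) yR by algebra
  also have "\<dots> = q" using qr(3) c qr(2) yR by (simp, algebra)
  finally have "s \<ominus> r \<otimes> y \<in> Q\<^sub>0"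
    using Q0.I_prime[of "y [^] n" "s \<ominus> r \<otimes> y"] Q0.pow_mem_imp_mem[OF yR, of n] y(2) c qr yR by auto
  then have "(s \<ominus> r \<otimes> y) \<oplus> r \<otimes> y \<in> Q" using assms(3) Q.I_l_closed[OF y(1) qr(2)] by blast
  moreover have "(s \<ominus> r \<otimes> y) \<oplus> r \<otimes> y = s" using c qr(2) yR by algebra
  ultimately show False using s by simp
qed

text \<open>Let \<open>Q\<close> be maximal among the primes strictly below \<open>P\<close> and \<open>y \<in> Y - Q\<close>. Up to a factor outside \<open>P\<close>,
  every \<open>b \<in> Y\<close> has a power congruent to some \<open>q b \<in> Q\<close> modulo \<open>y\<close>; by the principal ideal theorem
  \<open>Q\<close> is minimal over the elements \<open>q b\<close> with \<open>b \<noteq> y\<close>.\<close>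

theorem (in noetherian_cring) krull_height:
  assumes "finite Y" "card Y \<le> n" "Y \<subseteq> carrier R" "min_prime_over R Y P"
    and "finite C" "subset.chain {Q. primeideal Q R} C" "\<And>Q. Q \<in> C \<Longrightarrow> Q \<subseteq> P"
  shows "card C \<le> Suc n"
  using assms
proof (induction n arbitrary: Y P C rule: less_induct)
  case (less n)
  have Pp: "primeideal P R" using less.prems(4) min_prime_over_def by blast
  interpret P: primeideal P R by fact
  have Cprime: "primeideal Q R" if "Q \<in> C" for Q using less.prems(6) that unfolding subset.chain_def by blast
  have Clin: "Q \<subseteq> Q' \<or> Q' \<subseteq> Q" if "Q \<in> C" "Q' \<in> C" for Q Q'
    using less.prems(6) that unfolding subset.chain_def by blast
  \<comment> \<open>Whether or not \<open>P\<close> belongs to \<open>C\<close>, the remaining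
    members form a chain below \<open>Q\<close>, to which the induction hypothesis with
    \<open>n - 1\<close> is applied.\<close>
  define C' where "C' = C - {P}"
  have C': "finite C'" "card C \<le> Suc (card C')"
    using less.prems(5) by (auto simp: C'_def card_Diff_singleton_if)
  show ?case
  proof (cases "C' = {}")
    case True
    then show ?thesis using C' by simp
  next
    case False
    obtain Q' where Q': "Q' \<in> C'" "\<And>Z. Z \<in> C' \<Longrightarrow> Q' \<subseteq> Z \<Longrightarrow> Q' = Z"
      using finite_has_maximal[OF C'(1) False] by blast
    have Q'max: "Z \<subseteq> Q'" if "Z \<in> C'" for Z using Clin[of Z Q'] Q' that by (auto simp: C'_def)
    let ?A = "{Q. primeideal Q R \<and> Q \<subset> P}"
    have "Q' \<in> ?A" using Q'(1) Cprime less.prems(7) by (auto simp: C'_def)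
    then obtain Q where Q: "Q \<in> ?A" "Q' \<subseteq> Q" and Qmax: "\<And>J. J \<in> ?A \<Longrightarrow> Q \<subseteq> J \<Longrightarrow> J = Q"
      using ideal_maximal_element[of ?A Q'] by (auto simp: primeideal.axioms(1))
    have Qp: "primeideal Q R" using Q by blast
    interpret Q: primeideal Q R by fact
    have "\<not> Y \<subseteq> Q" using less.prems(4) Q unfolding min_prime_over_def by blast
    then obtain y where y: "y \<in> Y" "y \<notin> Q" by blast
    have yP: "y \<in> P" "Y \<subseteq> P" using y less.prems(4) unfolding min_prime_over_def by auto
    have yR: "y \<in> carrier R" using y less.prems by blast
    have minQ: "min_prime_over R (set_add R Q (PIdl y)) P"
      unfolding min_prime_over_def
    proof (intro conjI allI impI)
      show "primeideal P R" by fact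
      show "set_add R Q (PIdl y) \<subseteq> P" using add_PIdl_subset[OF P.is_ideal] Q yP by blast
      fix J assume J: "primeideal J R \<and> set_add R Q (PIdl y) \<subseteq> J \<and> J \<subseteq> P"
      then have "Q \<subseteq> J" "y \<in> J" using ideal_add_PIdl[OF Q.is_ideal yR] by auto
      then show "J = P" using Qmax[of J] J y(2) by blast
    qed
    have "\<exists>q. q \<in> Q \<and> (\<exists>s \<in> carrier R - P. \<exists>k::nat. \<exists>a\<in>carrier R. s \<otimes> b [^] k = q \<oplus> a \<otimes> y)"
      if b: "b \<in> Y" for b
    proof -
      obtain s k where "s \<in> carrier R - P" "s \<otimes> b [^] (k::nat) \<in> set_add R Q (PIdl y)"
        using min_prime_over_pow[OF ideal_add_PIdl(1)[OF Q.is_ideal yR] minQ, of b] yP b by blast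
      then show ?thesis unfolding mem_add_PIdl by blast
    qed
    then obtain q where q: "\<And>b. b \<in> Y \<Longrightarrow> q b \<in> Q \<and>
        (\<exists>s \<in> carrier R - P. \<exists>k::nat. \<exists>a\<in>carrier R. s \<otimes> b [^] k = q b \<oplus> a \<otimes> y)"
      by metis
    define Y' where "Y' = q ` (Y - {y})"
    have npos: "n > 0" using y(1) less.prems(1,2) by (metis card_gt_0_iff empty_iff le_zero_eq neq0_conv)
    have cY': "finite Y'" "card Y' \<le> n - 1"
      using less.prems(1,2) y(1) card_image_le[of "Y - {y}" q] by (auto simp: Y'_def)
    have Y'Q: "Y' \<subseteq> Q" using q by (auto simp: Y'_def)
    have "min_prime_over R Y' Q"
      unfolding min_prime_over_def
    proof (intro conjI allI impI)
      show "primeideal Q R" "Y' \<subseteq> Q" by fact+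
      fix Q0 assume Q0: "primeideal Q0 R \<and> Y' \<subseteq> Q0 \<and> Q0 \<subseteq> Q"
      \<comment> \<open>A prime \<open>J\<close> in this range contains \<open>y\<close> and all
        \<open>q b\<close>, hence a power of every \<open>b\<close>, hence \<open>Y\<close>. If
        \<open>Q0\<close> were strictly below \<open>Q\<close>, the chain \<open>Q0\<close>,
        \<open>Q\<close>, \<open>P\<close> would contradict the principal ideal theorem.\<close>
      have "min_prime_over R (insert y Q0) P"
        unfolding min_prime_over_def
      proof (intro conjI allI impI)
        show "primeideal P R" by fact
        show "insert y Q0 \<subseteq> P" using yP Q0 Q by blast
        fix J assume J: "primeideal J R \<and> insert y Q0 \<subseteq> J \<and> J \<subseteq> P"
        then have "primeideal J R" by blast
        interpret J: primeideal J R by fact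
        have "Y \<subseteq> J"
        proof
          fix b assume b: "b \<in> Y"
          show "b \<in> J"
          proof (cases "b = y")
            case True then show ?thesis using J by blast
          next
            case False
            obtain s k a where s: "s \<in> carrier R - P" "a \<in> carrier R" "s \<otimes> b [^] (k::nat) = q b \<oplus> a \<otimes> y"
              using q[OF b] by blast
            have "q b \<in> J" using False b J Q0 by (auto simp: Y'_def)
            then have "s \<otimes> b [^] k \<in> J" unfolding s(3) using J s(2) J.I_l_closed by auto
            then have "b [^] k \<in> J" using J.I_prime[of s "b [^] k"] s(1) J b less.prems(3) by blast
            then show ?thesis using J.pow_mem_imp_mem b less.prems(3) by blast
          qed
        qed
        then show "J = P" using less.prems(4) J unfolding min_prime_over_def by blast
      qed
      then show "Q0 = Q" using krull_principal_ideal[of Q0 Q P y] Q0 Q yP by blast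
    qed
    moreover have "subset.chain {Q. primeideal Q R} C'"
      using less.prems(6) unfolding subset.chain_def C'_def by blast
    moreover have "Z \<subseteq> Q" if "Z \<in> C'" for Z using Q'max[OF that] Q(2) by blast
    ultimately have "card C' \<le> Suc (n - 1)"
      using less.IH[of "n - 1" Y' Q C'] npos cY' Y'Q Q.a_subset C'(1) by auto
    then show ?thesis using C'(2) npos by linarith
  qed
qed

section \<open>Regular elements on modules\<close>

text \<open>The submodule \<open>YM\<close>. As an intersection it depends on the set
  \<open>Y\<close> alone, while \<open>list_times_module\<close> is tied to an enumeration;
  exchanging and permuting elements then needs no reindexing.\<close>

definition mult_span ::
  "('a, 'r) ring_scheme \<Rightarrow> ('a, 'b, 'm) module_scheme \<Rightarrow> 'a set \<Rightarrow> 'b set" where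
  "mult_span R M Y = \<Inter>{H. submodule H R M \<and> (\<forall>y\<in>Y. \<forall>b\<in>carrier M. y \<odot>\<^bsub>M\<^esub> b \<in> H)}"

text \<open>Multiplication by \<open>y\<close> is injective on \<open>M/ZM\<close>. The quotient may
  be zero: the properness condition of \<open>regular_sequence\<close> is handled
  separately.\<close>

definition nzd_mod ::
  "('a, 'r) ring_scheme \<Rightarrow> ('a, 'b, 'm) module_scheme \<Rightarrow> 'a set \<Rightarrow> 'a \<Rightarrow> bool" where
  "nzd_mod R M Z y \<longleftrightarrow>
     (\<forall>u\<in>carrier M. y \<odot>\<^bsub>M\<^esub> u \<in> mult_span R M Z \<longrightarrow> u \<in> mult_span R M Z)"

context module
begin

lemma mult_span_mem: "y \<in> Y \<Longrightarrow> b \<in> carrier M \<Longrightarrow> y \<odot>\<^bsub>M\<^esub> b \<in> mult_span R M Y"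
  unfolding mult_span_def by blast

lemma mult_span_least:
  "submodule H R M \<Longrightarrow> (\<And>y b. y \<in> Y \<Longrightarrow> b \<in> carrier M \<Longrightarrow> y \<odot>\<^bsub>M\<^esub> b \<in> H) \<Longrightarrow> mult_span R M Y \<subseteq> H"
  unfolding mult_span_def by blast

lemma submodule_mult_span:
  assumes "Y \<subseteq> carrier R"
  shows "submodule (mult_span R M Y) R M"
proof (rule submoduleI)
  have "mult_span R M Y \<subseteq> carrier M"
    by (rule mult_span_least) (use assms in \<open>auto intro: carrier_is_submodule\<close>)
  then show "mult_span R M Y \<subseteq> carrier M" .
  show "\<zero>\<^bsub>M\<^esub> \<in> mult_span R M Y"
    unfolding mult_span_def using submodule.axioms(1) subgroup.one_closed by fastforce
qed (unfold mult_span_def, auto dest: submoduleE)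

lemma mult_span_in_carrier: "Y \<subseteq> carrier R \<Longrightarrow> a \<in> mult_span R M Y \<Longrightarrow> a \<in> carrier M"
  using submoduleE(1)[OF submodule_mult_span] by blast

lemma mult_span_smult:
  "Y \<subseteq> carrier R \<Longrightarrow> r \<in> carrier R \<Longrightarrow> a \<in> mult_span R M Y \<Longrightarrow> r \<odot>\<^bsub>M\<^esub> a \<in> mult_span R M Y"
  using submoduleE(4)[OF submodule_mult_span] by blast

lemma mult_span_add:
  "Y \<subseteq> carrier R \<Longrightarrow> a \<in> mult_span R M Y \<Longrightarrow> b \<in> mult_span R M Y \<Longrightarrow> a \<oplus>\<^bsub>M\<^esub> b \<in> mult_span R M Y"
  using submoduleE(5)[OF submodule_mult_span] by blast

lemma mult_span_a_inv:
  "Y \<subseteq> carrier R \<Longrightarrow> a \<in> mult_span R M Y \<Longrightarrow> \<ominus>\<^bsub>M\<^esub> a \<in> mult_span R M Y"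
  using submoduleE(3)[OF submodule_mult_span] by blast

lemma mult_span_zero: "Y \<subseteq> carrier R \<Longrightarrow> \<zero>\<^bsub>M\<^esub> \<in> mult_span R M Y"
  using subgroup.one_closed[OF submodule.axioms(1)[OF submodule_mult_span]] by simp

lemma mult_span_mono:
  "Z \<subseteq> carrier R \<Longrightarrow> Y \<subseteq> Z \<Longrightarrow> mult_span R M Y \<subseteq> mult_span R M Z"
  by (rule mult_span_least) (auto intro: submodule_mult_span mult_span_mem)

lemma mult_span_subset:
  assumes "Z \<subseteq> carrier R" "\<And>y b. y \<in> Y \<Longrightarrow> b \<in> carrier M \<Longrightarrow> y \<odot>\<^bsub>M\<^esub> b \<in> mult_span R M Z"
  shows "mult_span R M Y \<subseteq> mult_span R M Z"
  using assms by (intro mult_span_least submodule_mult_span)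

lemma mult_span_empty: "mult_span R M {} = {\<zero>\<^bsub>M\<^esub>}"
proof
  have "submodule {\<zero>\<^bsub>M\<^esub>} R M" by (rule submoduleI) auto
  then show "mult_span R M {} \<subseteq> {\<zero>\<^bsub>M\<^esub>}" by (rule mult_span_least) auto
qed (use mult_span_zero in auto)

lemma mult_span_insertI:
  "y \<in> carrier R \<Longrightarrow> Y \<subseteq> carrier R \<Longrightarrow> b \<in> carrier M \<Longrightarrow> h \<in> mult_span R M Y \<Longrightarrow>
    y \<odot>\<^bsub>M\<^esub> b \<oplus>\<^bsub>M\<^esub> h \<in> mult_span R M (insert y Y)"
  using mult_span_mono[of "insert y Y" Y] by (intro mult_span_add mult_span_mem) auto

lemma mult_span_insertE:
  assumes "u \<in> mult_span R M (insert y Y)" "y \<in> carrier R" "Y \<subseteq> carrier R"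
  obtains b h where "b \<in> carrier M" "h \<in> mult_span R M Y" "u = y \<odot>\<^bsub>M\<^esub> b \<oplus>\<^bsub>M\<^esub> h"
proof -
  let ?H = "{y \<odot>\<^bsub>M\<^esub> b \<oplus>\<^bsub>M\<^esub> h | b h. b \<in> carrier M \<and> h \<in> mult_span R M Y}"
  note c = mult_span_in_carrier[OF assms(3)]
  have H: "v \<in> ?H" if "b \<in> carrier M" "h \<in> mult_span R M Y" "v = y \<odot>\<^bsub>M\<^esub> b \<oplus>\<^bsub>M\<^esub> h" for v b h
    using that by blast
  have "submodule ?H R M"
  proof (rule submoduleI)
    show "?H \<subseteq> carrier M" using assms(2) c by auto
    show "\<zero>\<^bsub>M\<^esub> \<in> ?H" using H[of "\<zero>\<^bsub>M\<^esub>" "\<zero>\<^bsub>M\<^esub>"] mult_span_zero[OF assms(3)] assms(2) by simp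
  next
    fix a assume "a \<in> ?H"
    then obtain b h where "b \<in> carrier M" "h \<in> mult_span R M Y" "a = y \<odot>\<^bsub>M\<^esub> b \<oplus>\<^bsub>M\<^esub> h" by blast
    then show "\<ominus>\<^bsub>M\<^esub> a \<in> ?H"
      using H[of "\<ominus>\<^bsub>M\<^esub> b" "\<ominus>\<^bsub>M\<^esub> h" "\<ominus>\<^bsub>M\<^esub> a"] mult_span_a_inv[OF assms(3)] assms(2) c
      by (simp add: smult_r_minus M.minus_add M.a_comm)
  next
    fix a a' assume "a \<in> ?H" "a' \<in> ?H"
    then obtain b h b' h' where "b \<in> carrier M" "h \<in> mult_span R M Y" "a = y \<odot>\<^bsub>M\<^esub> b \<oplus>\<^bsub>M\<^esub> h"
      "b' \<in> carrier M" "h' \<in> mult_span R M Y" "a' = y \<odot>\<^bsub>M\<^esub> b' \<oplus>\<^bsub>M\<^esub> h'" by blast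
    then show "a \<oplus>\<^bsub>M\<^esub> a' \<in> ?H"
      using H[of "b \<oplus>\<^bsub>M\<^esub> b'" "h \<oplus>\<^bsub>M\<^esub> h'" "a \<oplus>\<^bsub>M\<^esub> a'"] mult_span_add[OF assms(3)] assms(2) c
      by (simp add: smult_r_distr M.a_ac)
  next
    fix r a assume "a \<in> ?H" and r: "r \<in> carrier R"
    then obtain b h where "b \<in> carrier M" "h \<in> mult_span R M Y" "a = y \<odot>\<^bsub>M\<^esub> b \<oplus>\<^bsub>M\<^esub> h" by blast
    then show "r \<odot>\<^bsub>M\<^esub> a \<in> ?H"
      using H[of "r \<odot>\<^bsub>M\<^esub> b" "r \<odot>\<^bsub>M\<^esub> h" "r \<odot>\<^bsub>M\<^esub> a"] mult_span_smult[OF assms(3) r] assms(2) c r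
      by (simp add: smult_r_distr smult_assoc1[symmetric] R.m_comm)
  qed
  moreover have "v \<odot>\<^bsub>M\<^esub> b \<in> ?H" if "v \<in> insert y Y" "b \<in> carrier M" for v b
  proof (cases "v = y")
    case True
    then show ?thesis using H[of b "\<zero>\<^bsub>M\<^esub>"] that mult_span_zero[OF assms(3)] assms(2) by simp
  next
    case False
    then have "v \<odot>\<^bsub>M\<^esub> b \<in> mult_span R M Y" using that mult_span_mem by blast
    then show ?thesis using H[of "\<zero>\<^bsub>M\<^esub>" "v \<odot>\<^bsub>M\<^esub> b"] c assms(2) by simp
  qed
  ultimately have "mult_span R M (insert y Y) \<subseteq> ?H" by (rule mult_span_least)
  then show ?thesis using that assms(1) by blast
qed

lemma finsum_in_mult_span:
  assumes "finite S" "Y \<subseteq> carrier R" "\<And>i. i \<in> S \<Longrightarrow> g i \<in> mult_span R M Y"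
  shows "finsum M g S \<in> mult_span R M Y"
  using assms(1,3)
proof (induction rule: finite_induct)
  case empty
  then show ?case using mult_span_zero[OF assms(2)] by simp
next
  case (insert i S)
  then have "g \<in> insert i S \<rightarrow> carrier M" using mult_span_in_carrier[OF assms(2)] by blast
  then show ?case using insert mult_span_add[OF assms(2)] by (simp add: Pi_def)
qed

lemma mult_span_image_eq:
  assumes "finite S" "y \<in> S \<rightarrow> carrier R"
  shows "mult_span R M (y ` S) = {finsum M (\<lambda>i. y i \<odot>\<^bsub>M\<^esub> f i) S | f. \<forall>i\<in>S. f i \<in> carrier M}"
    (is "_ = ?H S")
proof
  show "?H S \<subseteq> mult_span R M (y ` S)"
    using assms by (auto intro!: finsum_in_mult_span mult_span_mem)
  show "mult_span R M (y ` S) \<subseteq> ?H S"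
    using assms
  proof (induction rule: finite_induct)
    case empty
    then show ?case using mult_span_empty by simp
  next
    case (insert i S)
    show ?case
    proof
      fix u assume "u \<in> mult_span R M (y ` insert i S)"
      then obtain b h where bh: "b \<in> carrier M" "h \<in> mult_span R M (y ` S)" "u = y i \<odot>\<^bsub>M\<^esub> b \<oplus>\<^bsub>M\<^esub> h"
        using mult_span_insertE[of u "y i" "y ` S"] insert.prems by auto
      then obtain f where f: "\<forall>i\<in>S. f i \<in> carrier M" "h = finsum M (\<lambda>i. y i \<odot>\<^bsub>M\<^esub> f i) S"
        using insert by auto
      have "finsum M (\<lambda>j. y j \<odot>\<^bsub>M\<^esub> (f(i := b)) j) (insert i S) = u"
        unfolding bh f using insert f(1) bh(1)
        by (subst M.finsum_insert) (auto intro!: arg_cong2[where f = "ring.add M"] M.finsum_cong')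
      then show "u \<in> ?H (insert i S)"
        using f(1) bh(1) by (intro CollectI exI[of _ "f(i := b)"]) auto
    qed
  qed
qed

lemma list_times_module_eq:
  assumes "set xs \<subseteq> carrier R"
  shows "list_times_module xs M = mult_span R M (set xs)"
proof -
  have "(\<lambda>i. xs ! i) ` {..<length xs} = set xs" by (auto simp: set_conv_nth)
  then show ?thesis
    using mult_span_image_eq[of "{..<length xs}" "\<lambda>i. xs ! i"] assms
    unfolding list_times_module_def by (auto simp: subset_iff)
qed

lemma regular_sequence_iff:
  assumes "set xs \<subseteq> carrier R"
  shows "regular_sequence xs M \<longleftrightarrow>
    (\<forall>i < length xs. nzd_mod R M (set (take i xs)) (xs ! i)) \<and> mult_span R M (set xs) \<noteq> carrier M"
proof -
  have "set (take i xs) \<subseteq> carrier R" for i using assms set_take_subset by (rule order_trans[rotated])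
  then show ?thesis
    unfolding regular_sequence_def nzd_mod_def by (simp add: list_times_module_eq assms)
qed

lemma nzd_mod_pow:
  assumes "nzd_mod R M Z y" "y \<in> carrier R"
  shows "nzd_mod R M Z (y [^] (n::nat))"
proof -
  have "y [^] n \<odot>\<^bsub>M\<^esub> u \<in> mult_span R M Z \<Longrightarrow> u \<in> carrier M \<Longrightarrow> u \<in> mult_span R M Z" for u
  proof (induction n arbitrary: u)
    case 0
    then show ?case by simp
  next
    case (Suc n)
    have "y [^] n \<odot>\<^bsub>M\<^esub> (y \<odot>\<^bsub>M\<^esub> u) \<in> mult_span R M Z"
      using Suc.prems assms(2) by (simp add: smult_assoc1)
    then have "y \<odot>\<^bsub>M\<^esub> u \<in> mult_span R M Z" using Suc assms(2) by simp
    then show ?case using assms(1) Suc.prems unfolding nzd_mod_def by blast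
  qed
  then show ?thesis unfolding nzd_mod_def by blast
qed

text \<open>Write \<open>y u = y c b + h\<close> with \<open>h\<close> in \<open>ZM\<close>; then
  \<open>y\<close> sends \<open>u - c b\<close> into \<open>ZM\<close>, so \<open>u - c b\<close> is
  already there.\<close>

lemma nzd_mod_cancel:
  assumes "nzd_mod R M Z y" "y \<in> carrier R" "c \<in> carrier R" "Z \<subseteq> carrier R" "u \<in> carrier M"
    and "y \<odot>\<^bsub>M\<^esub> u \<in> mult_span R M (insert (y \<otimes> c) Z)"
  shows "u \<in> mult_span R M (insert c Z)"
proof -
  obtain b h where bh: "b \<in> carrier M" "h \<in> mult_span R M Z" "y \<odot>\<^bsub>M\<^esub> u = (y \<otimes> c) \<odot>\<^bsub>M\<^esub> b \<oplus>\<^bsub>M\<^esub> h"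
    using mult_span_insertE[OF assms(6)] assms(2-4) by auto
  note h = mult_span_in_carrier[OF assms(4) bh(2)]
  let ?v = "u \<oplus>\<^bsub>M\<^esub> \<ominus>\<^bsub>M\<^esub> (c \<odot>\<^bsub>M\<^esub> b)"
  have "y \<odot>\<^bsub>M\<^esub> ?v = y \<odot>\<^bsub>M\<^esub> u \<oplus>\<^bsub>M\<^esub> \<ominus>\<^bsub>M\<^esub> ((y \<otimes> c) \<odot>\<^bsub>M\<^esub> b)"
    using assms(2,3,5) bh(1) by (simp add: smult_r_distr smult_r_minus smult_assoc1)
  also have "\<dots> = h" unfolding bh(3) using h bh(1) assms(2,3) by (simp add: M.a_ac M.r_neg1 M.r_neg)
  finally have "?v \<in> mult_span R M Z"
    using assms(1,3,5) bh(1,2) unfolding nzd_mod_def by simp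
  then have "c \<odot>\<^bsub>M\<^esub> b \<oplus>\<^bsub>M\<^esub> ?v \<in> mult_span R M (insert c Z)"
    using assms bh(1) by (intro mult_span_insertI)
  moreover have "c \<odot>\<^bsub>M\<^esub> b \<oplus>\<^bsub>M\<^esub> ?v = u"
    using assms(3,5) bh(1) by (simp add: M.a_lcomm M.r_neg)
  ultimately show ?thesis by simp
qed

text \<open>This makes the transition maps, multiplication by \<open>(x_1 ... x_e)^n\<close>,
  injective in the direct system of the modules \<open>M/(x_1^t, ..., x_e^t)M\<close>. The factors
  \<open>x_i^n\<close> are cancelled one index at a time, each being regular modulo powers of the
  other elements.\<close>

lemma mult_span_monomial_colon:
  fixes x :: "'i \<Rightarrow> 'a"
  assumes S: "finite S" "x \<in> S \<rightarrow> carrier R"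
    and nzd: "\<And>i k. i \<in> S \<Longrightarrow> \<forall>j\<in>S. k j > 0 \<Longrightarrow> nzd_mod R M ((\<lambda>j. x j [^] (k j :: nat)) ` (S - {i})) (x i)"
    and t: "t > 0" and u: "u \<in> carrier M"
    and mem: "(\<Otimes>i\<in>S. x i [^] (n::nat)) \<odot>\<^bsub>M\<^esub> u \<in> mult_span R M ((\<lambda>i. x i [^] (n + t)) ` S)"
  shows "u \<in> mult_span R M ((\<lambda>i. x i [^] t) ` S)"
proof -
  \<comment> \<open>\<open>F\<close> is the set of indices whose exponent is still
    \<open>n + t\<close>; removing an index from it is one application of
    \<open>nzd_mod_cancel\<close>.\<close>
  have "u \<in> mult_span R M ((\<lambda>i. x i [^] t) ` S)"
    if "finite F" "F \<subseteq> S" "u \<in> carrier M"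
      "(\<Otimes>i\<in>F. x i [^] n) \<odot>\<^bsub>M\<^esub> u \<in> mult_span R M ((\<lambda>i. x i [^] (if i \<in> F then n + t else t)) ` S)" for F u
    using that
  proof (induction F rule: finite_induct)
    case empty
    then show ?case by simp
  next
    case (insert i F)
    let ?k = "\<lambda>j. if j \<in> F then n + t else t"
    let ?Z = "(\<lambda>j. x j [^] ?k j) ` (S - {i})"
    have xF: "x \<in> F \<rightarrow> carrier R" "x i \<in> carrier R" "i \<in> S" using insert.prems S by auto
    have Z: "?Z \<subseteq> carrier R" using S by auto
    have prod: "(\<Otimes>i\<in>F. x i [^] n) \<in> carrier R" using xF by (intro R.finprod_closed) auto
    have "(\<Otimes>j\<in>insert i F. x j [^] n) = x i [^] n \<otimes> (\<Otimes>i\<in>F. x i [^] n)"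
      using insert xF by (subst R.finprod_insert) auto
    then have "x i [^] n \<odot>\<^bsub>M\<^esub> ((\<Otimes>i\<in>F. x i [^] n) \<odot>\<^bsub>M\<^esub> u) = (\<Otimes>j\<in>insert i F. x j [^] n) \<odot>\<^bsub>M\<^esub> u"
      using xF prod insert.prems(2) by (simp add: smult_assoc1)
    moreover have "(\<lambda>j. x j [^] (if j \<in> insert i F then n + t else t)) ` S = insert (x i [^] n \<otimes> x i [^] t) ?Z"
    proof -
      have "(\<lambda>j. x j [^] (if j \<in> insert i F then n + t else t)) ` S
          = insert (x i [^] (n + t)) ((\<lambda>j. x j [^] (if j \<in> insert i F then n + t else t)) ` (S - {i}))"
        using xF(3) image_insert[of "\<lambda>j. x j [^] (if j \<in> insert i F then n + t else t)" i "S - {i}"]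
        by (simp add: insert_absorb)
      also have "(\<lambda>j. x j [^] (if j \<in> insert i F then n + t else t)) ` (S - {i}) = ?Z"
        by (intro image_cong) auto
      finally show ?thesis using xF(2) by (simp add: R.nat_pow_mult)
    qed
    ultimately have "x i [^] n \<odot>\<^bsub>M\<^esub> ((\<Otimes>i\<in>F. x i [^] n) \<odot>\<^bsub>M\<^esub> u)
        \<in> mult_span R M (insert (x i [^] n \<otimes> x i [^] t) ?Z)"
      using insert.prems(3) by simp
    moreover have "nzd_mod R M ?Z (x i [^] n)"
      using nzd[OF xF(3), of ?k] t xF(2) by (intro nzd_mod_pow) auto
    ultimately have "(\<Otimes>i\<in>F. x i [^] n) \<odot>\<^bsub>M\<^esub> u \<in> mult_span R M (insert (x i [^] t) ?Z)"
      using nzd_mod_cancel[of ?Z "x i [^] n" "x i [^] t"] xF(2) Z prod insert.prems(2) by simp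
    also have "insert (x i [^] t) ?Z = (\<lambda>j. x j [^] ?k j) ` S"
    proof -
      have "(\<lambda>j. x j [^] ?k j) ` S = insert (x i [^] ?k i) ?Z" using xF(3) by blast
      then show ?thesis using insert.hyps(2) by simp
    qed
    finally show ?case using insert by blast
  qed
  from this[OF S(1) order_refl u] show ?thesis using mem by (simp cong: image_cong)
qed

end

section \<open>The ring as a module over itself\<close>

lemma self_algebra_simps [simp]:
  "carrier (self_algebra R) = carrier R" "monoid.mult (self_algebra R) = monoid.mult R"
  "monoid.one (self_algebra R) = monoid.one R" "ring.zero (self_algebra R) = ring.zero R"
  "ring.add (self_algebra R) = ring.add R" "smult (self_algebra R) = monoid.mult R"
  by (simp_all add: self_algebra_def)

lemma (in cring) algebra_self: "algebra R (self_algebra R)"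
proof -
  have "cring (self_algebra R)"
    by (intro cringI abelian_groupI comm_monoidI)
      (auto simp: a_ac m_ac l_distr r_distr intro: bexI[of _ "\<ominus> x" for x] l_neg)
  then show ?thesis
    by (intro algebraI is_cring) (auto simp: l_distr r_distr m_assoc)
qed

lemma (in cring) module_self: "module R (self_algebra R)"
  using algebra_self algebra.module by blast

lemma (in cring) submodule_self_iff: "submodule H R (self_algebra R) \<longleftrightarrow> ideal H R"
proof -
  interpret S: module R "self_algebra R" by (rule module_self)
  have eq: "subgroup H (add_monoid (self_algebra R)) = subgroup H (add_monoid R)"
    by (simp add: subgroup_def m_inv_def)
  show ?thesis
  proof
    assume H: "submodule H R (self_algebra R)"
    have "subgroup H (add_monoid R)" using submodule.axioms(1)[OF H] eq by simp
    moreover have c: "a \<in> carrier R" if "a \<in> H" for a using S.submoduleE(1)[OF H] that by auto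
    moreover have m: "r \<otimes> a \<in> H" if "a \<in> H" "r \<in> carrier R" for a r
      using submodule.smult_closed[OF H] that by simp
    moreover have "a \<otimes> r \<in> H" if "a \<in> H" "r \<in> carrier R" for a r
      using m[OF that] m_comm[OF c[OF that(1)] that(2)] by simp
    ultimately show "ideal H R" by (intro idealI ring_axioms) auto
  next
    assume "ideal H R"
    then interpret ideal H R .
    show "submodule H R (self_algebra R)"
      using I_l_closed eq a_subgroup by (auto intro!: submodule.intro simp: submodule_axioms_def)
  qed
qed

lemma (in cring) mult_span_self:
  assumes "Y \<subseteq> carrier R"
  shows "mult_span R (self_algebra R) Y = Idl Y"
proof
  interpret S: module R "self_algebra R" by (rule module_self)
  show "mult_span R (self_algebra R) Y \<subseteq> Idl Y"
    using genideal_ideal[OF assms] genideal_self[OF assms] assms ideal.I_r_closed[OF genideal_ideal[OF assms]]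
    by (intro S.mult_span_least) (auto simp: submodule_self_iff)
  show "Idl Y \<subseteq> mult_span R (self_algebra R) Y"
    using S.submodule_mult_span[OF assms] S.mult_span_mem[of _ Y \<one>] assms
    by (intro genideal_minimal) (auto simp: submodule_self_iff subset_iff)
qed

lemma (in cring) nzd_mod_self:
  assumes "Y \<subseteq> carrier R"
  shows "nzd_mod R (self_algebra R) Y y \<longleftrightarrow> (\<forall>u\<in>carrier R. y \<otimes> u \<in> Idl Y \<longrightarrow> u \<in> Idl Y)"
  unfolding nzd_mod_def by (simp add: mult_span_self[OF assms])

section \<open>Prime avoidance and permutability of regular sequences\<close>

text \<open>Such a set contains all minimal primes over \<open>I\<close>; it may contain other
  primes as well, which does no harm for prime avoidance. If \<open>a b\<close> is in
  \<open>I\<close> but \<open>a\<close> and \<open>b\<close> are not, every prime over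
  \<open>I\<close> contains \<open>I + (a)\<close> or \<open>I + (b)\<close>, and the sets found for
  these two are united.\<close>

lemma (in noetherian_cring) finite_primes_below:
  assumes "ideal I R"
  shows "\<exists>F. finite F \<and> (\<forall>P\<in>F. primeideal P R \<and> I \<subseteq> P) \<and>
    (\<forall>Q. primeideal Q R \<and> I \<subseteq> Q \<longrightarrow> (\<exists>P\<in>F. P \<subseteq> Q))"
  using assms
proof (induction rule: ideal_noetherian_induct)
  case (step I)
  show ?case
  proof (cases "primeideal I R")
    case True
    then show ?thesis by (intro exI[of _ "{I}"]) auto
  next
    case False
    then consider "carrier R = I"
      | a b where "a \<in> carrier R" "b \<in> carrier R" "a \<otimes> b \<in> I" "a \<notin> I" "b \<notin> I"
      using ideal.primeidealCD[OF step.hyps is_cring] by blast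
    then show ?thesis
    proof cases
      case 1
      have "\<not> I \<subseteq> Q" if "primeideal Q R" for Q
      proof -
        interpret Q: primeideal Q R by fact
        show ?thesis using 1 Q.one_notin by blast
      qed
      then show ?thesis by (intro exI[of _ "{}"]) auto
    next
      case 2
      let ?G = "\<lambda>J F. finite F \<and> (\<forall>P\<in>F. primeideal P R \<and> J \<subseteq> P) \<and>
        (\<forall>Q. primeideal Q R \<and> J \<subseteq> Q \<longrightarrow> (\<exists>P\<in>F. P \<subseteq> Q))"
      define A B where "A = set_add R I (PIdl a)" and "B = set_add R I (PIdl b)"
      have A: "ideal A R" "I \<subset> A" and B: "ideal B R" "I \<subset> B"
        using ideal_add_PIdl[OF step.hyps] 2 unfolding A_def B_def by blast+
      obtain F where F: "?G A F" using step.IH[OF A] by metis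
      obtain G where G: "?G B G" using step.IH[OF B] by metis
      have "\<exists>P\<in>F \<union> G. P \<subseteq> Q" if Q: "primeideal Q R" "I \<subseteq> Q" for Q
      proof -
        interpret Q: primeideal Q R by fact
        have "a \<in> Q \<or> b \<in> Q" using Q.I_prime 2 Q(2) by blast
        then have "A \<subseteq> Q \<or> B \<subseteq> Q" using add_PIdl_subset[OF Q.is_ideal Q(2)] unfolding A_def B_def by blast
        then show ?thesis
        proof
          assume "A \<subseteq> Q"
          then obtain P where "P \<in> F" "P \<subseteq> Q" using F Q(1) by metis
          then show ?thesis by blast
        next
          assume "B \<subseteq> Q"
          then obtain P where "P \<in> G" "P \<subseteq> Q" using G Q(1) by metis
          then show ?thesis by blast
        qed
      qed
      moreover have "\<forall>P\<in>F \<union> G. primeideal P R \<and> I \<subseteq> P"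
        using F G A(2) B(2) by (metis Un_iff order_trans psubset_imp_subset)
      ultimately show ?thesis using F G by (intro exI[of _ "F \<union> G"]) auto
    qed
  qed
qed

lemma (in cring) prime_avoidance:
  assumes "finite F" "ideal K R" "\<And>P. P \<in> F \<Longrightarrow> primeideal P R" "\<And>P. P \<in> F \<Longrightarrow> \<not> K \<subseteq> P"
  shows "\<exists>v\<in>K. \<forall>P\<in>F. v \<notin> P"
  using assms(1,3,4)
proof (induction F rule: finite_induct)
  case empty
  then show ?case using additive_subgroup.zero_closed[OF ideal.axioms(1)[OF assms(2)]] by blast
next
  case (insert P F)
  interpret K: ideal K R by fact
  have Pp: "primeideal P R" using insert.prems by blast
  interpret P: primeideal P R by fact
  obtain v where v: "v \<in> K" "\<forall>P\<in>F. v \<notin> P" using insert by auto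
  show ?case
  proof (cases "v \<in> P")
    case False
    then show ?thesis using v by blast
  next
    case True
    \<comment> \<open>A product gives an element \<open>c\<close> of \<open>K\<close> outside
      \<open>P\<close> that lies in every member of \<open>G\<close>. Then \<open>v + c\<close> is
      outside \<open>P\<close>, hence outside the members of \<open>F\<close> contained in
      \<open>P\<close>, and it is outside the members of \<open>G\<close> because \<open>v\<close>
      is.\<close>
    define G where "G = {N \<in> F. \<not> N \<subseteq> P}"
    have "\<exists>c\<in>K. c \<notin> P \<and> (\<forall>N\<in>H. c \<in> N)" if "finite H" "H \<subseteq> G" for H
      using that
    proof (induction H rule: finite_induct)
      case empty
      then show ?case using insert.prems by blast
    next
      case (insert N H)
      then obtain c where c: "c \<in> K" "c \<notin> P" "\<forall>N\<in>H. c \<in> N" by auto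
      obtain b where b: "b \<in> N" "b \<notin> P" using insert.prems unfolding G_def by blast
      have Nid: "ideal N' R" if "N' \<in> insert N H" for N'
        using \<open>\<And>P'. P' \<in> insert P F \<Longrightarrow> primeideal P' R\<close> that insert.prems primeideal.axioms(1)
        unfolding G_def by blast
      have bc: "b \<in> carrier R" "c \<in> carrier R" using ideal.Icarr[OF Nid] b c K.Icarr by auto
      have "c \<otimes> b \<in> K" using K.I_r_closed c(1) bc by blast
      moreover have "c \<otimes> b \<notin> P" using P.I_prime bc b c by blast
      moreover have "c \<otimes> b \<in> N" using ideal.I_l_closed[OF Nid] b(1) bc by blast
      moreover have "c \<otimes> b \<in> N'" if "N' \<in> H" for N' using ideal.I_r_closed[OF Nid] c(3) that bc by blast
      ultimately show ?case by blast
    qed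
    moreover have "finite G" unfolding G_def using insert.hyps(1) by simp
    ultimately obtain c where c: "c \<in> K" "c \<notin> P" "\<forall>N\<in>G. c \<in> N" by blast
    have vc: "v \<in> carrier R" "c \<in> carrier R" using v c K.Icarr by auto
    have "v \<oplus> c \<notin> P"
    proof
      assume "v \<oplus> c \<in> P"
      then have "(v \<oplus> c) \<oplus> \<ominus> v \<in> P" using P.a_closed P.a_inv_closed True by blast
      moreover have "(v \<oplus> c) \<oplus> \<ominus> v = c" using vc by algebra
      ultimately show False using c(2) by simp
    qed
    moreover have "v \<oplus> c \<notin> N" if "N \<in> F" for N
    proof
      assume vcN: "v \<oplus> c \<in> N"
      interpret N: primeideal N R using insert.prems that by blast
      have "N \<in> G" using vcN \<open>v \<oplus> c \<notin> P\<close> that unfolding G_def by blast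
      then have "(v \<oplus> c) \<oplus> \<ominus> c \<in> N" using vcN N.a_closed N.a_inv_closed c(3) by blast
      moreover have "(v \<oplus> c) \<oplus> \<ominus> c = v" using vc by algebra
      ultimately show False using v(2) that by simp
    qed
    ultimately show ?thesis using K.a_closed[OF v(1) c(1)] by blast
  qed
qed

text \<open>A regular sequence in \<open>P\<close> bounds the height of \<open>P\<close> from below.
  Since the last element \<open>x\<close> is regular modulo the others, \<open>s x^n\<close> in
  \<open>(xs)\<close> would put \<open>s\<close> into \<open>(xs)\<close>, hence into
  \<open>P\<close>; so some prime \<open>Q\<close> below \<open>P\<close> contains \<open>xs\<close>
  but not \<open>x\<close>, and the construction continues in \<open>Q\<close>.\<close>

lemma (in noetherian_cring) regular_list_prime_chain:
  assumes "set xs \<subseteq> P" "primeideal P R"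
    and "\<And>i. i < length xs \<Longrightarrow> nzd_mod R (self_algebra R) (set (take i xs)) (xs ! i)"
  shows "\<exists>C. finite C \<and> subset.chain {Q. primeideal Q R} C \<and> card C = Suc (length xs) \<and> P \<in> C \<and> (\<forall>Q\<in>C. Q \<subseteq> P)"
  using assms
proof (induction xs arbitrary: P rule: rev_induct)
  case Nil
  then show ?case by (intro exI[of _ "{P}"]) (auto simp: subset.chain_def)
next
  case (snoc x xs)
  interpret P: primeideal P R by fact
  have xs: "set xs \<subseteq> carrier R" "x \<in> P" "x \<in> carrier R" "set xs \<subseteq> P" using snoc.prems P.Icarr by auto
  have nz: "u \<in> Idl (set xs)" if "u \<in> carrier R" "x \<otimes> u \<in> Idl (set xs)" for u
    using snoc.prems(3)[of "length xs"] that nzd_mod_self[OF xs(1)] by simp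
  have "s \<otimes> x [^] (n::nat) \<notin> Idl (set xs)" if s: "s \<in> carrier R - P" for s n
  proof
    assume "s \<otimes> x [^] n \<in> Idl (set xs)"
    then have "s \<in> Idl (set xs)"
    proof (induction n)
      case 0
      then show ?case using s by simp
    next
      case (Suc n)
      have "x \<otimes> (s \<otimes> x [^] n) \<in> Idl (set xs)" using Suc.prems s xs(3) by (simp add: m_ac)
      then show ?case using Suc.IH nz[of "s \<otimes> x [^] n"] s xs(3) by auto
    qed
    then show False using s genideal_minimal[OF P.is_ideal xs(4)] by blast
  qed
  then obtain Q where Q: "primeideal Q R" "Idl (set xs) \<subseteq> Q" "Q \<subseteq> P" "x \<notin> Q"
    using prime_below_avoiding[OF genideal_ideal[OF xs(1)] P.primeideal xs(3)] by metis
  have "nzd_mod R (self_algebra R) (set (take i xs)) (xs ! i)" if "i < length xs" for i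
    using snoc.prems(3)[of i] that by (simp add: nth_append)
  then obtain C where C: "finite C" "subset.chain {Q. primeideal Q R} C" "card C = Suc (length xs)" "\<forall>Z\<in>C. Z \<subseteq> Q"
    using snoc.IH[of Q] Q(1,2) genideal_self[OF xs(1)] by (metis order_trans)
  have "P \<notin> C" using C(4) Q(3,4) xs(2) by blast
  moreover have "subset.chain {Q. primeideal Q R} (insert P C)"
    using C(2,4) Q(3) P.primeideal unfolding subset.chain_def by blast
  ultimately show ?case using C Q(3) by (intro exI[of _ "insert P C"]) auto
qed

section \<open>Noetherian local rings and the interchange of regular elements\<close>

locale noetherian_local_ring = noetherian_cring +
  assumes unique_maximalideal: "\<exists>!M. maximalideal M R"

lemma local_ring_iff: "local_ring R \<longleftrightarrow> noetherian_local_ring R"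
  unfolding local_ring_def noetherian_local_ring_def noetherian_cring_def noetherian_local_ring_axioms_def by blast

context noetherian_local_ring
begin

abbreviation (input) \<mm> where "\<mm> \<equiv> max_ideal R"

lemma maximalideal_max_ideal: "maximalideal \<mm> R"
  unfolding max_ideal_def using theI'[OF unique_maximalideal] .

sublocale max_ideal: primeideal "max_ideal R" R
  using maximalideal_prime[OF maximalideal_max_ideal] .

lemma ideal_subset_max_ideal:
  assumes "ideal I R" "\<one> \<notin> I"
  shows "I \<subseteq> \<mm>"
proof -
  let ?A = "{J. ideal J R \<and> \<one> \<notin> J}"
  obtain M where M: "M \<in> ?A" "I \<subseteq> M" "\<forall>J\<in>?A. M \<subseteq> J \<longrightarrow> J = M"
    using ideal_maximal_element[of ?A I] assms by auto
  have "maximalideal M R"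
  proof (rule maximalidealI)
    show "ideal M R" "carrier R \<noteq> M" using M(1) by auto
    fix J assume J: "ideal J R" "M \<subseteq> J" "J \<subseteq> carrier R"
    show "J = M \<or> J = carrier R"
    proof (cases "\<one> \<in> J")
      case True
      then show ?thesis using ideal.one_imp_carrier[OF J(1)] by blast
    next
      case False
      then show ?thesis using M(3) J by blast
    qed
  qed
  then have "M = \<mm>" using maximalideal_max_ideal unique_maximalideal by blast
  then show ?thesis using M(2) by blast
qed

lemma prime_subset_max_ideal: "primeideal P R \<Longrightarrow> P \<subseteq> \<mm>"
  using ideal_subset_max_ideal primeideal.axioms(1) primeideal.one_notin by blast

lemma unit_if_notin_max_ideal:
  assumes "r \<in> carrier R" "r \<notin> \<mm>"
  obtains s where "s \<in> carrier R" "s \<otimes> r = \<one>"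
proof -
  have "\<one> \<in> PIdl r"
    using ideal_subset_max_ideal[OF cgenideal_ideal[OF assms(1)]] cgenideal_self[OF assms(1)] assms(2) by blast
  then show ?thesis using that unfolding cgenideal_def by auto
qed

text \<open>Elements outside the maximal ideal are units. So \<open>nakayama_saturation\<close>,
  taken at the maximal ideal, becomes the usual form of Nakayama's lemma.\<close>

lemma saturation_max_ideal:
  assumes "ideal I R"
  shows "saturation R \<mm> I \<subseteq> I"
proof
  interpret I: ideal I R by fact
  fix a assume "a \<in> saturation R \<mm> I"
  then obtain s where s: "a \<in> carrier R" "s \<in> carrier R" "s \<notin> \<mm>" "s \<otimes> a \<in> I" unfolding saturation_def by blast
  obtain t where t: "t \<in> carrier R" "t \<otimes> s = \<one>" using unit_if_notin_max_ideal s by blast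
  have "t \<otimes> (s \<otimes> a) = a" using s(1,2) t by (simp add: m_assoc[symmetric])
  then show "a \<in> I" using I.I_l_closed[OF s(4) t(1)] by simp
qed

text \<open>With \<open>I = (Z)\<close>, the colon ideal \<open>K = (I : v)\<close> satisfies
  \<open>K = I + z K\<close>: an element \<open>k\<close> of \<open>K\<close> has the form
  \<open>z b + h\<close> as \<open>v\<close> is regular modulo \<open>(z, Z)\<close>, and cancelling
  \<open>z\<close> modulo \<open>I\<close> puts \<open>b\<close> into \<open>K\<close>. Nakayama's
  lemma gives \<open>K = I\<close>. The second conclusion is a manipulation of relations with both
  regularity hypotheses.\<close>

lemma nzd_mod_swap:
  assumes Z: "Z \<subseteq> carrier R" and z: "z \<in> \<mm>" and v: "v \<in> carrier R"
    and nzv: "nzd_mod R (self_algebra R) (insert z Z) v" and nzz: "nzd_mod R (self_algebra R) Z z"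
  shows "nzd_mod R (self_algebra R) Z v" "nzd_mod R (self_algebra R) (insert v Z) z"
proof -
  interpret S: module R "self_algebra R" by (rule module_self)
  have zR: "z \<in> carrier R" using z max_ideal.Icarr by blast
  define I where "I = Idl Z"
  have I: "ideal I R" using genideal_ideal[OF Z] I_def by simp
  interpret I: ideal I R by fact
  have span: "mult_span R (self_algebra R) Z = I" using mult_span_self[OF Z] I_def by simp
  have insE: "\<exists>b\<in>carrier R. \<exists>h\<in>I. u = y \<otimes> b \<oplus> h"
    if "u \<in> mult_span R (self_algebra R) (insert y Z)" "y \<in> carrier R" for u y
    using S.mult_span_insertE[OF that Z] span by (metis self_algebra_simps)
  have insI: "y \<otimes> b \<oplus> h \<in> mult_span R (self_algebra R) (insert y Z)"
    if "y \<in> carrier R" "b \<in> carrier R" "h \<in> I" for y b h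
    using S.mult_span_insertI[OF that(1) Z, of b h] that span by simp
  have z': "u \<in> I" if "u \<in> carrier R" "z \<otimes> u \<in> I" for u
    using nzz that span unfolding nzd_mod_def by simp
  have v': "u \<in> mult_span R (self_algebra R) (insert z Z)"
    if "u \<in> carrier R" "v \<otimes> u \<in> mult_span R (self_algebra R) (insert z Z)" for u
    using nzv that unfolding nzd_mod_def by simp
  have IZ: "I \<subseteq> mult_span R (self_algebra R) (insert z Z)"
    using S.mult_span_mono[of "insert z Z" Z] Z zR span by auto
  define K where "K = {u \<in> carrier R. v \<otimes> u \<in> I}"
  have K: "ideal K R" unfolding K_def using ideal.helper_max_prime[OF I is_cring v] .
  have "K \<subseteq> saturation R \<mm> I"
  proof (rule nakayama_saturation[OF max_ideal.primeideal I K z])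
    fix k assume "k \<in> K"
    then have k: "k \<in> carrier R" "v \<otimes> k \<in> I" unfolding K_def by auto
    then obtain b h where bh: "b \<in> carrier R" "h \<in> I" "k = z \<otimes> b \<oplus> h"
      using v'[of k] IZ insE[of k z] zR by blast
    have hR: "h \<in> carrier R" using bh(2) I.Icarr by blast
    have "z \<otimes> (v \<otimes> b) = v \<otimes> k \<oplus> \<ominus> (v \<otimes> h)" unfolding bh(3) using bh(1) hR v zR by algebra
    also have "\<dots> \<in> I" using k(2) I.I_l_closed[OF bh(2) v] by simp
    finally have "b \<in> K" using z'[of "v \<otimes> b"] bh(1) v unfolding K_def by simp
    moreover have "\<one> \<otimes> k = h \<oplus> z \<otimes> b" unfolding bh(3) using bh(1) hR zR by algebra
    ultimately show "\<exists>s\<in>carrier R - \<mm>. \<exists>i\<in>I. \<exists>k'\<in>K. s \<otimes> k = i \<oplus> z \<otimes> k'"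
      using bh(2) max_ideal.one_notin one_closed by blast
  qed
  then have KI: "K \<subseteq> I" using saturation_max_ideal[OF I] by blast
  show "nzd_mod R (self_algebra R) Z v"
    unfolding nzd_mod_def span using KI unfolding K_def by auto
  show "nzd_mod R (self_algebra R) (insert v Z) z"
    unfolding nzd_mod_def
  proof (intro ballI impI)
    fix u assume u: "u \<in> carrier (self_algebra R)"
      "z \<odot>\<^bsub>self_algebra R\<^esub> u \<in> mult_span R (self_algebra R) (insert v Z)"
    then have uR: "u \<in> carrier R" by simp
    obtain b h where bh: "b \<in> carrier R" "h \<in> I" "z \<otimes> u = v \<otimes> b \<oplus> h"
      using insE[of "z \<otimes> u" v] u v by auto
    have hR: "h \<in> carrier R" using bh(2) I.Icarr by blast
    have "v \<otimes> b = z \<otimes> u \<oplus> \<ominus> h" unfolding bh(3) using bh(1) hR v by algebra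
    then have "b \<in> mult_span R (self_algebra R) (insert z Z)"
      using v'[OF bh(1)] insI[OF zR uR, of "\<ominus> h"] bh(2) by simp
    then obtain c h' where c: "c \<in> carrier R" "h' \<in> I" "b = z \<otimes> c \<oplus> h'" using insE zR by blast
    have h'R: "h' \<in> carrier R" using c(2) I.Icarr by blast
    have "z \<otimes> (u \<oplus> \<ominus> (v \<otimes> c)) = z \<otimes> u \<oplus> \<ominus> (z \<otimes> (v \<otimes> c))" using uR v c(1) zR by algebra
    also have "\<dots> = v \<otimes> h' \<oplus> h" unfolding bh(3) c(3) using v c(1) h'R hR zR by algebra
    also have "\<dots> \<in> I" using I.I_l_closed[OF c(2) v] bh(2) by simp
    finally have "u \<oplus> \<ominus> (v \<otimes> c) \<in> I" using z' uR v c(1) by simp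
    then have "v \<otimes> c \<oplus> (u \<oplus> \<ominus> (v \<otimes> c)) \<in> mult_span R (self_algebra R) (insert v Z)"
      using insI v c(1) by blast
    moreover have "v \<otimes> c \<oplus> (u \<oplus> \<ominus> (v \<otimes> c)) = u" using uR v c(1) by algebra
    ultimately show "u \<in> mult_span R (self_algebra R) (insert v Z)" by simp
  qed
qed

end

text \<open>Every enumeration of the family is a regular sequence, up to properness. The family is
  indexed so that one member at a time can be replaced by a function update, as is done for
  powers.\<close>

definition permutably_regular :: "('a, 'r) ring_scheme \<Rightarrow> ('i \<Rightarrow> 'a) \<Rightarrow> 'i set \<Rightarrow> bool" where
  "permutably_regular R x S \<longleftrightarrow> (\<forall>T\<subseteq>S. \<forall>i\<in>S - T. nzd_mod R (self_algebra R) (x ` T) (x i))"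

lemma permutably_regular_subset: "permutably_regular R x S \<Longrightarrow> T \<subseteq> S \<Longrightarrow> permutably_regular R x T"
  unfolding permutably_regular_def by blast

lemma permutably_regular_image:
  assumes "permutably_regular R x S"
  shows "permutably_regular R (\<lambda>y. y) (x ` S)"
  unfolding permutably_regular_def
proof (intro allI impI ballI)
  fix T y assume T: "T \<subseteq> x ` S" and y: "y \<in> x ` S - T"
  define T' where "T' = {i \<in> S. x i \<in> T}"
  have "x ` T' = T" using T by (auto simp: T'_def)
  moreover obtain i where "i \<in> S - T'" "y = x i" using y by (auto simp: T'_def)
  moreover have "T' \<subseteq> S" by (auto simp: T'_def)
  ultimately show "nzd_mod R (self_algebra R) ((\<lambda>y. y) ` T) y"
    using assms unfolding permutably_regular_def by (metis image_ident)
qed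

context noetherian_local_ring
begin

text \<open>Starting from regularity of \<open>v\<close> modulo the whole family, the first half of
  \<open>nzd_mod_swap\<close> drops one member at a time, so \<open>v\<close> is regular modulo
  every subfamily. The second half then makes each \<open>x i\<close> regular modulo subfamilies
  that contain \<open>v\<close>.\<close>

lemma permutably_regular_insert:
  assumes "finite S" "x ` S \<subseteq> \<mm>" "v \<in> \<mm>" and Y: "permutably_regular R x S" and "l \<notin> S"
    and v: "nzd_mod R (self_algebra R) (x ` S) v"
  shows "permutably_regular R (x(l := v)) (insert l S)"
proof -
  have m: "\<mm> \<subseteq> carrier R" using max_ideal.a_subset .
  have vZ: "nzd_mod R (self_algebra R) (x ` T) v" if "T \<subseteq> S" for T
    using that
  proof (induction "card (S - T)" arbitrary: T)
    case 0
    then have "T = S" using assms(1) by auto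
    then show ?case using v by simp
  next
    case (Suc n)
    then obtain i where i: "i \<in> S - T" by (metis card.empty equals0I nat.distinct(1))
    have "n = card (S - insert i T)" using Suc.hyps(2) i by (simp add: card_Diff_insert)
    then have "nzd_mod R (self_algebra R) (insert (x i) (x ` T)) v" using Suc.hyps(1)[of "insert i T"] Suc.prems i by auto
    moreover have "nzd_mod R (self_algebra R) (x ` T) (x i)" using Y i Suc.prems unfolding permutably_regular_def by blast
    moreover have "x ` T \<subseteq> carrier R" "x i \<in> \<mm>" "v \<in> carrier R" using assms(2,3) m i Suc.prems by blast+
    ultimately show ?case using nzd_mod_swap(1) by blast
  qed
  have upd: "x(l := v) ` T = x ` T" if "T \<subseteq> S" for T using that assms(5) by (intro image_cong) auto
  show ?thesis
    unfolding permutably_regular_def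
  proof (intro allI impI ballI)
    fix T i assume T: "T \<subseteq> insert l S" and i: "i \<in> insert l S - T"
    show "nzd_mod R (self_algebra R) (x(l := v) ` T) ((x(l := v)) i)"
    proof (cases "l \<in> T")
      case False
      then have TS: "T \<subseteq> S" using T by blast
      then show ?thesis
        unfolding upd[OF TS] using vZ[OF TS] i Y unfolding permutably_regular_def by auto
    next
      case True
      define T' where "T' = T - {l}"
      have T': "T = insert l T'" "T' \<subseteq> S" "i \<in> S" "i \<notin> T'" "i \<noteq> l" using True T i T'_def by auto
      have "nzd_mod R (self_algebra R) (insert (x i) (x ` T')) v" using vZ[of "insert i T'"] T' by simp
      moreover have "nzd_mod R (self_algebra R) (x ` T') (x i)" using T' Y unfolding permutably_regular_def by blast
      moreover have "x ` T' \<subseteq> carrier R" "x i \<in> \<mm>" "v \<in> carrier R" using assms(2,3) m T' by blast+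
      ultimately have "nzd_mod R (self_algebra R) (insert v (x ` T')) (x i)"
        using nzd_mod_swap(2) by blast
      moreover have "x(l := v) ` T = insert v (x ` T')"
        using T'(1) upd[OF T'(2)] by (metis fun_upd_same image_insert)
      ultimately show ?thesis using T'(5) by simp
    qed
  qed
qed

lemma permutably_regular_list:
  assumes "set xs \<subseteq> \<mm>"
    and "\<And>i. i < length xs \<Longrightarrow> nzd_mod R (self_algebra R) (set (take i xs)) (xs ! i)"
  shows "permutably_regular R (\<lambda>i. xs ! i) {..<length xs}"
  using assms
proof (induction xs rule: rev_induct)
  case Nil
  then show ?case by (simp add: permutably_regular_def)
next
  case (snoc x xs)
  have "nzd_mod R (self_algebra R) (set (take i xs)) (xs ! i)" if "i < length xs" for i
    using snoc.prems(2)[of i] that by (simp add: nth_append)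
  then have IH: "permutably_regular R (\<lambda>i. xs ! i) {..<length xs}" using snoc by simp
  have im: "(\<lambda>i. xs ! i) ` {..<length xs} = set xs" by (auto simp: set_conv_nth)
  have "permutably_regular R ((\<lambda>i. xs ! i)(length xs := x)) (insert (length xs) {..<length xs})"
    using IH snoc.prems(1) snoc.prems(2)[of "length xs"] by (intro permutably_regular_insert) (auto simp: im)
  moreover have "((\<lambda>i. xs ! i)(length xs := x)) ` T = (\<lambda>i. (xs @ [x]) ! i) ` T"
    if "T \<subseteq> insert (length xs) {..<length xs}" for T
    using that by (intro image_cong) (auto simp: nth_append)
  moreover have "((\<lambda>i. xs ! i)(length xs := x)) i = (xs @ [x]) ! i" if "i \<in> insert (length xs) {..<length xs}" for i
    using that by (auto simp: nth_append)
  moreover have "{..<length (xs @ [x])} = insert (length xs) {..<length xs}" by auto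
  ultimately show ?case
    unfolding permutably_regular_def by (metis DiffD1)
qed

text \<open>A power of an element that is regular modulo the others is again regular modulo them, so
  the element can be taken out and its power put back by \<open>permutably_regular_insert\<close>.
  This is done for all indices except \<open>i\<close>, which keeps \<open>x i\<close>
  itself.\<close>

lemma permutably_regular_pow:
  assumes "finite S" "x ` S \<subseteq> \<mm>" "permutably_regular R x S" "\<And>i. i \<in> S \<Longrightarrow> k i > 0" "i \<in> S"
  shows "nzd_mod R (self_algebra R) ((\<lambda>j. x j [^] (k j :: nat)) ` (S - {i})) (x i)"
proof -
  define x' where "x' F j = (if j \<in> F then x j [^] k j else x j)" for F j
  have x'm: "x' F ` S \<subseteq> \<mm>" for F using assms(2,4) max_ideal.pow_mem by (auto simp: x'_def)
  have "permutably_regular R (x' F) S" if "finite F" "F \<subseteq> S" for F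
    using that
  proof (induction F rule: finite_induct)
    case empty
    then show ?case using assms(3) by (simp add: x'_def)
  next
    case (insert l F)
    then have IH: "permutably_regular R (x' F) S" and l: "l \<in> S" "l \<notin> F" by auto
    have "nzd_mod R (self_algebra R) (x' F ` (S - {l})) (x' F l)"
      using IH l unfolding permutably_regular_def by blast
    then have "nzd_mod R (self_algebra R) (x' F ` (S - {l})) (x l [^] k l)"
      using l assms(2) max_ideal.Icarr
      by (intro module.nzd_mod_pow[OF module_self]) (auto simp: x'_def)
    moreover have "x l [^] k l \<in> \<mm>" using assms(2,4) l max_ideal.pow_mem by blast
    ultimately have "permutably_regular R ((x' F)(l := x l [^] k l)) (insert l (S - {l}))"
      using assms(1) x'm[of F] IH
      by (intro permutably_regular_insert permutably_regular_subset[OF IH]) auto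
    moreover have "(x' F)(l := x l [^] k l) = x' (insert l F)" by (auto simp: x'_def)
    ultimately show ?case using l by (simp add: insert_absorb)
  qed
  from this[of "S - {i}"] have "permutably_regular R (x' (S - {i})) S" using assms(1) by simp
  then have "nzd_mod R (self_algebra R) (x' (S - {i}) ` (S - {i})) (x' (S - {i}) i)"
    using assms(5) unfolding permutably_regular_def by blast
  moreover have "x' (S - {i}) ` (S - {i}) = (\<lambda>j. x j [^] k j) ` (S - {i})"
    by (intro image_cong) (auto simp: x'_def)
  ultimately show ?thesis by (simp add: x'_def)
qed

end

section \<open>Systems of parameters\<close>

text \<open>A system of parameters without its order; \<open>parameter_family\<close> shows that a
  system of parameters has no repetitions. The condition on the radical is replaced by the maximal
  ideal being the only prime over \<open>Y\<close>, which suits the arguments with primes.\<close>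

definition parameter_set :: "('a, 'r) ring_scheme \<Rightarrow> 'a set \<Rightarrow> bool" where
  "parameter_set R Y \<longleftrightarrow> finite Y \<and> enat (card Y) = krull_dim R \<and> min_prime_over R Y (max_ideal R)"

context noetherian_local_ring
begin

lemma min_prime_over_max_ideal_iff:
  "min_prime_over R Y \<mm> \<longleftrightarrow> Y \<subseteq> \<mm> \<and> (\<forall>P. primeideal P R \<and> Y \<subseteq> P \<longrightarrow> P = \<mm>)"
  unfolding min_prime_over_def using max_ideal.primeideal prime_subset_max_ideal by blast

lemma krull_dim_le:
  assumes "finite Y" "min_prime_over R Y \<mm>"
  shows "krull_dim R \<le> enat (card Y)"
  unfolding krull_dim_def
proof (rule SUP_least)
  fix C assume "C \<in> {C. finite C \<and> C \<noteq> {} \<and> subset.chain {P. primeideal P R} C}"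
  then have C: "finite C" "subset.chain {P. primeideal P R} C" by auto
  have "Y \<subseteq> carrier R" using assms(2) max_ideal.a_subset unfolding min_prime_over_def by blast
  moreover have "Q \<subseteq> \<mm>" if "Q \<in> C" for Q
    using C(2) that prime_subset_max_ideal unfolding subset.chain_def by blast
  ultimately have "card C \<le> Suc (card Y)" using krull_height[OF assms(1) order_refl _ assms(2) C] by blast
  then show "enat (card C - 1) \<le> enat (card Y)" by simp
qed

end

lemma krull_dim_ge:
  assumes "finite C" "C \<noteq> {}" "subset.chain {P. primeideal P R} C"
  shows "enat (card C - 1) \<le> krull_dim R"
  unfolding krull_dim_def using assms by (intro SUP_upper) auto

context noetherian_local_ring
begin

lemma mem_max_ideal_pow:
  assumes "min_prime_over R Y \<mm>" "r \<in> \<mm>"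
  obtains n where "r [^] (n::nat) \<in> Idl Y"
proof -
  have Y: "Y \<subseteq> \<mm>" "Y \<subseteq> carrier R" using assms(1) max_ideal.a_subset unfolding min_prime_over_def by blast+
  have "min_prime_over R (Idl Y) \<mm>"
    unfolding min_prime_over_max_ideal_iff
  proof (intro conjI allI impI)
    show "Idl Y \<subseteq> \<mm>" using genideal_minimal[OF max_ideal.is_ideal Y(1)] .
    fix P assume P: "primeideal P R \<and> Idl Y \<subseteq> P"
    then have "Y \<subseteq> P" using genideal_self[OF Y(2)] by auto
    then show "P = \<mm>" using assms(1) P unfolding min_prime_over_max_ideal_iff by simp
  qed
  then obtain s n where s: "s \<in> carrier R - \<mm>" "s \<otimes> r [^] (n::nat) \<in> Idl Y"
    using min_prime_over_pow[OF genideal_ideal[OF Y(2)] _ assms(2)] by blast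
  have "r [^] n \<in> saturation R \<mm> (Idl Y)"
    using s assms(2) max_ideal.Icarr unfolding saturation_def by blast
  then show ?thesis using that saturation_max_ideal[OF genideal_ideal[OF Y(2)]] by blast
qed

lemma system_of_parameters_iff:
  "system_of_parameters R xs \<longleftrightarrow> enat (length xs) = krull_dim R \<and> min_prime_over R (set xs) \<mm>"
proof -
  have "min_prime_over R (set xs) \<mm> \<longleftrightarrow> set xs \<subseteq> \<mm> \<and> ideal_radical R (Idl (set xs)) = \<mm>"
  proof (intro iffI conjI)
    assume m: "min_prime_over R (set xs) \<mm>"
    then show xs: "set xs \<subseteq> \<mm>" unfolding min_prime_over_def by blast
    have "Idl (set xs) \<subseteq> \<mm>" using genideal_minimal[OF max_ideal.is_ideal xs] .
    then have "r \<in> \<mm>" if "r \<in> carrier R" "r [^] (n::nat) \<in> Idl (set xs)" for r n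
      using max_ideal.pow_mem_imp_mem[OF that(1)] that(2) by auto
    moreover have "r \<in> carrier R \<and> (\<exists>n::nat. r [^] n \<in> Idl (set xs))" if "r \<in> \<mm>" for r
      using mem_max_ideal_pow[OF m that] max_ideal.Icarr[OF that] by metis
    ultimately show "ideal_radical R (Idl (set xs)) = \<mm>"
      unfolding ideal_radical_def by (intro equalityI subsetI CollectI) auto
  next
    assume m: "set xs \<subseteq> \<mm> \<and> ideal_radical R (Idl (set xs)) = \<mm>"
    have "P = \<mm>" if P: "primeideal P R" "set xs \<subseteq> P" for P
    proof -
      interpret P: primeideal P R by fact
      have Idl: "Idl (set xs) \<subseteq> P" using genideal_minimal[OF P.is_ideal P(2)] .
      have "\<mm> \<subseteq> P"
      proof
        fix r assume "r \<in> \<mm>"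
        then have "r \<in> ideal_radical R (Idl (set xs))" using m by simp
        then obtain n where "r \<in> carrier R" "r [^] (n::nat) \<in> Idl (set xs)"
          unfolding ideal_radical_def by auto
        then show "r \<in> P" using Idl P.pow_mem_imp_mem[of r n] by auto
      qed
      then show ?thesis using prime_subset_max_ideal[OF P(1)] by blast
    qed
    then show "min_prime_over R (set xs) \<mm>" by (simp add: m min_prime_over_max_ideal_iff)
  qed
  then show ?thesis unfolding system_of_parameters_def by blast
qed

text \<open>By \<open>krull_dim_le\<close>, fewer than \<open>dim R\<close> elements cannot have the
  maximal ideal as a minimal prime, so repetitions are impossible.\<close>

lemma parameter_family:
  assumes "finite S" "enat (card S) = krull_dim R" "min_prime_over R (x ` S) \<mm>"
  shows "inj_on x S" "parameter_set R (x ` S)"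
proof -
  have "enat (card S) \<le> enat (card (x ` S))" using krull_dim_le[OF _ assms(3)] assms(1,2) by simp
  then have c: "card (x ` S) = card S" using card_image_le[OF assms(1), of x] by simp
  then show "inj_on x S" using eq_card_imp_inj_on[OF assms(1)] by blast
  show "parameter_set R (x ` S)" using c assms unfolding parameter_set_def by simp
qed

lemma parameter_set_list:
  assumes "system_of_parameters R xs"
  shows "parameter_set R (set xs)" "distinct xs"
proof -
  have im: "(\<lambda>i. xs ! i) ` {..<length xs} = set xs" by (auto simp: set_conv_nth)
  note * = parameter_family[of "{..<length xs}" "\<lambda>i. xs ! i", unfolded im]
  show "parameter_set R (set xs)" using * assms unfolding system_of_parameters_iff by simp
  show "distinct xs" using * assms unfolding system_of_parameters_iff by (simp add: distinct_conv_nth inj_on_def) blast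
qed

lemma min_prime_over_pow_image:
  assumes "min_prime_over R (x ` S) \<mm>" "\<And>i. i \<in> S \<Longrightarrow> k i > 0"
  shows "min_prime_over R ((\<lambda>i. x i [^] (k i :: nat)) ` S) \<mm>"
  unfolding min_prime_over_max_ideal_iff
proof (intro conjI allI impI)
  have x: "x ` S \<subseteq> \<mm>" using assms(1) unfolding min_prime_over_def by blast
  then show "(\<lambda>i. x i [^] k i) ` S \<subseteq> \<mm>" using assms(2) max_ideal.pow_mem by blast
  fix P assume P: "primeideal P R \<and> (\<lambda>i. x i [^] k i) ` S \<subseteq> P"
  then interpret P: primeideal P R by blast
  have "x ` S \<subseteq> P" using P P.pow_mem_imp_mem x max_ideal.Icarr by blast
  then show "P = \<mm>" using assms(1) P unfolding min_prime_over_max_ideal_iff by blast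
qed

text \<open>\<open>F\<close> collects primes over \<open>Y\<close> other than the maximal ideal, one
  below each prime in question. Let a prime \<open>P\<close> contain \<open>v\<close> and
  \<open>Y\<close>, and let \<open>p\<close> be a member of \<open>F\<close> below it. Then
  \<open>p\<close> misses \<open>v\<close> and is strictly smaller than \<open>P\<close>; since the
  maximal ideal is minimal over \<open>p\<close> and \<open>y\<close>, the principal ideal theorem
  leaves no room for \<open>P\<close> strictly between.\<close>

lemma finite_primes_avoid_exchange:
  assumes "Y \<subseteq> carrier R" "min_prime_over R (insert y Y) \<mm>"
  obtains F where "finite F" "\<And>P. P \<in> F \<Longrightarrow> primeideal P R \<and> \<not> \<mm> \<subseteq> P"
    "\<And>v. v \<in> \<mm> \<Longrightarrow> \<forall>P\<in>F. v \<notin> P \<Longrightarrow> min_prime_over R (insert v Y) \<mm>"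
proof -
  have ym: "y \<in> \<mm>" "Y \<subseteq> \<mm>" using assms(2) unfolding min_prime_over_def by blast+
  obtain F where F: "finite F" "\<forall>P\<in>F. primeideal P R \<and> Idl Y \<subseteq> P"
    "\<forall>Q. primeideal Q R \<and> Idl Y \<subseteq> Q \<longrightarrow> (\<exists>P\<in>F. P \<subseteq> Q)"
    using finite_primes_below[OF genideal_ideal[OF assms(1)]] by metis
  have "primeideal P R \<and> \<not> \<mm> \<subseteq> P" if "P \<in> F - {\<mm>}" for P
    using that F(2) prime_subset_max_ideal by blast
  moreover have "min_prime_over R (insert v Y) \<mm>" if v: "v \<in> \<mm>" "\<forall>P\<in>F - {\<mm>}. v \<notin> P" for v
    unfolding min_prime_over_max_ideal_iff
  proof (intro conjI allI impI)
    show "insert v Y \<subseteq> \<mm>" using v(1) ym by blast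
    fix P assume P: "primeideal P R \<and> insert v Y \<subseteq> P"
    then have "Idl Y \<subseteq> P" using genideal_minimal primeideal.axioms(1) by blast
    then obtain p where p: "p \<in> F" "p \<subseteq> P" using F(3) P by metis
    show "P = \<mm>"
    proof (cases "p = \<mm>")
      case True
      then show ?thesis using p(2) P prime_subset_max_ideal by blast
    next
      case False
      then have "p \<subset> P" using v(2) p P by blast
      have pY: "primeideal p R" "Y \<subseteq> p" using F(2) p(1) genideal_self[OF assms(1)] by blast+
      have "min_prime_over R (insert y p) \<mm>"
        unfolding min_prime_over_max_ideal_iff
      proof (intro conjI allI impI)
        show "insert y p \<subseteq> \<mm>" using ym prime_subset_max_ideal[OF pY(1)] by blast
        fix N assume "primeideal N R \<and> insert y p \<subseteq> N"
        then show "N = \<mm>" using pY(2) assms(2) unfolding min_prime_over_max_ideal_iff by blast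
      qed
      then show ?thesis
        using krull_principal_ideal[of p P \<mm> y] pY(1) P \<open>p \<subset> P\<close> ym(1) prime_subset_max_ideal[of P] by blast
    qed
  qed
  ultimately show ?thesis using that[of "F - {\<mm>}"] F(1) by blast
qed

text \<open>Any two systems of parameters are connected by replacing one element at a time: prime
  avoidance yields an element that can replace both \<open>y\<close> in one and \<open>w\<close> in the other.\<close>

lemma parameter_set_connected:
  assumes d: "krull_dim R = enat d"
    and exch: "\<And>Z y v. finite Z \<Longrightarrow> y \<notin> Z \<Longrightarrow> v \<notin> Z \<Longrightarrow> parameter_set R (insert y Z) \<Longrightarrow>
      parameter_set R (insert v Z) \<Longrightarrow> \<Phi> (insert y Z) \<Longrightarrow> \<Phi> (insert v Z)"
    and "parameter_set R Y" "parameter_set R W" "\<Phi> Y"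
  shows "\<Phi> W"
  using assms(3-)
proof (induction "d - card (Y \<inter> W)" arbitrary: Y W rule: less_induct)
  case less
  have fin: "finite Y" "finite W" "card Y = d" "card W = d"
    using less.prems(1,2) d unfolding parameter_set_def by auto
  show ?case
  proof (cases "Y = W")
    case True
    then show ?thesis using less.prems by simp
  next
    case False
    then have "\<not> Y \<subseteq> W" "\<not> W \<subseteq> Y" using fin by (metis card_subset_eq)+
    then obtain y w where yw: "y \<in> Y" "y \<notin> W" "w \<in> W" "w \<notin> Y" by blast
    define Y' W' where "Y' = Y - {y}" and "W' = W - {w}"
    have Y: "Y = insert y Y'" "W = insert w W'" using yw by (auto simp: Y'_def W'_def)
    have sub: "Y' \<subseteq> carrier R" "W' \<subseteq> carrier R"
      using less.prems(1,2) max_ideal.a_subset unfolding parameter_set_def min_prime_over_def Y'_def W'_def by blast+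
    obtain F where F: "finite F" "\<And>P. P \<in> F \<Longrightarrow> primeideal P R \<and> \<not> \<mm> \<subseteq> P"
      "\<And>v. v \<in> \<mm> \<Longrightarrow> \<forall>P\<in>F. v \<notin> P \<Longrightarrow> min_prime_over R (insert v Y') \<mm>"
      using finite_primes_avoid_exchange[OF sub(1), of y] less.prems(1) Y unfolding parameter_set_def by metis
    obtain G where G: "finite G" "\<And>P. P \<in> G \<Longrightarrow> primeideal P R \<and> \<not> \<mm> \<subseteq> P"
      "\<And>v. v \<in> \<mm> \<Longrightarrow> \<forall>P\<in>G. v \<notin> P \<Longrightarrow> min_prime_over R (insert v W') \<mm>"
      using finite_primes_avoid_exchange[OF sub(2), of w] less.prems(2) Y unfolding parameter_set_def by metis
    have "\<exists>v\<in>\<mm>. \<forall>P\<in>F \<union> G. v \<notin> P"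
      using F(1,2) G(1,2) by (intro prime_avoidance max_ideal.is_ideal) auto
    then obtain v where v: "v \<in> \<mm>" "\<forall>P\<in>F. v \<notin> P" "\<forall>P\<in>G. v \<notin> P" by auto
    have mp: "min_prime_over R (insert v Y') \<mm>" "min_prime_over R (insert v W') \<mm>" using F(3) G(3) v by auto
    have card': "Suc (card Y') = d" "Suc (card W') = d" "finite Y'" "finite W'"
      using card_Suc_Diff1[OF fin(1) yw(1)] card_Suc_Diff1[OF fin(2) yw(3)] fin by (auto simp: Y'_def W'_def)
    have le: "d \<le> card (insert v Y')" "d \<le> card (insert v W')"
      using krull_dim_le[OF _ mp(1)] krull_dim_le[OF _ mp(2)] d card' by auto
    then have vn: "v \<notin> Y'" "v \<notin> W'" using card' by (auto simp: insert_absorb)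
    have ps: "parameter_set R (insert v Y')" "parameter_set R (insert v W')"
      using mp card' vn d unfolding parameter_set_def by auto
    \<comment> \<open>The measure drops: removing \<open>y\<close> and \<open>w\<close> loses
      nothing from the intersection, and \<open>v\<close> is new in it.\<close>
    have "Y \<inter> W \<subseteq> Y' \<inter> W'" using yw by (auto simp: Y'_def W'_def)
    then have "insert v (Y \<inter> W) \<subseteq> insert v Y' \<inter> insert v W'" by blast
    then have "card (insert v (Y \<inter> W)) \<le> card (insert v Y' \<inter> insert v W')"
      using card' by (intro card_mono) auto
    moreover have "v \<notin> Y \<inter> W" using vn yw by (auto simp: Y'_def W'_def)
    ultimately have "card (Y \<inter> W) < card (insert v Y' \<inter> insert v W')" using fin by simp
    moreover have "card (Y \<inter> W) < d"
      using fin False yw by (metis Int_lower1 card_mono card_subset_eq inf.absorb_iff1 le_neq_implies_less \<open>\<not> Y \<subseteq> W\<close>)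
    ultimately have less': "d - card (insert v Y' \<inter> insert v W') < d - card (Y \<inter> W)" by linarith
    have "y \<notin> Y'" "w \<notin> W'" by (auto simp: Y'_def W'_def)
    \<comment> \<open>The path runs from \<open>Y\<close> to \<open>insert v Y'\<close> by one
      exchange, to \<open>insert v W'\<close> by induction, and to \<open>W\<close> by exchanging
      \<open>v\<close> for \<open>w\<close>.\<close>
    have "\<Phi> (insert v Y')"
      by (rule exch[OF card'(3) \<open>y \<notin> Y'\<close> vn(1) _ ps(1)]) (use less.prems Y(1) in simp_all)
    then have "\<Phi> (insert v W')" using less.hyps[OF less' ps] by blast
    then have "\<Phi> (insert w W')"
      by (rule exch[OF card'(4) vn(2) \<open>w \<notin> W'\<close> ps(2), rotated]) (use less.prems Y(2) in simp)
    then show ?thesis using Y(2) by simp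
  qed
qed

end

section \<open>Contracted ideals under the exchange of a parameter\<close>

lemma (in module) smult_mem_mult_span:
  assumes "Y \<subseteq> carrier R" "e \<in> carrier M" "q \<in> Idl Y"
  shows "q \<odot>\<^bsub>M\<^esub> e \<in> mult_span R M Y"
proof -
  let ?I = "{q \<in> carrier R. q \<odot>\<^bsub>M\<^esub> e \<in> mult_span R M Y}"
  have "ideal ?I R"
  proof (rule idealI[OF ring_axioms])
    show "subgroup ?I (add_monoid R)"
    proof (rule R.add.subgroupI)
      have "\<zero> \<in> ?I" using mult_span_zero[OF assms(1)] assms(2) by simp
      then show "?I \<noteq> {}" by blast
    qed (use assms(2) mult_span_a_inv[OF assms(1)] mult_span_add[OF assms(1)] in
        \<open>auto simp: smult_l_minus smult_l_distr\<close>)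
    fix a r assume "a \<in> ?I" "r \<in> carrier R"
    then show "r \<otimes> a \<in> ?I" using mult_span_smult[OF assms(1)] assms(2) by (simp add: smult_assoc1)
    then show "a \<otimes> r \<in> ?I" using \<open>a \<in> ?I\<close> \<open>r \<in> carrier R\<close> by (simp add: R.m_comm)
  qed
  then have "Idl Y \<subseteq> ?I" using assms mult_span_mem by (intro genideal_minimal) auto
  then show ?thesis using assms(3) by blast
qed

text \<open>For \<open>I = (Y)\<close> this is the equality of \<open>I\<close> and the contraction
  of \<open>IB\<close> to \<open>R\<close>; the other inclusion always holds, by
  \<open>smult_mem_mult_span\<close>.\<close>

definition contracts :: "('a, 'r) ring_scheme \<Rightarrow> ('a, 'b, 'm) module_scheme \<Rightarrow> 'a set \<Rightarrow> bool" where
  "contracts R B Y \<longleftrightarrow> (\<forall>u\<in>carrier R. structure_map B u \<in> mult_span R B Y \<longrightarrow> u \<in> Idl\<^bsub>R\<^esub> Y)"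

context noetherian_local_ring
begin

text \<open>The elements of \<open>Z\<close> are listed first and \<open>y\<close> last. Being free
  to choose the order is what replaces permutability on \<open>B\<close>, where Nakayama's lemma is
  missing.\<close>

lemma big_Cohen_Macaulay_nzd_mod:
  assumes "big_Cohen_Macaulay R B" "parameter_set R (insert y Z)" "finite Z" "y \<notin> Z"
  shows "nzd_mod R B Z y"
proof -
  interpret B: algebra R B using assms(1) big_Cohen_Macaulay_def by blast
  obtain zs where zs: "set zs = Z" "distinct zs" using assms(3) finite_distinct_list by blast
  have "system_of_parameters R (zs @ [y])"
    using assms zs distinct_card[OF zs(2)] unfolding parameter_set_def system_of_parameters_iff by simp
  then have "regular_sequence (zs @ [y]) B" using assms(1) big_Cohen_Macaulay_def by blast
  moreover have "set (zs @ [y]) \<subseteq> carrier R"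
    using assms(2) zs max_ideal.a_subset unfolding parameter_set_def min_prime_over_def by auto
  ultimately have "\<forall>i<length (zs @ [y]). nzd_mod R B (set (take i (zs @ [y]))) ((zs @ [y]) ! i)"
    using B.regular_sequence_iff by blast
  then show ?thesis using zs by force
qed

text \<open>If \<open>(y, Z)\<close> contracts, so does \<open>(y\<^sup>n, Z)\<close>, since \<open>y\<close> can be cancelled modulo \<open>Z\<close> on \<open>B\<close>. As
  \<open>y\<^sup>t \<equiv> v a\<close> modulo \<open>Z\<close> for some \<open>t\<close> and \<open>a\<close> is regular modulo \<open>Z\<close>, multiplication by \<open>a\<close> carries the
  contraction property from \<open>(y\<^sup>t, Z)\<close> to \<open>(v, Z)\<close>.\<close>

lemma regular_contracts_exchange:
  assumes B: "big_Cohen_Macaulay R B" and Z: "finite Z" "y \<notin> Z" "v \<notin> Z"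
    and ps: "parameter_set R (insert y Z)" "parameter_set R (insert v Z)"
    and reg: "permutably_regular R (\<lambda>z. z) (insert y Z)" and con: "contracts R B (insert y Z)"
  shows "permutably_regular R (\<lambda>z. z) (insert v Z)" "contracts R B (insert v Z)"
proof -
  interpret S: module R "self_algebra R" by (rule module_self)
  interpret B: algebra R B using B big_Cohen_Macaulay_def by blast
  have m: "Z \<subseteq> \<mm>" "y \<in> \<mm>" "v \<in> \<mm>" using ps unfolding parameter_set_def min_prime_over_def by auto
  have c: "Z \<subseteq> carrier R" "y \<in> carrier R" "v \<in> carrier R" using m max_ideal.a_subset by auto
  have cpow: "y [^] (n::nat) \<in> carrier R" for n using c by simp
  interpret IZ: ideal "Idl Z" R using genideal_ideal c(1) .
  have ins: "u \<in> Idl (insert w Z) \<longleftrightarrow> (\<exists>r\<in>carrier R. \<exists>h\<in>Idl Z. u = w \<otimes> r \<oplus> h)" if "w \<in> carrier R" for u w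
  proof
    assume "u \<in> Idl (insert w Z)"
    then have "u \<in> mult_span R (self_algebra R) (insert w Z)" using mult_span_self[of "insert w Z"] that c(1) by simp
    then show "\<exists>r\<in>carrier R. \<exists>h\<in>Idl Z. u = w \<otimes> r \<oplus> h"
      using S.mult_span_insertE[of u w Z] that c(1) mult_span_self[OF c(1)] by (metis self_algebra_simps)
  next
    assume "\<exists>r\<in>carrier R. \<exists>h\<in>Idl Z. u = w \<otimes> r \<oplus> h"
    then show "u \<in> Idl (insert w Z)"
      using S.mult_span_insertI[of w Z] that c(1) mult_span_self[OF c(1)] mult_span_self[of "insert w Z"] by auto
  qed
  have "nzd_mod R (self_algebra R) ((\<lambda>z. z) ` Z) y" using reg Z unfolding permutably_regular_def by blast
  then have nzy: "nzd_mod R (self_algebra R) Z y" by simp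
  obtain t where t: "y [^] (t::nat) \<in> Idl (insert v Z)"
    using mem_max_ideal_pow[of "insert v Z" y] ps m unfolding parameter_set_def by blast
  then obtain a q where aq: "a \<in> carrier R" "q \<in> Idl Z" "y [^] t = v \<otimes> a \<oplus> q" using ins[OF c(3)] by blast
  have qR: "q \<in> carrier R" using aq(2) IZ.Icarr by blast
  have nzt: "u \<in> Idl Z" if "u \<in> carrier R" "y [^] t \<otimes> u \<in> Idl Z" for u
    using S.nzd_mod_pow[OF nzy c(2), of t] that unfolding nzd_mod_self[OF c(1)] by blast
  have nzva: "u \<in> Idl Z" if u: "u \<in> carrier R" "v \<otimes> u \<in> Idl Z \<or> a \<otimes> u \<in> Idl Z" for u
  proof -
    have "(v \<otimes> a) \<otimes> u = a \<otimes> (v \<otimes> u)" "(v \<otimes> a) \<otimes> u = v \<otimes> (a \<otimes> u)" using u(1) aq(1) c(3) by (simp_all add: m_ac)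
    then have "(v \<otimes> a) \<otimes> u \<in> Idl Z" using u(2) IZ.I_l_closed[of "v \<otimes> u" a] IZ.I_l_closed[of "a \<otimes> u" v] aq(1) c(3) by auto
    moreover have "y [^] t \<otimes> u = (v \<otimes> a) \<otimes> u \<oplus> u \<otimes> q" unfolding aq(3) using u(1) aq(1) c(3) qR by algebra
    ultimately have "y [^] t \<otimes> u \<in> Idl Z" using IZ.I_l_closed[OF aq(2) u(1)] IZ.a_closed by simp
    then show ?thesis using nzt u(1) by blast
  qed
  have "nzd_mod R (self_algebra R) ((\<lambda>z. z) ` Z) v" using nzva unfolding nzd_mod_self[OF c(1)] by (simp add: nzd_mod_self c(1))
  moreover have "permutably_regular R (\<lambda>z. z) Z" using reg permutably_regular_subset by blast
  ultimately have "permutably_regular R ((\<lambda>z. z)(v := v)) (insert v Z)"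
    using permutably_regular_insert[of Z "\<lambda>z. z" v v] Z m by simp
  moreover have "(\<lambda>z. z)(v := v) = (\<lambda>z. z)" by auto
  ultimately show "permutably_regular R (\<lambda>z. z) (insert v Z)" by simp
  have nzB: "nzd_mod R B Z y" using big_Cohen_Macaulay_nzd_mod[OF B ps(1) Z(1,2)] .
  have one: "\<one>\<^bsub>B\<^esub> \<in> carrier B" by simp
  have sm: "structure_map B r \<in> carrier B" if "r \<in> carrier R" for r
    using that unfolding structure_map_def by simp
  have sm_mult: "structure_map B (r \<otimes> s) = r \<odot>\<^bsub>B\<^esub> structure_map B s" if "r \<in> carrier R" "s \<in> carrier R" for r s
    using that unfolding structure_map_def by (simp add: B.smult_assoc1)
  have sm_Idl: "structure_map B h \<in> mult_span R B (insert w Z)" if "h \<in> Idl Z" "w \<in> carrier R" for h w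
    using B.smult_mem_mult_span[OF c(1) one that(1)] B.mult_span_mono[of "insert w Z" Z] that(2) c(1)
    unfolding structure_map_def by auto
  \<comment> \<open>If \<open>u\<close> maps into \<open>(y^(n+1), Z)B\<close>, the hypothesis on
    \<open>(y, Z)\<close> gives \<open>u = y r + h\<close> with \<open>h\<close> in
    \<open>(Z)\<close>. Cancelling \<open>y\<close> modulo \<open>ZB\<close> shows that
    \<open>r\<close> maps into \<open>(y^n, Z)B\<close>, and the induction hypothesis applies to
    \<open>r\<close>. For \<open>n = 0\<close> the ideal is the whole ring.\<close>
  have conpow: "contracts R B (insert (y [^] n) Z)" for n :: nat
  proof (induction n)
    case 0
    show ?case
      unfolding contracts_def
    proof (intro ballI impI)
      fix u assume "u \<in> carrier R"
      then show "u \<in> Idl (insert (y [^] (0::nat)) Z)"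
        using IZ.zero_closed by (simp add: ins, intro bexI[of _ u] bexI[of _ \<zero>]) auto
    qed
  next
    case (Suc n)
    show ?case
      unfolding contracts_def
    proof (intro ballI impI)
      fix u assume u: "u \<in> carrier R" "structure_map B u \<in> mult_span R B (insert (y [^] Suc n) Z)"
      have "mult_span R B (insert (y [^] Suc n) Z) \<subseteq> mult_span R B (insert y Z)"
      proof (rule B.mult_span_subset)
        show "insert y Z \<subseteq> carrier R" using c by simp
        fix w b assume w: "w \<in> insert (y [^] Suc n) Z" "b \<in> carrier B"
        show "w \<odot>\<^bsub>B\<^esub> b \<in> mult_span R B (insert y Z)"
        proof (cases "w \<in> Z")
          case True
          then show ?thesis using w(2) B.mult_span_mem by blast
        next
          case False
          then have "w \<odot>\<^bsub>B\<^esub> b = y \<odot>\<^bsub>B\<^esub> (y [^] n \<odot>\<^bsub>B\<^esub> b)"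
            using w c by (simp add: B.smult_assoc1[symmetric] m_comm)
          then show ?thesis using w(2) c B.mult_span_mem[of y "insert y Z" "y [^] n \<odot>\<^bsub>B\<^esub> b"] by simp
        qed
      qed
      then obtain r h where rh: "r \<in> carrier R" "h \<in> Idl Z" "u = y \<otimes> r \<oplus> h"
        using con u ins[OF c(2)] unfolding contracts_def by blast
      have hR: "h \<in> carrier R" using rh(2) IZ.Icarr by blast
      have yS: "insert (y [^] Suc n) Z \<subseteq> carrier R" using c by simp
      have "structure_map B (\<ominus> h) \<in> mult_span R B (insert (y [^] Suc n) Z)"
        using sm_Idl rh(2) c(2) by simp
      then have "structure_map B u \<oplus>\<^bsub>B\<^esub> structure_map B (\<ominus> h) \<in> mult_span R B (insert (y [^] Suc n) Z)"
        using u(2) B.mult_span_add[OF yS] by blast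
      moreover have "structure_map B u \<oplus>\<^bsub>B\<^esub> structure_map B (\<ominus> h) = structure_map B (u \<oplus> \<ominus> h)"
        using u(1) hR unfolding structure_map_def by (simp add: B.smult_l_distr)
      moreover have "u \<oplus> \<ominus> h = y \<otimes> r" unfolding rh(3) using c(2) rh(1) hR by algebra
      ultimately have "y \<odot>\<^bsub>B\<^esub> structure_map B r \<in> mult_span R B (insert (y \<otimes> y [^] n) Z)"
        using sm_mult[OF c(2) rh(1)] c(2) by (simp add: m_comm)
      then have "structure_map B r \<in> mult_span R B (insert (y [^] n) Z)"
        using B.nzd_mod_cancel[OF nzB c(2) cpow c(1) sm[OF rh(1)]] by blast
      then have "r \<in> Idl (insert (y [^] n) Z)" using Suc rh(1) unfolding contracts_def by blast
      then obtain r' h' where r': "r' \<in> carrier R" "h' \<in> Idl Z" "r = y [^] n \<otimes> r' \<oplus> h'" using ins[OF cpow] by blast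
      have h'R: "h' \<in> carrier R" using r'(2) IZ.Icarr by blast
      have "u = y [^] Suc n \<otimes> r' \<oplus> (y \<otimes> h' \<oplus> h)"
        unfolding rh(3) r'(3) nat_pow_Suc using cpow[of n] c(2) r'(1) h'R hR by algebra
      moreover have "y \<otimes> h' \<oplus> h \<in> Idl Z" using IZ.I_l_closed[OF r'(2) c(2)] rh(2) by simp
      ultimately show "u \<in> Idl (insert (y [^] Suc n) Z)" using ins[OF cpow] r'(1) by blast
    qed
  qed
  show "contracts R B (insert v Z)"
    unfolding contracts_def
  proof (intro ballI impI)
    fix u assume u: "u \<in> carrier R" "structure_map B u \<in> mult_span R B (insert v Z)"
    obtain b h where bh: "b \<in> carrier B" "h \<in> mult_span R B Z" "structure_map B u = v \<odot>\<^bsub>B\<^esub> b \<oplus>\<^bsub>B\<^esub> h"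
      using B.mult_span_insertE[OF u(2) c(3,1)] by blast
    have hB: "h \<in> carrier B" using B.mult_span_in_carrier[OF c(1) bh(2)] .
    have ytZ: "insert (y [^] t) Z \<subseteq> carrier R" using c by simp
    have Zsub: "mult_span R B Z \<subseteq> mult_span R B (insert (y [^] t) Z)" using B.mult_span_mono[OF ytZ] by blast
    have "v \<otimes> a = y [^] t \<oplus> \<ominus> q" unfolding aq(3) using c(3) aq(1) qR by algebra
    then have "a \<odot>\<^bsub>B\<^esub> (v \<odot>\<^bsub>B\<^esub> b) = y [^] t \<odot>\<^bsub>B\<^esub> b \<oplus>\<^bsub>B\<^esub> \<ominus>\<^bsub>B\<^esub> (q \<odot>\<^bsub>B\<^esub> b)"
      using aq(1) c(2,3) qR bh(1)
      by (metis B.smult_assoc1 B.smult_l_distr B.smult_l_minus a_inv_closed cpow m_comm)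
    then have "structure_map B (a \<otimes> u) = (y [^] t \<odot>\<^bsub>B\<^esub> b \<oplus>\<^bsub>B\<^esub> \<ominus>\<^bsub>B\<^esub> (q \<odot>\<^bsub>B\<^esub> b)) \<oplus>\<^bsub>B\<^esub> a \<odot>\<^bsub>B\<^esub> h"
      unfolding sm_mult[OF aq(1) u(1)] bh(3) using aq(1) bh(1) hB c(3) by (simp add: B.smult_r_distr)
    moreover have "y [^] t \<odot>\<^bsub>B\<^esub> b \<in> mult_span R B (insert (y [^] t) Z)" using bh(1) B.mult_span_mem by blast
    moreover have "\<ominus>\<^bsub>B\<^esub> (q \<odot>\<^bsub>B\<^esub> b) \<in> mult_span R B (insert (y [^] t) Z)"
      using B.smult_mem_mult_span[OF c(1) bh(1) aq(2)] B.mult_span_a_inv[OF c(1)] Zsub by blast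
    moreover have "a \<odot>\<^bsub>B\<^esub> h \<in> mult_span R B (insert (y [^] t) Z)"
      using B.mult_span_smult[OF c(1) aq(1) bh(2)] Zsub by blast
    ultimately have "structure_map B (a \<otimes> u) \<in> mult_span R B (insert (y [^] t) Z)"
      using B.mult_span_add[OF ytZ] by simp
    then have "a \<otimes> u \<in> Idl (insert (y [^] t) Z)"
      using conpow aq(1) u(1) unfolding contracts_def by blast
    then obtain r h' where r: "r \<in> carrier R" "h' \<in> Idl Z" "a \<otimes> u = y [^] t \<otimes> r \<oplus> h'" using ins[OF cpow] by blast
    have h'R: "h' \<in> carrier R" using r(2) IZ.Icarr by blast
    \<comment> \<open>Modulo \<open>Z\<close> the equation for \<open>a u\<close> reads
      \<open>a u = v a r\<close>, and \<open>a\<close> can be cancelled there.\<close>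
    have "a \<otimes> (u \<oplus> \<ominus> (v \<otimes> r)) = a \<otimes> u \<oplus> \<ominus> ((v \<otimes> a) \<otimes> r)" using aq(1) u(1) c(3) r(1) by algebra
    also have "\<dots> = (v \<otimes> a \<oplus> q) \<otimes> r \<oplus> h' \<oplus> \<ominus> ((v \<otimes> a) \<otimes> r)" by (simp only: r(3) aq(3))
    also have "\<dots> = r \<otimes> q \<oplus> h'"
    proof -
      have "(w \<oplus> q) \<otimes> r \<oplus> h' \<oplus> \<ominus> (w \<otimes> r) = r \<otimes> q \<oplus> h'" if "w \<in> carrier R" for w
        using that r(1) qR h'R by algebra
      then show ?thesis using aq(1) c(3) by simp
    qed
    also have "\<dots> \<in> Idl Z" using IZ.I_l_closed[OF aq(2) r(1)] r(2) by simp
    finally have "u \<oplus> \<ominus> (v \<otimes> r) \<in> Idl Z"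
      using nzva[of "u \<oplus> \<ominus> (v \<otimes> r)"] u(1) c(3) r(1) by blast
    moreover have "u = v \<otimes> r \<oplus> (u \<oplus> \<ominus> (v \<otimes> r))" using u(1) c(3) r(1) by algebra
    ultimately show "u \<in> Idl (insert v Z)" using ins[OF c(3)] r(1) by blast
  qed
qed

end

section \<open>Localization of modules\<close>

locale module_localization = module R M for R (structure) and M (structure) +
  fixes W :: "'a set"
  assumes W_carrier: "W \<subseteq> carrier R" and one_in_W: "\<one>\<^bsub>R\<^esub> \<in> W"
    and W_mult: "s \<in> W \<Longrightarrow> t \<in> W \<Longrightarrow> s \<otimes>\<^bsub>R\<^esub> t \<in> W"
begin

lemma W_closed [simp]: "s \<in> W \<Longrightarrow> s \<in> carrier R"
  using W_carrier by blast

lemma smult_left_commute: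
  "a \<in> carrier R \<Longrightarrow> b \<in> carrier R \<Longrightarrow> u \<in> carrier M \<Longrightarrow> a \<odot>\<^bsub>M\<^esub> (b \<odot>\<^bsub>M\<^esub> u) = b \<odot>\<^bsub>M\<^esub> (a \<odot>\<^bsub>M\<^esub> u)"
  by (simp add: smult_assoc1[symmetric] R.m_comm)

definition loc_rel :: "'c \<Rightarrow> 'a \<Rightarrow> 'c \<Rightarrow> 'a \<Rightarrow> bool" where
  "loc_rel u s v t \<longleftrightarrow> (\<exists>w\<in>W. w \<odot>\<^bsub>M\<^esub> (t \<odot>\<^bsub>M\<^esub> u) = w \<odot>\<^bsub>M\<^esub> (s \<odot>\<^bsub>M\<^esub> v))"

lemma loc_class_eq: "loc_class M W u s = {(v, t). v \<in> carrier M \<and> t \<in> W \<and> loc_rel u s v t}"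
  unfolding loc_class_def loc_rel_def ..

lemma loc_rel_refl: "loc_rel u s u s"
  unfolding loc_rel_def using one_in_W by blast

lemma loc_rel_sym: "loc_rel u s v t \<Longrightarrow> loc_rel v t u s"
  unfolding loc_rel_def by metis

lemma loc_rel_trans:
  assumes "loc_rel u s v t" "loc_rel v t z r"
    and "u \<in> carrier M" "v \<in> carrier M" "z \<in> carrier M" "s \<in> W" "t \<in> W" "r \<in> W"
  shows "loc_rel u s z r"
proof -
  obtain w w' where w: "w \<in> W" "w \<odot>\<^bsub>M\<^esub> (t \<odot>\<^bsub>M\<^esub> u) = w \<odot>\<^bsub>M\<^esub> (s \<odot>\<^bsub>M\<^esub> v)"
    and w': "w' \<in> W" "w' \<odot>\<^bsub>M\<^esub> (r \<odot>\<^bsub>M\<^esub> v) = w' \<odot>\<^bsub>M\<^esub> (t \<odot>\<^bsub>M\<^esub> z)"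
    using assms(1,2) unfolding loc_rel_def by blast
  \<comment> \<open>The middle denominator \<open>t\<close> cannot be cancelled in general, so it is
    absorbed into the witness.\<close>
  have "(w \<otimes>\<^bsub>R\<^esub> w' \<otimes>\<^bsub>R\<^esub> t) \<odot>\<^bsub>M\<^esub> (r \<odot>\<^bsub>M\<^esub> u) = (w' \<otimes>\<^bsub>R\<^esub> r) \<odot>\<^bsub>M\<^esub> (w \<odot>\<^bsub>M\<^esub> (t \<odot>\<^bsub>M\<^esub> u))"
    using assms w(1) w'(1) by (simp add: smult_assoc1[symmetric] R.m_ac)
  also have "\<dots> = (w \<otimes>\<^bsub>R\<^esub> s) \<odot>\<^bsub>M\<^esub> (w' \<odot>\<^bsub>M\<^esub> (r \<odot>\<^bsub>M\<^esub> v))"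
    unfolding w(2) using assms w(1) w'(1) by (simp add: smult_assoc1[symmetric] R.m_ac)
  also have "\<dots> = (w \<otimes>\<^bsub>R\<^esub> w' \<otimes>\<^bsub>R\<^esub> t) \<odot>\<^bsub>M\<^esub> (s \<odot>\<^bsub>M\<^esub> z)"
    unfolding w'(2) using assms w(1) w'(1) by (simp add: smult_assoc1[symmetric] R.m_ac)
  finally show ?thesis
    unfolding loc_rel_def using w(1) w'(1) assms(7) W_mult by blast
qed

lemma loc_class_eq_iff:
  assumes "u \<in> carrier M" "v \<in> carrier M" "s \<in> W" "t \<in> W"
  shows "loc_class M W u s = loc_class M W v t \<longleftrightarrow> loc_rel u s v t"
proof
  assume "loc_class M W u s = loc_class M W v t"
  moreover have "(v, t) \<in> loc_class M W v t" using assms loc_rel_refl by (simp add: loc_class_eq)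
  ultimately have "(v, t) \<in> loc_class M W u s" by simp
  then show "loc_rel u s v t" by (simp add: loc_class_eq)
next
  assume *: "loc_rel u s v t"
  have "loc_rel u s z r \<longleftrightarrow> loc_rel v t z r" if "z \<in> carrier M" "r \<in> W" for z r
    using loc_rel_trans[OF * _ assms(1,2) that(1) assms(3,4) that(2)]
      loc_rel_trans[OF loc_rel_sym[OF *] _ assms(2,1) that(1) assms(4,3) that(2)] by blast
  then show "loc_class M W u s = loc_class M W v t" unfolding loc_class_eq by auto
qed

text \<open>The operations of \<open>localization\<close> and the maps of the Cech complex are
  unions over representatives. This evaluates such a union once the term is known to be constant on
  the class.\<close>

lemma UN_loc_class:
  assumes "u \<in> carrier M" "s \<in> W"
    and "\<And>v t. v \<in> carrier M \<Longrightarrow> t \<in> W \<Longrightarrow> loc_rel u s v t \<Longrightarrow> F v t = A"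
  shows "(\<Union>(v, t)\<in>loc_class M W u s. F v t) = A"
proof -
  have "(u, s) \<in> loc_class M W u s" using assms loc_rel_refl by (simp add: loc_class_eq)
  moreover have "F v t = A" if "(v, t) \<in> loc_class M W u s" for v t using that assms(3) by (simp add: loc_class_eq)
  ultimately show ?thesis by blast
qed

lemma carrier_localization:
  "carrier (localization R M W) = {loc_class M W u s | u s. u \<in> carrier M \<and> s \<in> W}"
  by (simp add: localization_def)

lemma zero_localization: "\<zero>\<^bsub>localization R M W\<^esub> = loc_class M W \<zero>\<^bsub>M\<^esub> \<one>\<^bsub>R\<^esub>"
  by (simp add: localization_def)

lemma loc_class_zero: "s \<in> W \<Longrightarrow> loc_class M W \<zero>\<^bsub>M\<^esub> s = \<zero>\<^bsub>localization R M W\<^esub>"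
  unfolding zero_localization using one_in_W by (subst loc_class_eq_iff) (auto simp: loc_rel_def)

lemma loc_class_cancel:
  assumes "u \<in> carrier M" "s \<in> W" "a \<in> carrier R" "s \<otimes>\<^bsub>R\<^esub> a \<in> W"
  shows "loc_class M W (a \<odot>\<^bsub>M\<^esub> u) (s \<otimes>\<^bsub>R\<^esub> a) = loc_class M W u s"
proof (subst loc_class_eq_iff)
  show "loc_rel (a \<odot>\<^bsub>M\<^esub> u) (s \<otimes>\<^bsub>R\<^esub> a) u s"
    unfolding loc_rel_def using one_in_W assms by (intro bexI[of _ "\<one>\<^bsub>R\<^esub>"]) (simp_all add: smult_assoc1)
qed (use assms in auto)

lemma loc_class_add:
  assumes "u \<in> carrier M" "v \<in> carrier M" "s \<in> W" "t \<in> W"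
  shows "loc_class M W u s \<oplus>\<^bsub>localization R M W\<^esub> loc_class M W v t =
    loc_class M W (t \<odot>\<^bsub>M\<^esub> u \<oplus>\<^bsub>M\<^esub> s \<odot>\<^bsub>M\<^esub> v) (s \<otimes>\<^bsub>R\<^esub> t)"
proof -
  have eq: "loc_class M W (t' \<odot>\<^bsub>M\<^esub> u' \<oplus>\<^bsub>M\<^esub> s' \<odot>\<^bsub>M\<^esub> v') (s' \<otimes>\<^bsub>R\<^esub> t') =
      loc_class M W (t \<odot>\<^bsub>M\<^esub> u \<oplus>\<^bsub>M\<^esub> s \<odot>\<^bsub>M\<^esub> v) (s \<otimes>\<^bsub>R\<^esub> t)"
    if c: "u' \<in> carrier M" "v' \<in> carrier M" "s' \<in> W" "t' \<in> W" and rel: "loc_rel u s u' s'" "loc_rel v t v' t'"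
    for u' v' s' t'
  proof (subst loc_class_eq_iff)
    obtain w w' where w: "w \<in> W" "w \<odot>\<^bsub>M\<^esub> (s' \<odot>\<^bsub>M\<^esub> u) = w \<odot>\<^bsub>M\<^esub> (s \<odot>\<^bsub>M\<^esub> u')"
      and w': "w' \<in> W" "w' \<odot>\<^bsub>M\<^esub> (t' \<odot>\<^bsub>M\<^esub> v) = w' \<odot>\<^bsub>M\<^esub> (t \<odot>\<^bsub>M\<^esub> v')"
      using rel unfolding loc_rel_def by blast
    have "(w \<otimes>\<^bsub>R\<^esub> w') \<odot>\<^bsub>M\<^esub> ((s \<otimes>\<^bsub>R\<^esub> t) \<odot>\<^bsub>M\<^esub> (t' \<odot>\<^bsub>M\<^esub> u' \<oplus>\<^bsub>M\<^esub> s' \<odot>\<^bsub>M\<^esub> v')) =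
      (w' \<otimes>\<^bsub>R\<^esub> t \<otimes>\<^bsub>R\<^esub> t') \<odot>\<^bsub>M\<^esub> (w \<odot>\<^bsub>M\<^esub> (s \<odot>\<^bsub>M\<^esub> u')) \<oplus>\<^bsub>M\<^esub> (w \<otimes>\<^bsub>R\<^esub> s \<otimes>\<^bsub>R\<^esub> s') \<odot>\<^bsub>M\<^esub> (w' \<odot>\<^bsub>M\<^esub> (t \<odot>\<^bsub>M\<^esub> v'))"
      using assms c w(1) w'(1) by (simp add: smult_r_distr smult_assoc1[symmetric] R.m_ac)
    also have "\<dots> = (w \<otimes>\<^bsub>R\<^esub> w') \<odot>\<^bsub>M\<^esub> ((s' \<otimes>\<^bsub>R\<^esub> t') \<odot>\<^bsub>M\<^esub> (t \<odot>\<^bsub>M\<^esub> u \<oplus>\<^bsub>M\<^esub> s \<odot>\<^bsub>M\<^esub> v))"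
      unfolding w(2)[symmetric] w'(2)[symmetric]
      using assms c w(1) w'(1) by (simp add: smult_r_distr smult_assoc1[symmetric] R.m_ac)
    finally show "loc_rel (t' \<odot>\<^bsub>M\<^esub> u' \<oplus>\<^bsub>M\<^esub> s' \<odot>\<^bsub>M\<^esub> v') (s' \<otimes>\<^bsub>R\<^esub> t') (t \<odot>\<^bsub>M\<^esub> u \<oplus>\<^bsub>M\<^esub> s \<odot>\<^bsub>M\<^esub> v) (s \<otimes>\<^bsub>R\<^esub> t)"
      unfolding loc_rel_def using w(1) w'(1) W_mult by blast
  qed (use assms c W_mult in auto)
  have "loc_class M W u s \<oplus>\<^bsub>localization R M W\<^esub> loc_class M W v t =
    (\<Union>(u', s')\<in>loc_class M W u s. \<Union>(v', t')\<in>loc_class M W v t.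
      loc_class M W (t' \<odot>\<^bsub>M\<^esub> u' \<oplus>\<^bsub>M\<^esub> s' \<odot>\<^bsub>M\<^esub> v') (s' \<otimes>\<^bsub>R\<^esub> t'))"
    by (simp add: localization_def)
  also have "\<dots> = loc_class M W (t \<odot>\<^bsub>M\<^esub> u \<oplus>\<^bsub>M\<^esub> s \<odot>\<^bsub>M\<^esub> v) (s \<otimes>\<^bsub>R\<^esub> t)"
    using assms eq by (intro UN_loc_class) auto
  finally show ?thesis .
qed

lemma loc_class_add_same:
  assumes "u \<in> carrier M" "v \<in> carrier M" "s \<in> W"
  shows "loc_class M W u s \<oplus>\<^bsub>localization R M W\<^esub> loc_class M W v s = loc_class M W (u \<oplus>\<^bsub>M\<^esub> v) s"
proof -
  have "s \<odot>\<^bsub>M\<^esub> u \<oplus>\<^bsub>M\<^esub> s \<odot>\<^bsub>M\<^esub> v = s \<odot>\<^bsub>M\<^esub> (u \<oplus>\<^bsub>M\<^esub> v)" using assms by (simp add: smult_r_distr)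
  then show ?thesis using assms loc_class_cancel[of "u \<oplus>\<^bsub>M\<^esub> v" s s] W_mult by (simp add: loc_class_add)
qed

lemma loc_class_closed: "u \<in> carrier M \<Longrightarrow> s \<in> W \<Longrightarrow> loc_class M W u s \<in> carrier (localization R M W)"
  by (auto simp: carrier_localization)

lemma abelian_group_localization: "abelian_group (localization R M W)"
proof (rule abelian_groupI)
  let ?L = "localization R M W"
  show "\<zero>\<^bsub>?L\<^esub> \<in> carrier ?L" unfolding zero_localization using one_in_W by (simp add: loc_class_closed)
  fix a assume "a \<in> carrier ?L"
  then obtain u s where a: "a = loc_class M W u s" "u \<in> carrier M" "s \<in> W" by (auto simp: carrier_localization)
  show "\<zero>\<^bsub>?L\<^esub> \<oplus>\<^bsub>?L\<^esub> a = a"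
    using a loc_class_add_same[of "\<zero>\<^bsub>M\<^esub>" u s] by (simp add: loc_class_zero)
  show "\<exists>b\<in>carrier ?L. b \<oplus>\<^bsub>?L\<^esub> a = \<zero>\<^bsub>?L\<^esub>"
    using a loc_class_add_same[of "\<ominus>\<^bsub>M\<^esub> u" u s]
    by (intro bexI[of _ "loc_class M W (\<ominus>\<^bsub>M\<^esub> u) s"]) (simp_all add: M.l_neg loc_class_zero loc_class_closed)
  fix b assume "b \<in> carrier ?L"
  then obtain v t where b: "b = loc_class M W v t" "v \<in> carrier M" "t \<in> W" by (auto simp: carrier_localization)
  show "a \<oplus>\<^bsub>?L\<^esub> b \<in> carrier ?L" using a b W_mult by (simp add: loc_class_add loc_class_closed)
  show "a \<oplus>\<^bsub>?L\<^esub> b = b \<oplus>\<^bsub>?L\<^esub> a" using a b by (simp add: loc_class_add R.m_comm M.a_comm)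
  fix c assume "c \<in> carrier ?L"
  then obtain z r where c: "c = loc_class M W z r" "z \<in> carrier M" "r \<in> W" by (auto simp: carrier_localization)
  show "a \<oplus>\<^bsub>?L\<^esub> b \<oplus>\<^bsub>?L\<^esub> c = a \<oplus>\<^bsub>?L\<^esub> (b \<oplus>\<^bsub>?L\<^esub> c)"
    using a b c W_mult
    by (simp add: loc_class_add smult_r_distr smult_assoc1[symmetric] R.m_ac M.a_ac)
qed

lemma loc_class_a_inv:
  assumes "u \<in> carrier M" "s \<in> W"
  shows "\<ominus>\<^bsub>localization R M W\<^esub> loc_class M W u s = loc_class M W (\<ominus>\<^bsub>M\<^esub> u) s"
proof -
  interpret L: abelian_group "localization R M W" by (rule abelian_group_localization)
  show ?thesis
    using loc_class_add_same[of "\<ominus>\<^bsub>M\<^esub> u" u s] assms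
    by (intro L.minus_equality) (simp_all add: M.l_neg loc_class_zero loc_class_closed)
qed

lemma loc_class_finsum:
  assumes "finite S" "g \<in> S \<rightarrow> carrier M" "s \<in> W"
  shows "finsum (localization R M W) (\<lambda>i. loc_class M W (g i) s) S = loc_class M W (finsum M g S) s"
proof -
  interpret L: abelian_group "localization R M W" by (rule abelian_group_localization)
  show ?thesis
    using assms(1,2)
  proof (induction rule: finite_induct)
    case empty
    then show ?case using assms(3) by (simp add: loc_class_zero)
  next
    case (insert i S)
    then have "(\<lambda>i. loc_class M W (g i) s) \<in> S \<rightarrow> carrier (localization R M W)"
      using assms(3) by (auto intro!: loc_class_closed)
    then show ?case
      using insert assms(3) by (simp add: Pi_def loc_class_closed loc_class_add_same)
  qed
qed

end

lemma loc_class_restrict: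
  assumes "module_localization R M W'" "module_localization R M W" "W' \<subseteq> W" "u \<in> carrier M" "s \<in> W'"
  shows "(\<Union>(v, t)\<in>loc_class M W' u s. loc_class M W v t) = loc_class M W u s"
proof -
  interpret W': module_localization R M W' by fact
  interpret W: module_localization R M W by fact
  show ?thesis
  proof (rule W'.UN_loc_class[OF assms(4,5)])
    fix v t assume "v \<in> carrier M" "t \<in> W'" "W'.loc_rel u s v t"
    moreover have "W.loc_rel u s v t"
      using \<open>W'.loc_rel u s v t\<close> assms(3) unfolding W.loc_rel_def W'.loc_rel_def by blast
    ultimately show "loc_class M W v t = loc_class M W u s"
      using assms(3-5) W.loc_rel_sym[of u s v t] W.loc_class_eq_iff[of v u t s] by blast
  qed
qed

lemma loc_class_map:
  assumes "module_localization R M W" "module_localization R N W"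
    and f: "\<And>u. u \<in> carrier M \<Longrightarrow> f u \<in> carrier N"
      "\<And>r u. r \<in> carrier R \<Longrightarrow> u \<in> carrier M \<Longrightarrow> f (r \<odot>\<^bsub>M\<^esub> u) = r \<odot>\<^bsub>N\<^esub> f u"
    and "u \<in> carrier M" "s \<in> W"
  shows "(\<Union>(v, t)\<in>loc_class M W u s. loc_class N W (f v) t) = loc_class N W (f u) s"
proof -
  interpret M: module_localization R M W by fact
  interpret N: module_localization R N W by fact
  show ?thesis
  proof (rule M.UN_loc_class[OF assms(5,6)])
    fix v t assume v: "v \<in> carrier M" "t \<in> W" "M.loc_rel u s v t"
    then obtain w where w: "w \<in> W" "w \<odot>\<^bsub>M\<^esub> (t \<odot>\<^bsub>M\<^esub> u) = w \<odot>\<^bsub>M\<^esub> (s \<odot>\<^bsub>M\<^esub> v)"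
      unfolding M.loc_rel_def by blast
    have "w \<odot>\<^bsub>N\<^esub> (t \<odot>\<^bsub>N\<^esub> f u) = f (w \<odot>\<^bsub>M\<^esub> (t \<odot>\<^bsub>M\<^esub> u))" using w(1) v assms(5) f by simp
    also have "\<dots> = w \<odot>\<^bsub>N\<^esub> (s \<odot>\<^bsub>N\<^esub> f v)" unfolding w(2) using w(1) v assms(6) f by simp
    finally have "N.loc_rel (f u) s (f v) t" unfolding N.loc_rel_def using w(1) by blast
    then show "loc_class N W (f v) t = loc_class N W (f u) s"
      using v assms(5,6) f(1) N.loc_rel_sym by (subst N.loc_class_eq_iff) auto
  qed
qed

lemma (in abelian_group) translates_eq_iff:
  assumes H: "additive_subgroup H G" and v: "v \<in> carrier G" "w \<in> carrier G"
  shows "(\<lambda>h. h \<oplus> v) ` H = (\<lambda>h. h \<oplus> w) ` H \<longleftrightarrow> v \<ominus> w \<in> H"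
proof -
  interpret H: additive_subgroup H G by fact
  have sub: "(\<lambda>h. h \<oplus> a) ` H \<subseteq> (\<lambda>h. h \<oplus> b) ` H"
    if "a \<ominus> b \<in> H" "a \<in> carrier G" "b \<in> carrier G" for a b
  proof
    fix z assume "z \<in> (\<lambda>h. h \<oplus> a) ` H"
    then obtain h where h: "h \<in> H" "z = h \<oplus> a" by blast
    have "z = (h \<oplus> (a \<ominus> b)) \<oplus> b"
      unfolding h(2) using h(1) that(2,3) H.a_Hcarr[OF h(1)] by (simp add: minus_eq a_assoc l_neg)
    then show "z \<in> (\<lambda>h. h \<oplus> b) ` H" using H.a_closed[OF h(1) that(1)] by blast
  qed
  show ?thesis
  proof
    assume "(\<lambda>h. h \<oplus> v) ` H = (\<lambda>h. h \<oplus> w) ` H"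
    moreover have "v \<in> (\<lambda>h. h \<oplus> v) ` H" using v(1) H.zero_closed by (auto intro!: image_eqI[of _ _ \<zero>])
    ultimately obtain h where h: "h \<in> H" "v = h \<oplus> w" by blast
    have "v \<ominus> w = h" unfolding h(2) using v(2) H.a_Hcarr[OF h(1)] by (simp add: minus_eq a_assoc r_neg)
    then show "v \<ominus> w \<in> H" using h(1) by simp
  next
    assume vw: "v \<ominus> w \<in> H"
    have "w \<ominus> v = \<ominus> (v \<ominus> w)" using v by (simp add: minus_eq minus_add a_comm)
    then have "w \<ominus> v \<in> H" using H.a_inv_closed[OF vw] by simp
    then show "(\<lambda>h. h \<oplus> v) ` H = (\<lambda>h. h \<oplus> w) ` H" using sub vw v by blast
  qed
qed

section \<open>Top local cohomology\<close>

lemma PiE_singleton_domain: "(\<Pi>\<^sub>E i \<in> {a}. F i) = (\<lambda>v. \<lambda>i\<in>{a}. v) ` F a"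
proof
  show "(\<Pi>\<^sub>E i \<in> {a}. F i) \<subseteq> (\<lambda>v. \<lambda>i\<in>{a}. v) ` F a"
  proof
    fix c assume c: "c \<in> (\<Pi>\<^sub>E i \<in> {a}. F i)"
    then have "c = (\<lambda>i\<in>{a}. c a)" by (auto simp: fun_eq_iff PiE_def extensional_def)
    then show "c \<in> (\<lambda>v. \<lambda>i\<in>{a}. v) ` F a" using PiE_mem[OF c] by blast
  qed
  have "(\<lambda>i\<in>{a}. v) \<in> (\<Pi>\<^sub>E i \<in> {a}. F i)" if "v \<in> F a" for v
    unfolding restrict_PiE_iff using that by blast
  then show "(\<lambda>v. \<lambda>i\<in>{a}. v) ` F a \<subseteq> (\<Pi>\<^sub>E i \<in> {a}. F i)" by blast
qed

lemma inj_const_restrict: "inj (\<lambda>v. \<lambda>i\<in>{a}. v)"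
  by (intro injI) (metis restrict_apply singletonI)

locale cech_module = module R M for R (structure) and M (structure) +
  fixes xs :: "'a list"
  assumes xs_carrier: "set xs \<subseteq> carrier R"
begin

abbreviation "idx \<equiv> {..<length xs}"

abbreviation "cprod S \<equiv> finprod R (\<lambda>i. xs ! i) S"

lemma xs_nth [simp]: "i < length xs \<Longrightarrow> xs ! i \<in> carrier R"
  using xs_carrier nth_mem by blast

lemma xs_pow_closed: "S \<subseteq> idx \<Longrightarrow> (\<lambda>i. (xs ! i) [^]\<^bsub>R\<^esub> (k i :: nat)) \<in> S \<rightarrow> carrier R"
  by (auto intro!: R.nat_pow_closed)

lemma cprod_closed [simp]: "S \<subseteq> idx \<Longrightarrow> cprod S \<in> carrier R"
  by (intro R.finprod_closed) auto

lemma cech_monoid_memI: "finprod R (\<lambda>i. (xs ! i) [^]\<^bsub>R\<^esub> (k i :: nat)) S \<in> cech_monoid R xs S"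
  unfolding cech_monoid_def by blast

lemma cprod_pow:
  assumes "S \<subseteq> idx"
  shows "cprod S [^]\<^bsub>R\<^esub> n = finprod R (\<lambda>i. (xs ! i) [^]\<^bsub>R\<^esub> (n :: nat)) S"
  using finite_subset[OF assms finite_lessThan] assms
proof (induction S rule: finite_induct)
  case empty
  then show ?case by simp
next
  case (insert i S)
  then show ?case
    using xs_pow_closed[of S "\<lambda>_. n"] by (simp add: Pi_def R.nat_pow_distrib subset_iff)
qed

lemma cprod_pow_mem: "S \<subseteq> idx \<Longrightarrow> cprod S [^]\<^bsub>R\<^esub> (n :: nat) \<in> cech_monoid R xs S"
  using cprod_pow[of S n] cech_monoid_memI[of "\<lambda>_. n" S] by simp

lemma module_localization_cech:
  assumes S: "S \<subseteq> idx"
  shows "module_localization R M (cech_monoid R xs S)"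
proof (unfold_locales)
  show "cech_monoid R xs S \<subseteq> carrier R"
    unfolding cech_monoid_def using xs_pow_closed[OF S] by (auto intro!: R.finprod_closed)
  show "\<one>\<^bsub>R\<^esub> \<in> cech_monoid R xs S" using cprod_pow_mem[OF S, of 0] by simp
  fix s t assume "s \<in> cech_monoid R xs S" "t \<in> cech_monoid R xs S"
  then obtain k l where kl: "s = finprod R (\<lambda>i. (xs ! i) [^]\<^bsub>R\<^esub> (k i :: nat)) S"
    "t = finprod R (\<lambda>i. (xs ! i) [^]\<^bsub>R\<^esub> (l i :: nat)) S" unfolding cech_monoid_def by blast
  have "s \<otimes>\<^bsub>R\<^esub> t = finprod R (\<lambda>i. (xs ! i) [^]\<^bsub>R\<^esub> (k i + l i)) S"
    unfolding kl R.finprod_multf[OF xs_pow_closed[OF S] xs_pow_closed[OF S], symmetric]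
    using S by (intro R.finprod_cong') (auto simp: R.nat_pow_mult subset_iff intro!: R.nat_pow_closed)
  then show "s \<otimes>\<^bsub>R\<^esub> t \<in> cech_monoid R xs S" using cech_monoid_memI by simp
qed

text \<open>All exponents are padded to a common value. Thus every fraction can be written with a
  power of the product of the parameters as its denominator.\<close>

lemma cech_monoid_complement:
  assumes S: "S \<subseteq> idx" and "s \<in> cech_monoid R xs S"
  obtains s' t where "s' \<in> cech_monoid R xs S" "t > 0" "s \<otimes>\<^bsub>R\<^esub> s' = cprod S [^]\<^bsub>R\<^esub> (t :: nat)"
proof -
  have fin: "finite S" using S finite_subset by blast
  obtain k where k: "s = finprod R (\<lambda>i. (xs ! i) [^]\<^bsub>R\<^esub> (k i :: nat)) S"
    using assms(2) unfolding cech_monoid_def by blast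
  \<comment> \<open>The sum bounds each exponent. The successor keeps \<open>t\<close> positive, so
    that the powers \<open>x_i^t\<close> of a system of parameters form one again.\<close>
  define t where "t = Suc (sum k S)"
  have "k i \<le> t" if "i \<in> S" for i using member_le_sum[of i S k] that fin by (simp add: t_def)
  then have *: "s \<otimes>\<^bsub>R\<^esub> finprod R (\<lambda>i. (xs ! i) [^]\<^bsub>R\<^esub> (t - k i)) S = cprod S [^]\<^bsub>R\<^esub> t"
    unfolding k cprod_pow[OF S] R.finprod_multf[OF xs_pow_closed[OF S] xs_pow_closed[OF S], symmetric]
    using S by (intro R.finprod_cong') (auto simp: R.nat_pow_mult subset_iff intro!: R.nat_pow_closed)
  have "t > 0" by (simp add: t_def)
  then show ?thesis by (rule that[OF cech_monoid_memI _ *])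
qed

lemma cech_monoid_mono:
  assumes "S \<subseteq> T" "T \<subseteq> idx"
  shows "cech_monoid R xs S \<subseteq> cech_monoid R xs T"
proof
  fix s assume "s \<in> cech_monoid R xs S"
  then obtain k where k: "s = finprod R (\<lambda>i. (xs ! i) [^]\<^bsub>R\<^esub> (k i :: nat)) S"
    unfolding cech_monoid_def by blast
  have "s = finprod R (\<lambda>i. (xs ! i) [^]\<^bsub>R\<^esub> (if i \<in> S then k i else 0)) T"
    unfolding k using assms finite_subset[OF assms(2)] xs_pow_closed[OF assms(2)]
    by (intro R.finprod_mono_neutral_cong_left) auto
  then show "s \<in> cech_monoid R xs T" using cech_monoid_memI by simp
qed

abbreviation "tfrac u s \<equiv> loc_class M (cech_monoid R xs idx) u s"

abbreviation "tloc \<equiv> cech_loc R xs M idx"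

sublocale top: module_localization R M "cech_monoid R xs idx"
  by (rule module_localization_cech) simp

lemma tloc_eq: "tloc = localization R M (cech_monoid R xs idx)"
  by (simp add: cech_loc_def)

sublocale tloc: abelian_group tloc
  unfolding tloc_eq by (rule top.abelian_group_localization)

abbreviation "ppow n \<equiv> cprod idx [^]\<^bsub>R\<^esub> (n :: nat)"

abbreviation "power_span n \<equiv> mult_span R M ((\<lambda>i. (xs ! i) [^]\<^bsub>R\<^esub> (n :: nat)) ` idx)"

lemma pow_img: "(\<lambda>i. (xs ! i) [^]\<^bsub>R\<^esub> (n :: nat)) ` idx \<subseteq> carrier R"
  by (auto intro!: R.nat_pow_closed)

lemma ppow_mem [simp]: "ppow n \<in> cech_monoid R xs idx"
  by (rule cprod_pow_mem) simp

lemma ppow_closed [simp]: "ppow n \<in> carrier R"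
  by simp

lemma tloc_rep:
  assumes "v \<in> carrier tloc"
  obtains u t where "u \<in> carrier M" "t > 0" "v = tfrac u (ppow t)"
proof -
  obtain u s where us: "u \<in> carrier M" "s \<in> cech_monoid R xs idx" "v = tfrac u s"
    using assms unfolding tloc_eq top.carrier_localization by blast
  obtain s' t where s': "s' \<in> cech_monoid R xs idx" "t > 0" "s \<otimes>\<^bsub>R\<^esub> s' = ppow t"
    using cech_monoid_complement[OF order_refl us(2)] by metis
  have "v = tfrac (s' \<odot>\<^bsub>M\<^esub> u) (ppow t)"
    using top.loc_class_cancel[of u s s'] us s' by (metis top.W_closed ppow_mem)
  then show ?thesis using that us s' by (metis smult_closed top.W_closed)
qed

lemma cprod_split:
  assumes "i \<in> idx"
  shows "ppow n = (xs ! i) [^]\<^bsub>R\<^esub> n \<otimes>\<^bsub>R\<^esub> cprod (idx - {i}) [^]\<^bsub>R\<^esub> n"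
proof -
  have "cprod idx = cprod (insert i (idx - {i}))" using assms by (simp add: insert_absorb)
  also have "\<dots> = xs ! i \<otimes>\<^bsub>R\<^esub> cprod (idx - {i})" using assms by (subst R.finprod_insert) auto
  finally show ?thesis using assms by (simp add: R.nat_pow_distrib)
qed

text \<open>This is the well-definedness of the transition maps from
  \<open>M/(x_1^n, ..., x_e^n)M\<close> to \<open>M/(x_1^(m+n), ..., x_e^(m+n))M\<close>: the factor
  \<open>x_i^m\<close> of the multiplier raises the exponent of \<open>x_i^n\<close>.\<close>

lemma power_span_ppow:
  assumes "g \<in> power_span n"
  shows "ppow m \<odot>\<^bsub>M\<^esub> g \<in> power_span (m + n)"
proof -
  let ?H = "{g \<in> carrier M. ppow m \<odot>\<^bsub>M\<^esub> g \<in> power_span (m + n)}"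
  have "submodule ?H R M"
    using mult_span_zero[OF pow_img] mult_span_add[OF pow_img] mult_span_a_inv[OF pow_img]
      mult_span_smult[OF pow_img]
    by (intro submoduleI) (auto simp: smult_r_minus smult_r_distr top.smult_left_commute)
  moreover have "y \<odot>\<^bsub>M\<^esub> b \<in> ?H" if "y \<in> (\<lambda>i. (xs ! i) [^]\<^bsub>R\<^esub> n) ` idx" "b \<in> carrier M" for y b
  proof -
    obtain i where i: "i \<in> idx" "y = (xs ! i) [^]\<^bsub>R\<^esub> n" using \<open>y \<in> _\<close> by blast
    have c: "cprod (idx - {i}) [^]\<^bsub>R\<^esub> m \<in> carrier R" "(xs ! i) [^]\<^bsub>R\<^esub> m \<in> carrier R" "y \<in> carrier R" using i by auto
    have "ppow m \<odot>\<^bsub>M\<^esub> (y \<odot>\<^bsub>M\<^esub> b) = (xs ! i) [^]\<^bsub>R\<^esub> (m + n) \<odot>\<^bsub>M\<^esub> (cprod (idx - {i}) [^]\<^bsub>R\<^esub> m \<odot>\<^bsub>M\<^esub> b)"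
      unfolding cprod_split[OF i(1)] i(2) using i that(2) c
      by (simp add: smult_assoc1[symmetric] R.m_ac R.nat_pow_mult[symmetric])
    then show ?thesis using i c that(2) mult_span_mem by auto
  qed
  ultimately have "power_span n \<subseteq> ?H" by (rule mult_span_least)
  then show ?thesis using assms by blast
qed

text \<open>The sum of the images of the localizations that omit one parameter:
  \<open>x_i^n b\<close> over \<open>(x_1 ... x_e)^n\<close> equals \<open>b\<close> over the
  \<open>n\<close>-th power of the product of the other parameters.\<close>

definition top_boundaries :: "('c \<times> 'a) set set" where
  "top_boundaries = {tfrac g (ppow n) | g n. g \<in> power_span n}"

lemma power_span_carrier: "g \<in> power_span n \<Longrightarrow> g \<in> carrier M"
  using mult_span_in_carrier[OF pow_img] .

lemma top_boundariesI: "g \<in> power_span n \<Longrightarrow> tfrac g (ppow n) \<in> top_boundaries"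
  unfolding top_boundaries_def by blast

lemma top_boundaries_subgroup: "additive_subgroup top_boundaries tloc"
proof (intro additive_subgroup.intro tloc.add.subgroupI)
  show "top_boundaries \<subseteq> carrier (tloc)"
    unfolding top_boundaries_def tloc_eq using power_span_carrier by (auto intro!: top.loc_class_closed)
  have "tfrac \<zero>\<^bsub>M\<^esub> (ppow 0) \<in> top_boundaries" using mult_span_zero[OF pow_img] by (rule top_boundariesI)
  then show "top_boundaries \<noteq> {}" by blast
  fix a assume "a \<in> top_boundaries"
  then obtain g n where g: "a = tfrac g (ppow n)" "g \<in> power_span n" unfolding top_boundaries_def by blast
  show "\<ominus>\<^bsub>tloc\<^esub> a \<in> top_boundaries"
    unfolding g(1) using mult_span_a_inv[OF pow_img g(2)] power_span_carrier[OF g(2)]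
    by (subst tloc_eq, subst top.loc_class_a_inv) (auto intro: top_boundariesI)
  fix b assume "b \<in> top_boundaries"
  then obtain h m where h: "b = tfrac h (ppow m)" "h \<in> power_span m" unfolding top_boundaries_def by blast
  have "ppow m \<odot>\<^bsub>M\<^esub> g \<oplus>\<^bsub>M\<^esub> ppow n \<odot>\<^bsub>M\<^esub> h \<in> power_span (n + m)"
    using power_span_ppow[OF g(2), of m] power_span_ppow[OF h(2), of n] mult_span_add[OF pow_img]
    by (simp add: add.commute)
  then have "tfrac (ppow m \<odot>\<^bsub>M\<^esub> g \<oplus>\<^bsub>M\<^esub> ppow n \<odot>\<^bsub>M\<^esub> h) (ppow (n + m)) \<in> top_boundaries" by (rule top_boundariesI)
  then show "a \<oplus>\<^bsub>tloc\<^esub> b \<in> top_boundaries"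
    unfolding g(1) h(1) tloc_eq using power_span_carrier g(2) h(2)
    by (subst top.loc_class_add) (auto simp: R.nat_pow_mult)
qed

text \<open>Equality of two fractions holds after multiplication by some \<open>w\<close> of the
  monoid, and \<open>w\<close> divides a power of the product. The condition says that the class of
  \<open>u\<close> dies at a finite stage of the direct system.\<close>

lemma tfrac_top_boundaries_iff:
  assumes "u \<in> carrier M"
  shows "tfrac u (ppow t) \<in> top_boundaries \<longleftrightarrow> (\<exists>n. ppow n \<odot>\<^bsub>M\<^esub> u \<in> power_span (n + t))"
proof
  assume "tfrac u (ppow t) \<in> top_boundaries"
  then obtain g n where g: "tfrac u (ppow t) = tfrac g (ppow n)" "g \<in> power_span n"
    unfolding top_boundaries_def by blast
  have gM: "g \<in> carrier M" using power_span_carrier g(2) .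
  obtain w where w: "w \<in> cech_monoid R xs idx" "w \<odot>\<^bsub>M\<^esub> (ppow n \<odot>\<^bsub>M\<^esub> u) = w \<odot>\<^bsub>M\<^esub> (ppow t \<odot>\<^bsub>M\<^esub> g)"
    using g(1) top.loc_class_eq_iff[OF assms gM, of "ppow t" "ppow n"] unfolding top.loc_rel_def by auto
  obtain w' k where w': "w' \<in> cech_monoid R xs idx" "w \<otimes>\<^bsub>R\<^esub> w' = ppow k"
    using cech_monoid_complement[OF order_refl w(1)] by metis
  have wc: "w \<in> carrier R" "w' \<in> carrier R" using w w' by auto
  have "ppow (k + n) \<odot>\<^bsub>M\<^esub> u = w' \<odot>\<^bsub>M\<^esub> (w \<odot>\<^bsub>M\<^esub> (ppow n \<odot>\<^bsub>M\<^esub> u))"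
    using wc assms by (simp add: smult_assoc1[symmetric] R.nat_pow_mult[symmetric] w'(2)[symmetric] R.m_ac)
  also have "\<dots> = ppow (k + t) \<odot>\<^bsub>M\<^esub> g"
    unfolding w(2) using wc gM
    by (simp add: smult_assoc1[symmetric] R.nat_pow_mult[symmetric] w'(2)[symmetric] R.m_ac)
  also have "\<dots> \<in> power_span (k + t + n)" using power_span_ppow[OF g(2)] .
  finally show "\<exists>n. ppow n \<odot>\<^bsub>M\<^esub> u \<in> power_span (n + t)"
    by (intro exI[of _ "k + n"]) (simp add: ac_simps)
next
  assume "\<exists>n. ppow n \<odot>\<^bsub>M\<^esub> u \<in> power_span (n + t)"
  then obtain n where n: "ppow n \<odot>\<^bsub>M\<^esub> u \<in> power_span (n + t)" by blast
  have eq: "ppow t \<otimes>\<^bsub>R\<^esub> ppow n = ppow (n + t)" by (simp add: R.nat_pow_mult add.commute)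
  have "tfrac u (ppow t) = tfrac (ppow n \<odot>\<^bsub>M\<^esub> u) (ppow (n + t))"
    using top.loc_class_cancel[of u "ppow t" "ppow n"] assms unfolding eq by simp
  then show "tfrac u (ppow t) \<in> top_boundaries" using top_boundariesI[OF n] by simp
qed

section \<open>The Cech complex in top degree\<close>

abbreviation "const_cochain v \<equiv> (\<lambda>S\<in>{idx}. v)"

lemma cech_index_top: "cech_index xs (length xs) = {idx}"
proof -
  have "S = idx" if "S \<subseteq> idx" "card S = length xs" for S
    using card_subset_eq[of idx S] that by simp
  then show ?thesis unfolding cech_index_def by auto
qed

lemma cech_index_above: "cech_index xs (Suc (length xs)) = {}"
proof -
  have "\<not> (S \<subseteq> idx \<and> card S = Suc (length xs))" for S
    using card_mono[of idx S] by auto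
  then show ?thesis unfolding cech_index_def by simp
qed

lemma carrier_top_cochains: "carrier (cech_cochains R xs M (length xs)) = const_cochain ` carrier tloc"
  unfolding cech_cochains_def cech_index_top partial_object.simps by (rule PiE_singleton_domain)

lemma cech_cocycles_top: "cech_cocycles R xs M (length xs) = const_cochain ` carrier tloc"
  unfolding cech_cocycles_def carrier_top_cochains[symmetric]
  by (auto simp: cech_differential_def cech_index_above cech_cochains_def)

lemma mult_top_cochains:
  "const_cochain v \<otimes>\<^bsub>cech_cochains R xs M (length xs)\<^esub> const_cochain w = const_cochain (v \<oplus>\<^bsub>tloc\<^esub> w)"
  unfolding cech_cochains_def cech_index_top by (auto simp: fun_eq_iff)

text \<open>Once the denominator is padded to the \<open>n\<close>-th power of the product over the
  face, numerator and denominator are multiplied by \<open>x_i^n\<close>.\<close>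

lemma restrict_mem_top_boundaries:
  assumes i: "i \<in> idx" and v: "v \<in> carrier (cech_loc R xs M (idx - {i}))"
  shows "cech_restrict R xs M idx v \<in> top_boundaries"
proof -
  have sub: "idx - {i} \<subseteq> idx" by blast
  interpret face: module_localization R M "cech_monoid R xs (idx - {i})" using module_localization_cech[OF sub] .
  obtain b s where b: "b \<in> carrier M" "s \<in> cech_monoid R xs (idx - {i})"
    "v = loc_class M (cech_monoid R xs (idx - {i})) b s"
    using v unfolding cech_loc_def face.carrier_localization by blast
  note mono = cech_monoid_mono[OF sub order_refl]
  have s: "s \<in> cech_monoid R xs idx" using b(2) mono by blast
  have "cech_restrict R xs M idx v = tfrac b s"
    unfolding cech_restrict_def b(3)
    using loc_class_restrict[OF face.module_localization_axioms top.module_localization_axioms mono b(1,2)] .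
  obtain s' n where s': "s' \<in> cech_monoid R xs (idx - {i})" "s \<otimes>\<^bsub>R\<^esub> s' = cprod (idx - {i}) [^]\<^bsub>R\<^esub> (n::nat)"
    using cech_monoid_complement[OF sub b(2)] by metis
  have c: "s' \<in> carrier R" "s \<in> carrier R" "(xs ! i) [^]\<^bsub>R\<^esub> n \<in> carrier R" using s' s i by auto
  have "s \<otimes>\<^bsub>R\<^esub> ((xs ! i) [^]\<^bsub>R\<^esub> n \<otimes>\<^bsub>R\<^esub> s') = (xs ! i) [^]\<^bsub>R\<^esub> n \<otimes>\<^bsub>R\<^esub> (s \<otimes>\<^bsub>R\<^esub> s')" using c by (simp add: R.m_lcomm)
  then have eq: "s \<otimes>\<^bsub>R\<^esub> ((xs ! i) [^]\<^bsub>R\<^esub> n \<otimes>\<^bsub>R\<^esub> s') = ppow n" unfolding s'(2) cprod_split[OF i] .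
  then have "tfrac b s = tfrac (((xs ! i) [^]\<^bsub>R\<^esub> n \<otimes>\<^bsub>R\<^esub> s') \<odot>\<^bsub>M\<^esub> b) (ppow n)"
    using top.loc_class_cancel[of b s "(xs ! i) [^]\<^bsub>R\<^esub> n \<otimes>\<^bsub>R\<^esub> s'"] b(1) s c by simp
  moreover have "((xs ! i) [^]\<^bsub>R\<^esub> n \<otimes>\<^bsub>R\<^esub> s') \<odot>\<^bsub>M\<^esub> b \<in> power_span n"
    using i c b(1) by (auto simp: smult_assoc1 intro!: mult_span_mem)
  ultimately show ?thesis using \<open>cech_restrict R xs M idx v = tfrac b s\<close> top_boundariesI by simp
qed

lemma top_boundaries_eq_differential:
  assumes "length xs = Suc q" "v \<in> top_boundaries"
  shows "const_cochain v \<in> cech_differential R xs M q ` carrier (cech_cochains R xs M q)"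
proof -
  obtain g n where g: "v = tfrac g (ppow n)" "g \<in> power_span n" using assms(2) unfolding top_boundaries_def by blast
  obtain f where f: "\<forall>i\<in>idx. f i \<in> carrier M" "g = finsum M (\<lambda>i. (xs ! i) [^]\<^bsub>R\<^esub> n \<odot>\<^bsub>M\<^esub> f i) idx"
    using g(2) mult_span_image_eq[of idx "\<lambda>i. (xs ! i) [^]\<^bsub>R\<^esub> n"] by (auto simp: Pi_def)
  \<comment> \<open>The sign is chosen to cancel the one with which the face omitting
    \<open>i\<close> enters the differential.\<close>
  define b where "b i = (if even (card {j \<in> idx. j < i}) then f i else \<ominus>\<^bsub>M\<^esub> f i)" for i
  have bM: "b i \<in> carrier M" if "i \<in> idx" for i using f(1) that by (simp add: b_def)
  \<comment> \<open>A face \<open>S\<close> with \<open>q\<close> elements misses exactly one index,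
    which \<open>the_elem\<close> recovers.\<close>
  define c where "c = (\<lambda>S\<in>cech_index xs q. loc_class M (cech_monoid R xs S) (b (the_elem (idx - S))) (cprod S [^]\<^bsub>R\<^esub> n))"
  have face: "idx - {i} \<in> cech_index xs q" if "i \<in> idx" for i
    using that assms(1) unfolding cech_index_def by auto
  have face': "\<exists>i\<in>idx. idx - S = {i} \<and> S = idx - {i}" if "S \<in> cech_index xs q" for S
  proof -
    have S: "S \<subseteq> idx" "card S = q" using that unfolding cech_index_def by auto
    then have "card (idx - S) = 1" using assms(1) card_Diff_subset[of S idx] finite_subset[OF S(1)] by simp
    then obtain i where "idx - S = {i}" using card_1_singletonE by blast
    moreover from this have "S = idx - {i}" "i \<in> idx" using S(1) by auto
    ultimately show ?thesis by blast
  qed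
  have c_face: "c (idx - {i}) = loc_class M (cech_monoid R xs (idx - {i})) (b i) (cprod (idx - {i}) [^]\<^bsub>R\<^esub> n)"
    if "i \<in> idx" for i
  proof -
    have "idx - (idx - {i}) = {i}" using that by auto
    then show ?thesis using face[OF that] by (simp add: c_def)
  qed
  have cc: "c \<in> carrier (cech_cochains R xs M q)"
  proof -
    have "c S \<in> carrier (cech_loc R xs M S)" if S: "S \<in> cech_index xs q" for S
    proof -
      obtain i where i: "i \<in> idx" "S = idx - {i}" using face'[OF S] by blast
      interpret face: module_localization R M "cech_monoid R xs (idx - {i})" by (rule module_localization_cech) auto
      show ?thesis unfolding i(2) c_face[OF i(1)] cech_loc_def
        using bM[OF i(1)] cprod_pow_mem[of "idx - {i}" n] by (intro face.loc_class_closed) auto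
    qed
    then show ?thesis unfolding cech_cochains_def by (auto simp: c_def)
  qed
  have res: "cech_restrict R xs M idx (c (idx - {i})) = tfrac ((xs ! i) [^]\<^bsub>R\<^esub> n \<odot>\<^bsub>M\<^esub> b i) (ppow n)" if i: "i \<in> idx" for i
  proof -
    have sub: "idx - {i} \<subseteq> idx" by blast
    interpret face: module_localization R M "cech_monoid R xs (idx - {i})" using module_localization_cech[OF sub] .
    have p: "cprod (idx - {i}) [^]\<^bsub>R\<^esub> n \<in> cech_monoid R xs (idx - {i})" using cprod_pow_mem[OF sub] .
    note mono = cech_monoid_mono[OF sub order_refl]
    have cl: "(xs ! i) [^]\<^bsub>R\<^esub> n \<in> carrier R" "cprod (idx - {i}) [^]\<^bsub>R\<^esub> n \<in> carrier R" using i p by auto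
    have "cech_restrict R xs M idx (c (idx - {i})) = tfrac (b i) (cprod (idx - {i}) [^]\<^bsub>R\<^esub> n)"
      unfolding cech_restrict_def c_face[OF i]
      using loc_class_restrict[OF face.module_localization_axioms top.module_localization_axioms mono bM[OF i] p] .
    also have "\<dots> = tfrac ((xs ! i) [^]\<^bsub>R\<^esub> n \<odot>\<^bsub>M\<^esub> b i) (cprod (idx - {i}) [^]\<^bsub>R\<^esub> n \<otimes>\<^bsub>R\<^esub> (xs ! i) [^]\<^bsub>R\<^esub> n)"
      using top.loc_class_cancel[of "b i" "cprod (idx - {i}) [^]\<^bsub>R\<^esub> n" "(xs ! i) [^]\<^bsub>R\<^esub> n"] bM[OF i] mono p cl
        ppow_mem[of n] by (subst (asm) cprod_split[OF i]) (auto simp: R.m_comm)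
    also have "cprod (idx - {i}) [^]\<^bsub>R\<^esub> n \<otimes>\<^bsub>R\<^esub> (xs ! i) [^]\<^bsub>R\<^esub> n = ppow n" using cl by (simp add: cprod_split[OF i] R.m_comm)
    finally show ?thesis .
  qed
  have term_eq: "(if even (card {j \<in> idx. j < i}) then cech_restrict R xs M idx (c (idx - {i}))
      else \<ominus>\<^bsub>tloc\<^esub> cech_restrict R xs M idx (c (idx - {i}))) = tfrac ((xs ! i) [^]\<^bsub>R\<^esub> n \<odot>\<^bsub>M\<^esub> f i) (ppow n)"
    if i: "i \<in> idx" for i
    unfolding res[OF i] using f(1) i
    by (auto simp: b_def tloc_eq top.loc_class_a_inv smult_r_minus)
  have "finsum tloc (\<lambda>i. if even (card {j \<in> idx. j < i}) then cech_restrict R xs M idx (c (idx - {i}))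
      else \<ominus>\<^bsub>tloc\<^esub> cech_restrict R xs M idx (c (idx - {i}))) idx
    = finsum tloc (\<lambda>i. tfrac ((xs ! i) [^]\<^bsub>R\<^esub> n \<odot>\<^bsub>M\<^esub> f i) (ppow n)) idx"
    using f(1) term_eq
    by (intro tloc.finsum_cong') (auto simp: tloc_eq intro!: top.loc_class_closed)
  also have "\<dots> = v"
    unfolding g(1) f(2) tloc_eq using f(1) by (intro top.loc_class_finsum) auto
  finally have "cech_differential R xs M q c = const_cochain v"
    unfolding cech_differential_def assms(1)[symmetric] cech_index_top by (auto simp: fun_eq_iff)
  then show ?thesis using cc by (metis image_eqI)
qed

lemma cech_coboundaries_top: "cech_coboundaries R xs M (length xs) = const_cochain ` top_boundaries"
proof (cases "length xs")
  \<comment> \<open>Without parameters, the coboundaries in degree 0 are zero by definition, and so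
    is the span of the empty family.\<close>
  case 0
  have idx0: "idx = {}" using 0 by simp
  have "top_boundaries = {\<zero>\<^bsub>tloc\<^esub>}"
  proof -
    have "power_span n = {\<zero>\<^bsub>M\<^esub>}" for n using idx0 mult_span_empty by simp
    then show ?thesis unfolding top_boundaries_def tloc_eq by (auto simp: top.loc_class_zero)
  qed
  moreover have "cech_index xs 0 = {idx}" using cech_index_top 0 by simp
  ultimately show ?thesis using 0 by (auto simp: cech_cochains_def fun_eq_iff)
next
  case (Suc q)
  have "cech_differential R xs M q c \<in> const_cochain ` top_boundaries" if c: "c \<in> carrier (cech_cochains R xs M q)" for c
  proof -
    interpret H: additive_subgroup top_boundaries tloc by (rule top_boundaries_subgroup)
    let ?t = "\<lambda>i. if even (card {j \<in> idx. j < i}) then cech_restrict R xs M idx (c (idx - {i}))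
      else \<ominus>\<^bsub>tloc\<^esub> cech_restrict R xs M idx (c (idx - {i}))"
    have t: "?t i \<in> top_boundaries" if i: "i \<in> idx" for i
    proof -
      have "idx - {i} \<in> cech_index xs q" using i Suc unfolding cech_index_def by auto
      then have "c (idx - {i}) \<in> carrier (cech_loc R xs M (idx - {i}))" using c unfolding cech_cochains_def by auto
      then show ?thesis using restrict_mem_top_boundaries[OF i] H.a_inv_closed by simp
    qed
    have "finsum tloc ?t S \<in> top_boundaries" if "finite S" "S \<subseteq> idx" for S
      using that
    proof (induction S rule: finite_induct)
      case empty
      then show ?case using H.zero_closed by simp
    next
      case (insert i S)
      then have "?t \<in> S \<rightarrow> carrier tloc" "?t i \<in> carrier tloc" using t H.a_Hcarr by blast+
      then show ?case using insert t by (subst tloc.finsum_insert) (auto intro!: H.a_closed)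
    qed
    then have "finsum tloc ?t idx \<in> top_boundaries" by blast
    moreover have "cech_differential R xs M q c = const_cochain (finsum tloc ?t idx)"
      unfolding cech_differential_def Suc[symmetric] cech_index_top by (auto simp: fun_eq_iff)
    ultimately show ?thesis by blast
  qed
  then show ?thesis using top_boundaries_eq_differential[OF Suc] unfolding Suc by auto
qed

end

lemma r_coset_const_cochain:
  assumes "cech_module R M xs"
  shows "cech_coboundaries R xs M (length xs) #>\<^bsub>cech_cochains R xs M (length xs)\<^esub> (\<lambda>S\<in>{{..<length xs}}. v) =
    (\<lambda>w. \<lambda>S\<in>{{..<length xs}}. w) ` (\<lambda>h. h \<oplus>\<^bsub>cech_loc R xs M {..<length xs}\<^esub> v) ` cech_module.top_boundaries R M xs"
proof -
  interpret cech_module R M xs by fact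
  show ?thesis unfolding r_coset_def cech_coboundaries_top using mult_top_cochains by auto
qed

text \<open>The kernel of the map on top local cohomology in terms of elements of the direct limit of
  the modules \<open>M/(x\<^sub>1\<^sup>t, \<dots>, x\<^sub>e\<^sup>t)M\<close>.\<close>

theorem inj_on_local_cohomology_map_iff:
  assumes M: "cech_module R M xs" and N: "cech_module R N xs"
    and f: "\<And>u. u \<in> carrier M \<Longrightarrow> f u \<in> carrier N"
      "\<And>r u. r \<in> carrier R \<Longrightarrow> u \<in> carrier M \<Longrightarrow> f (r \<odot>\<^bsub>M\<^esub> u) = r \<odot>\<^bsub>N\<^esub> f u"
      "\<And>u v. u \<in> carrier M \<Longrightarrow> v \<in> carrier M \<Longrightarrow> f (u \<oplus>\<^bsub>M\<^esub> v) = f u \<oplus>\<^bsub>N\<^esub> f v"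
  shows "inj_on (local_cohomology_map R xs N (length xs) f) (carrier (local_cohomology R xs M (length xs))) \<longleftrightarrow>
    (\<forall>u\<in>carrier M. \<forall>t>0.
      (\<exists>n. finprod R (\<lambda>i. xs ! i) {..<length xs} [^]\<^bsub>R\<^esub> n \<odot>\<^bsub>N\<^esub> f u \<in>
        mult_span R N ((\<lambda>i. (xs ! i) [^]\<^bsub>R\<^esub> (n + t :: nat)) ` {..<length xs})) \<longrightarrow>
      (\<exists>n. finprod R (\<lambda>i. xs ! i) {..<length xs} [^]\<^bsub>R\<^esub> n \<odot>\<^bsub>M\<^esub> u \<in>
        mult_span R M ((\<lambda>i. (xs ! i) [^]\<^bsub>R\<^esub> (n + t :: nat)) ` {..<length xs})))"
    (is "?inj \<longleftrightarrow> ?ker")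
proof -
  interpret M: cech_module R M xs by fact
  interpret N: cech_module R N xs by fact
  let ?e = "length xs" and ?S = "{..<length xs}"
  let ?K = "cech_coboundaries R xs M ?e" and ?c = "\<lambda>v. \<lambda>S\<in>{?S}. v"
  define fl where "fl V = (\<Union>(u, s)\<in>V. loc_class N (cech_monoid R xs ?S) (f u) s)" for V
  have fl: "fl (M.tfrac u s) = N.tfrac (f u) s" if "u \<in> carrier M" "s \<in> cech_monoid R xs ?S" for u s
    unfolding fl_def
    using loc_class_map[OF M.top.module_localization_axioms N.top.module_localization_axioms f(1,2) that] .
  have fl_closed: "fl v \<in> carrier N.tloc" if "v \<in> carrier M.tloc" for v
    using M.tloc_rep[OF that] f(1) fl N.tloc_eq N.top.loc_class_closed N.ppow_mem
    by (metis M.ppow_mem)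
  have fl_add: "fl (v \<oplus>\<^bsub>M.tloc\<^esub> w) = fl v \<oplus>\<^bsub>N.tloc\<^esub> fl w"
    if vw: "v \<in> carrier M.tloc" "w \<in> carrier M.tloc" for v w
  proof -
    obtain u t where ut: "u \<in> carrier M" "v = M.tfrac u (M.ppow t)" using M.tloc_rep[OF vw(1)] by metis
    obtain z r where zr: "z \<in> carrier M" "w = M.tfrac z (M.ppow r)" using M.tloc_rep[OF vw(2)] by metis
    have p: "M.ppow n \<in> carrier R" "M.ppow n \<in> cech_monoid R xs ?S" for n by auto
    show ?thesis
      using p M.top.W_mult[of "M.ppow t" "M.ppow r"] ut(1) zr(1)
      unfolding ut(2) zr(2) M.tloc_eq N.tloc_eq by (simp add: M.top.loc_class_add N.top.loc_class_add fl f)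
  qed
  interpret HM: additive_subgroup M.top_boundaries M.tloc by (rule M.top_boundaries_subgroup)
  interpret HN: additive_subgroup N.top_boundaries N.tloc by (rule N.top_boundaries_subgroup)
  have fl_boundary: "fl v \<in> N.top_boundaries" if v: "v \<in> M.top_boundaries" for v
  proof -
    obtain g n where g: "v = M.tfrac g (M.ppow n)" "g \<in> M.power_span n" using v unfolding M.top_boundaries_def by blast
    let ?H = "{g \<in> carrier M. f g \<in> N.power_span n}"
    have "f \<zero>\<^bsub>M\<^esub> = \<zero>\<^bsub>N\<^esub>" using f(2)[of "\<zero>\<^bsub>R\<^esub>" "\<zero>\<^bsub>M\<^esub>"] f(1) by simp
    moreover have "f (\<ominus>\<^bsub>M\<^esub> a) = \<ominus>\<^bsub>N\<^esub> f a" if "a \<in> carrier M" for a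
      using f(2)[of "\<ominus>\<^bsub>R\<^esub> \<one>\<^bsub>R\<^esub>" a] f(1) that by (simp add: M.smult_l_minus N.smult_l_minus)
    ultimately have "submodule ?H R M"
      using N.mult_span_zero[OF N.pow_img] N.mult_span_add[OF N.pow_img] N.mult_span_a_inv[OF N.pow_img]
        N.mult_span_smult[OF N.pow_img] f
      by (intro M.submoduleI) auto
    then have "M.power_span n \<subseteq> ?H"
      using f(1,2) N.mult_span_mem M.pow_img by (intro M.mult_span_least) (auto simp: subset_iff)
    then have "f g \<in> N.power_span n" using g(2) by blast
    then show ?thesis
      unfolding g(1) using fl[OF M.power_span_carrier[OF g(2)] M.ppow_mem] N.top_boundariesI by simp
  qed
  \<comment> \<open>\<open>CM v\<close> is the cohomology class of \<open>v\<close>: the translate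
    of \<open>top_boundaries\<close> by \<open>v\<close>, its elements wrapped as cochains on the
    single index set. \<open>CN\<close> is the same for \<open>N\<close>.\<close>
  define CM where "CM v = ?c ` (\<lambda>h. h \<oplus>\<^bsub>M.tloc\<^esub> v) ` M.top_boundaries" for v
  define CN where "CN v = ?c ` (\<lambda>h. h \<oplus>\<^bsub>N.tloc\<^esub> v) ` N.top_boundaries" for v
  have CM_eq: "CM v = CM w \<longleftrightarrow> v \<ominus>\<^bsub>M.tloc\<^esub> w \<in> M.top_boundaries"
    if "v \<in> carrier M.tloc" "w \<in> carrier M.tloc" for v w
    unfolding CM_def inj_image_eq_iff[OF inj_const_restrict] M.tloc.translates_eq_iff[OF M.top_boundaries_subgroup that] ..
  have CN_eq: "CN v = CN w \<longleftrightarrow> v \<ominus>\<^bsub>N.tloc\<^esub> w \<in> N.top_boundaries"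
    if "v \<in> carrier N.tloc" "w \<in> carrier N.tloc" for v w
    unfolding CN_def inj_image_eq_iff[OF inj_const_restrict] N.tloc.translates_eq_iff[OF N.top_boundaries_subgroup that] ..
  have carrier_H: "carrier (local_cohomology R xs M ?e) = CM ` carrier M.tloc"
  proof -
    have "?K #>\<^bsub>(cech_cochains R xs M ?e)\<lparr>carrier := cech_cocycles R xs M ?e\<rparr>\<^esub> c = ?K #>\<^bsub>cech_cochains R xs M ?e\<^esub> c" for c
      by (simp add: r_coset_def)
    then show ?thesis
      unfolding local_cohomology_def FactGroup_def RCOSETS_def CM_def
      by (auto simp: M.cech_cocycles_top r_coset_const_cochain[OF M])
  qed
  have map_CM: "local_cohomology_map R xs N ?e f (CM v) = CN (fl v)" if v: "v \<in> carrier M.tloc" for v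
  proof -
    have cmap: "cech_cochain_map R xs N ?e f (?c w) = ?c (fl w)" for w
      unfolding cech_cochain_map_def M.cech_index_top fl_def by (auto simp: fun_eq_iff)
    have CN_same: "CN (fl (h \<oplus>\<^bsub>M.tloc\<^esub> v)) = CN (fl v)" if h: "h \<in> M.top_boundaries" for h
    proof -
      have hc: "h \<in> carrier M.tloc" using HM.a_Hcarr[OF h] .
      have "fl (h \<oplus>\<^bsub>M.tloc\<^esub> v) \<ominus>\<^bsub>N.tloc\<^esub> fl v = fl h"
        using fl_closed[OF hc] fl_closed[OF v]
        by (simp add: fl_add[OF hc v] N.tloc.minus_eq N.tloc.a_assoc N.tloc.r_neg)
      then show ?thesis using CN_eq fl_boundary[OF h] fl_closed v hc M.tloc.a_closed by simp
    qed
    have "local_cohomology_map R xs N ?e f (CM v) = (\<Union>h\<in>M.top_boundaries. CN (fl (h \<oplus>\<^bsub>M.tloc\<^esub> v)))"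
      unfolding local_cohomology_map_def CM_def CN_def
      by (simp add: cmap r_coset_const_cochain[OF N])
    also have "\<dots> = CN (fl v)" using CN_same HM.zero_closed by blast
    finally show ?thesis .
  qed
  have "?inj \<longleftrightarrow> (\<forall>v\<in>carrier M.tloc. fl v \<in> N.top_boundaries \<longrightarrow> v \<in> M.top_boundaries)"
  proof
    assume inj: ?inj
    show "\<forall>v\<in>carrier M.tloc. fl v \<in> N.top_boundaries \<longrightarrow> v \<in> M.top_boundaries"
    proof (intro ballI impI)
      fix v assume v: "v \<in> carrier M.tloc" "fl v \<in> N.top_boundaries"
      have z: "\<zero>\<^bsub>M.tloc\<^esub> \<in> carrier M.tloc" by simp
      have "fl \<zero>\<^bsub>M.tloc\<^esub> \<in> N.top_boundaries" using fl_boundary HM.zero_closed .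
      then have "fl v \<ominus>\<^bsub>N.tloc\<^esub> fl \<zero>\<^bsub>M.tloc\<^esub> \<in> N.top_boundaries"
        using v(2) by (simp add: N.tloc.minus_eq)
      then have "CN (fl v) = CN (fl \<zero>\<^bsub>M.tloc\<^esub>)" using CN_eq fl_closed v(1) z by blast
      then have "CM v = CM \<zero>\<^bsub>M.tloc\<^esub>"
        using inj map_CM[OF v(1)] map_CM[OF z] v(1) z unfolding carrier_H inj_on_def by auto
      moreover have "\<ominus>\<^bsub>M.tloc\<^esub> \<zero>\<^bsub>M.tloc\<^esub> = \<zero>\<^bsub>M.tloc\<^esub>" by (intro M.tloc.minus_equality) simp_all
      ultimately show "v \<in> M.top_boundaries" using CM_eq[OF v(1) z] v(1) by (simp add: M.tloc.minus_eq)
    qed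
  next
    assume ker: "\<forall>v\<in>carrier M.tloc. fl v \<in> N.top_boundaries \<longrightarrow> v \<in> M.top_boundaries"
    show ?inj
    proof (rule inj_onI)
      fix A B assume "A \<in> carrier (local_cohomology R xs M ?e)" "B \<in> carrier (local_cohomology R xs M ?e)"
        and eq: "local_cohomology_map R xs N ?e f A = local_cohomology_map R xs N ?e f B"
      then obtain v w where v: "v \<in> carrier M.tloc" "A = CM v" and w: "w \<in> carrier M.tloc" "B = CM w"
        unfolding carrier_H by blast
      have vw: "v \<ominus>\<^bsub>M.tloc\<^esub> w \<in> carrier M.tloc" using v(1) w(1) by simp
      have "v = (v \<ominus>\<^bsub>M.tloc\<^esub> w) \<oplus>\<^bsub>M.tloc\<^esub> w"
        using v(1) w(1) by (simp add: M.tloc.minus_eq M.tloc.a_assoc M.tloc.l_neg)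
      then have "fl v = fl (v \<ominus>\<^bsub>M.tloc\<^esub> w) \<oplus>\<^bsub>N.tloc\<^esub> fl w" using fl_add[OF vw w(1)] by simp
      then have "fl v \<ominus>\<^bsub>N.tloc\<^esub> fl w = fl (v \<ominus>\<^bsub>M.tloc\<^esub> w)"
        using fl_closed[OF vw] fl_closed[OF w(1)] by (simp add: N.tloc.minus_eq N.tloc.a_assoc N.tloc.r_neg)
      moreover have "CN (fl v) = CN (fl w)" using eq map_CM v w by simp
      ultimately have "fl (v \<ominus>\<^bsub>M.tloc\<^esub> w) \<in> N.top_boundaries" using CN_eq fl_closed v(1) w(1) by simp
      then show "A = B" using ker vw CM_eq v w by simp
    qed
  qed
  also have "\<dots> \<longleftrightarrow> ?ker"
  proof
    assume L: "\<forall>v\<in>carrier M.tloc. fl v \<in> N.top_boundaries \<longrightarrow> v \<in> M.top_boundaries"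
    show ?ker
    proof (intro ballI allI impI)
      fix u and t :: nat assume u: "u \<in> carrier M" "t > 0" "\<exists>n. M.ppow n \<odot>\<^bsub>N\<^esub> f u \<in> N.power_span (n + t)"
      then have "fl (M.tfrac u (M.ppow t)) \<in> N.top_boundaries"
        using fl[OF u(1) M.ppow_mem] N.tfrac_top_boundaries_iff[OF f(1)[OF u(1)], of t] by simp
      moreover have "M.tfrac u (M.ppow t) \<in> carrier M.tloc"
        unfolding M.tloc_eq using M.top.loc_class_closed u(1) M.ppow_mem by blast
      ultimately show "\<exists>n. M.ppow n \<odot>\<^bsub>M\<^esub> u \<in> M.power_span (n + t)"
        using L M.tfrac_top_boundaries_iff[OF u(1), of t] by blast
    qed
  next
    assume Rr: ?ker
    show "\<forall>v\<in>carrier M.tloc. fl v \<in> N.top_boundaries \<longrightarrow> v \<in> M.top_boundaries"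
    proof (intro ballI impI)
      fix v assume v: "v \<in> carrier M.tloc" "fl v \<in> N.top_boundaries"
      obtain u t where ut: "u \<in> carrier M" "t > 0" "v = M.tfrac u (M.ppow t)" using M.tloc_rep[OF v(1)] by metis
      have "\<exists>n. M.ppow n \<odot>\<^bsub>N\<^esub> f u \<in> N.power_span (n + t)"
        using v(2) fl[OF ut(1) M.ppow_mem, of t] N.tfrac_top_boundaries_iff[OF f(1)[OF ut(1)], of t] ut(3) by simp
      then have "\<exists>n. M.ppow n \<odot>\<^bsub>M\<^esub> u \<in> M.power_span (n + t)" using Rr ut(1,2) by blast
      then show "v \<in> M.top_boundaries" using M.tfrac_top_boundaries_iff[OF ut(1), of t] ut(3) by simp
    qed
  qed
  finally show ?thesis .
qed

section \<open>Reduction modulo a principal ideal\<close>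

lemma zero_FactRing: "\<zero>\<^bsub>R Quot I\<^esub> = I"
  by (simp add: FactRing_def)

locale principal_quotient = cring R for R (structure) and x +
  assumes x_carrier: "x \<in> carrier R"
begin

abbreviation "quot \<equiv> R Quot (PIdl x)"

abbreviation "res r \<equiv> PIdl x +> r"

lemma res_hom_cring: "ring_hom_cring R quot (\<lambda>r. res r)"
  using ideal.rcos_ring_hom_cring[OF cgenideal_ideal[OF x_carrier] is_cring] .

sublocale res: ring_hom_cring R quot "\<lambda>r. res r"
  by (rule res_hom_cring)

lemma carrier_quot: "carrier quot = (\<lambda>r. res r) ` carrier R"
  by (auto simp: FactRing_def A_RCOSETS_def' a_r_coset_def')

lemma res_zero_iff: "r \<in> carrier R \<Longrightarrow> res r = \<zero>\<^bsub>quot\<^esub> \<longleftrightarrow> r \<in> PIdl x"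
proof -
  assume r: "r \<in> carrier R"
  have "res r = PIdl x \<longleftrightarrow> r \<in> PIdl x"
    using ideal.rcos_const_imp_mem[OF cgenideal_ideal[OF x_carrier] r] a_rcos_zero[OF cgenideal_ideal[OF x_carrier], of r]
    by (rule iffI)
  then show ?thesis by (simp only: zero_FactRing)
qed

lemma res_eq_iff:
  "r \<in> carrier R \<Longrightarrow> s \<in> carrier R \<Longrightarrow> res r = res s \<longleftrightarrow> r \<ominus> s \<in> PIdl x"
  using quotient_eq_iff_same_a_r_cos[OF cgenideal_ideal[OF x_carrier]] by blast

end

text \<open>\<open>D\<close> is the algebra \<open>B/xB\<close> over \<open>R/xR\<close>, up to isomorphism, with projection \<open>\<pi>\<close>.\<close>

locale algebra_quotient = principal_quotient R x + B?: algebra R B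
  for R (structure) and x and B (structure) and D and \<pi> +
  assumes \<pi>_surj: "\<pi> ` carrier B = carrier D"
    and \<pi>_add: "a \<in> carrier B \<Longrightarrow> b \<in> carrier B \<Longrightarrow> \<pi> (a \<oplus>\<^bsub>B\<^esub> b) = \<pi> a \<oplus>\<^bsub>D\<^esub> \<pi> b"
    and \<pi>_mult: "a \<in> carrier B \<Longrightarrow> b \<in> carrier B \<Longrightarrow> \<pi> (a \<otimes>\<^bsub>B\<^esub> b) = \<pi> a \<otimes>\<^bsub>D\<^esub> \<pi> b"
    and \<pi>_one: "\<pi> \<one>\<^bsub>B\<^esub> = \<one>\<^bsub>D\<^esub>" and \<pi>_zero: "\<pi> \<zero>\<^bsub>B\<^esub> = \<zero>\<^bsub>D\<^esub>"
    and \<pi>_smult: "r \<in> carrier R \<Longrightarrow> b \<in> carrier B \<Longrightarrow> \<pi> (r \<odot>\<^bsub>B\<^esub> b) = (PIdl x +> r) \<odot>\<^bsub>D\<^esub> \<pi> b"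
    and \<pi>_ker: "b \<in> carrier B \<Longrightarrow> \<pi> b = \<zero>\<^bsub>D\<^esub> \<longleftrightarrow> b \<in> mult_span R B {x}"
begin

lemma \<pi>_closed [simp]: "b \<in> carrier B \<Longrightarrow> \<pi> b \<in> carrier D"
  using \<pi>_surj by blast

lemma D_cases:
  assumes "d \<in> carrier D" obtains b where "b \<in> carrier B" "d = \<pi> b"
  using assms \<pi>_surj by blast

text \<open>The locale asks only that \<pi> be surjective and compatible with the operations, so the
  laws of \<open>D\<close> are obtained by lifting elements to \<open>B\<close>.\<close>

lemma algebra_quotient_algebra: "algebra quot D"
proof -
  note h = \<pi>_add[symmetric] \<pi>_mult[symmetric] \<pi>_one[symmetric] \<pi>_zero[symmetric]
  have D: "cring D"
  proof (intro cringI abelian_groupI comm_monoidI)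
    fix a assume "a \<in> carrier D"
    then obtain a' where a: "a' \<in> carrier B" "a = \<pi> a'" using D_cases by blast
    show "\<zero>\<^bsub>D\<^esub> \<oplus>\<^bsub>D\<^esub> a = a" "\<one>\<^bsub>D\<^esub> \<otimes>\<^bsub>D\<^esub> a = a" using a by (simp_all add: h)
    show "\<exists>b\<in>carrier D. b \<oplus>\<^bsub>D\<^esub> a = \<zero>\<^bsub>D\<^esub>"
      using a by (intro bexI[of _ "\<pi> (\<ominus>\<^bsub>B\<^esub> a')"]) (simp_all add: h M.l_neg)
    fix b assume "b \<in> carrier D"
    then obtain b' where b: "b' \<in> carrier B" "b = \<pi> b'" using D_cases by blast
    show "a \<oplus>\<^bsub>D\<^esub> b \<in> carrier D" "a \<otimes>\<^bsub>D\<^esub> b \<in> carrier D" using a b by (simp_all add: h)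
    show "a \<oplus>\<^bsub>D\<^esub> b = b \<oplus>\<^bsub>D\<^esub> a" using a b by (simp add: h M.a_comm)
    show "a \<otimes>\<^bsub>D\<^esub> b = b \<otimes>\<^bsub>D\<^esub> a" using a b by (simp add: h m_comm)
    fix c assume "c \<in> carrier D"
    then obtain c' where c: "c' \<in> carrier B" "c = \<pi> c'" using D_cases by blast
    show "a \<oplus>\<^bsub>D\<^esub> b \<oplus>\<^bsub>D\<^esub> c = a \<oplus>\<^bsub>D\<^esub> (b \<oplus>\<^bsub>D\<^esub> c)" using a b c by (simp add: h M.a_assoc)
    show "a \<otimes>\<^bsub>D\<^esub> b \<otimes>\<^bsub>D\<^esub> c = a \<otimes>\<^bsub>D\<^esub> (b \<otimes>\<^bsub>D\<^esub> c)" using a b c by (simp add: h m_assoc)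
    show "(a \<oplus>\<^bsub>D\<^esub> b) \<otimes>\<^bsub>D\<^esub> c = a \<otimes>\<^bsub>D\<^esub> c \<oplus>\<^bsub>D\<^esub> b \<otimes>\<^bsub>D\<^esub> c" using a b c by (simp add: h l_distr)
  qed (simp_all add: h)
  note h' = h \<pi>_smult[symmetric]
  show ?thesis
  proof (rule algebraI[OF res.S.is_cring D])
    fix U d assume "U \<in> carrier quot" "d \<in> carrier D"
    obtain r where "r \<in> carrier R" "U = res r" using \<open>U \<in> _\<close> unfolding carrier_quot by blast
    moreover obtain b where "b \<in> carrier B" "d = \<pi> b" using D_cases[OF \<open>d \<in> _\<close>] .
    ultimately have rb: "r \<in> carrier R" "U = res r" "b \<in> carrier B" "d = \<pi> b" by auto
    show "U \<odot>\<^bsub>D\<^esub> d \<in> carrier D" using rb by (simp add: h')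
    { fix V assume "V \<in> carrier quot"
      then obtain s where s: "s \<in> carrier R" "V = res s" unfolding carrier_quot by blast
      have UV: "U \<oplus>\<^bsub>quot\<^esub> V = res (r \<oplus> s)" "U \<otimes>\<^bsub>quot\<^esub> V = res (r \<otimes> s)" using rb(1,2) s by simp_all
      show "(U \<oplus>\<^bsub>quot\<^esub> V) \<odot>\<^bsub>D\<^esub> d = U \<odot>\<^bsub>D\<^esub> d \<oplus>\<^bsub>D\<^esub> V \<odot>\<^bsub>D\<^esub> d"
        unfolding UV using rb s by (simp add: h' smult_l_distr del: res.hom_add)
      show "(U \<otimes>\<^bsub>quot\<^esub> V) \<odot>\<^bsub>D\<^esub> d = U \<odot>\<^bsub>D\<^esub> (V \<odot>\<^bsub>D\<^esub> d)"
        unfolding UV using rb s by (simp add: h' smult_assoc1 del: res.hom_mult) }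
    { fix d' assume "d' \<in> carrier D"
      then obtain b' where b': "b' \<in> carrier B" "d' = \<pi> b'" using D_cases by blast
      show "U \<odot>\<^bsub>D\<^esub> (d \<oplus>\<^bsub>D\<^esub> d') = U \<odot>\<^bsub>D\<^esub> d \<oplus>\<^bsub>D\<^esub> U \<odot>\<^bsub>D\<^esub> d'"
        using rb b' by (simp add: h' smult_r_distr)
      show "(U \<odot>\<^bsub>D\<^esub> d) \<otimes>\<^bsub>D\<^esub> d' = U \<odot>\<^bsub>D\<^esub> (d \<otimes>\<^bsub>D\<^esub> d')"
        using rb b' by (simp add: h' smult_assoc2) }
  next
    fix d assume "d \<in> carrier D"
    then obtain b where "b \<in> carrier B" "d = \<pi> b" using D_cases by blast
    then show "\<one>\<^bsub>quot\<^esub> \<odot>\<^bsub>D\<^esub> d = d" using \<pi>_smult[of \<one> b] by simp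
  qed
qed

sublocale D: algebra quot D
  by (rule algebra_quotient_algebra)

lemma \<pi>_a_inv: "b \<in> carrier B \<Longrightarrow> \<pi> (\<ominus>\<^bsub>B\<^esub> b) = \<ominus>\<^bsub>D\<^esub> \<pi> b"
  using \<pi>_add[of "\<ominus>\<^bsub>B\<^esub> b" b] by (intro D.M.minus_equality[symmetric]) (simp_all add: M.l_neg \<pi>_zero)

text \<open>Submodules of \<open>B/xB\<close> correspond to submodules of \<open>B\<close> that
  contain \<open>xB\<close>. Through this equivalence every notion over \<open>R/xR\<close>
  (regularity, properness, contraction) becomes the one over \<open>R\<close> with \<open>x\<close>
  added to the set.\<close>

lemma \<pi>_mem_mult_span_iff:
  assumes Z: "Z \<subseteq> carrier R" and u: "u \<in> carrier B"
  shows "\<pi> u \<in> mult_span quot D ((\<lambda>r. res r) ` Z) \<longleftrightarrow> u \<in> mult_span R B (insert x Z)"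
proof
  let ?Z = "(\<lambda>r. res r) ` Z"
  have kZ: "?Z \<subseteq> carrier quot" using Z by auto
  have xZ: "insert x Z \<subseteq> carrier R" using Z x_carrier by auto
  {
    let ?H = "{b \<in> carrier B. \<pi> b \<in> mult_span quot D ?Z}"
    have "submodule ?H R B"
    proof (rule submoduleI)
      show "?H \<subseteq> carrier B" by blast
      show "\<zero>\<^bsub>B\<^esub> \<in> ?H" using D.mult_span_zero[OF kZ] by (simp add: \<pi>_zero)
      show "\<ominus>\<^bsub>B\<^esub> a \<in> ?H" if "a \<in> ?H" for a
        using that D.mult_span_a_inv[OF kZ, of "\<pi> a"] by (simp add: \<pi>_a_inv)
      show "a \<oplus>\<^bsub>B\<^esub> b \<in> ?H" if "a \<in> ?H" "b \<in> ?H" for a b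
        using that D.mult_span_add[OF kZ, of "\<pi> a" "\<pi> b"] by (simp add: \<pi>_add)
      show "r \<odot>\<^bsub>B\<^esub> a \<in> ?H" if "r \<in> carrier R" "a \<in> ?H" for r a
        using that D.mult_span_smult[OF kZ, of "res r" "\<pi> a"] by (simp add: \<pi>_smult)
    qed
    moreover have "y \<odot>\<^bsub>B\<^esub> b \<in> ?H" if "y \<in> insert x Z" "b \<in> carrier B" for y b
    proof (cases "y = x")
      case True
      then have "\<pi> (y \<odot>\<^bsub>B\<^esub> b) = \<zero>\<^bsub>D\<^esub>" using \<pi>_ker that mult_span_mem[of x "{x}" b] x_carrier by simp
      then show ?thesis using D.mult_span_zero[OF kZ] that True x_carrier by simp
    next
      case False
      then have "y \<in> Z" using that by blast
      then show ?thesis using that Z D.mult_span_mem[of "res y" ?Z "\<pi> b"] by (auto simp: \<pi>_smult)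
    qed
    ultimately have "mult_span R B (insert x Z) \<subseteq> ?H" by (rule mult_span_least)
    then show "u \<in> mult_span R B (insert x Z) \<Longrightarrow> \<pi> u \<in> mult_span quot D ?Z" by blast
  }
  {
    note c = mult_span_in_carrier[OF xZ]
    let ?H = "\<pi> ` mult_span R B (insert x Z)"
    have "submodule ?H quot D"
    proof (rule D.submoduleI)
      show "?H \<subseteq> carrier D" using c by auto
      show "\<zero>\<^bsub>D\<^esub> \<in> ?H" using mult_span_zero[OF xZ] \<pi>_zero by (metis image_eqI)
      show "\<ominus>\<^bsub>D\<^esub> a \<in> ?H" if "a \<in> ?H" for a
        using that mult_span_a_inv[OF xZ] c by (auto simp: \<pi>_a_inv[symmetric])
      show "a \<oplus>\<^bsub>D\<^esub> b \<in> ?H" if "a \<in> ?H" "b \<in> ?H" for a b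
        using that mult_span_add[OF xZ] c by (auto simp: \<pi>_add[symmetric])
      show "r \<odot>\<^bsub>D\<^esub> a \<in> ?H" if "r \<in> carrier quot" "a \<in> ?H" for r a
        using that mult_span_smult[OF xZ] c by (auto simp: carrier_quot \<pi>_smult[symmetric])
    qed
    moreover have "y \<odot>\<^bsub>D\<^esub> d \<in> ?H" if yd: "y \<in> ?Z" "d \<in> carrier D" for y d
    proof -
      obtain z where z: "z \<in> Z" "y = res z" using yd by blast
      obtain b where b: "b \<in> carrier B" "d = \<pi> b" using D_cases[OF yd(2)] by blast
      have "y \<odot>\<^bsub>D\<^esub> d = \<pi> (z \<odot>\<^bsub>B\<^esub> b)" using z b Z by (auto simp: \<pi>_smult)
      then show ?thesis using mult_span_mem[of z "insert x Z" b] z b by simp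
    qed
    ultimately have "mult_span quot D ?Z \<subseteq> ?H" by (rule D.mult_span_least)
    moreover assume "\<pi> u \<in> mult_span quot D ?Z"
    ultimately obtain v where v: "v \<in> mult_span R B (insert x Z)" "\<pi> u = \<pi> v" by blast
    have vB: "v \<in> carrier B" using c v by blast
    have "\<pi> (u \<oplus>\<^bsub>B\<^esub> \<ominus>\<^bsub>B\<^esub> v) = \<zero>\<^bsub>D\<^esub>"
      using u vB v(2) by (simp add: \<pi>_add \<pi>_a_inv D.M.r_neg)
    then have "u \<oplus>\<^bsub>B\<^esub> \<ominus>\<^bsub>B\<^esub> v \<in> mult_span R B (insert x Z)"
      using \<pi>_ker[of "u \<oplus>\<^bsub>B\<^esub> \<ominus>\<^bsub>B\<^esub> v"] u vB mult_span_mono[OF xZ, of "{x}"] by auto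
    then have "(u \<oplus>\<^bsub>B\<^esub> \<ominus>\<^bsub>B\<^esub> v) \<oplus>\<^bsub>B\<^esub> v \<in> mult_span R B (insert x Z)" using mult_span_add[OF xZ] v(1) by blast
    moreover have "(u \<oplus>\<^bsub>B\<^esub> \<ominus>\<^bsub>B\<^esub> v) \<oplus>\<^bsub>B\<^esub> v = u" using u vB by (simp add: M.a_assoc M.l_neg)
    ultimately show "u \<in> mult_span R B (insert x Z)" by simp
  }
qed

lemma nzd_mod_quotient_iff:
  assumes "Z \<subseteq> carrier R" "z \<in> carrier R"
  shows "nzd_mod quot D ((\<lambda>r. res r) ` Z) (res z) \<longleftrightarrow> nzd_mod R B (insert x Z) z"
proof -
  have "res z \<odot>\<^bsub>D\<^esub> \<pi> b \<in> mult_span quot D ((\<lambda>r. res r) ` Z) \<longleftrightarrow> z \<odot>\<^bsub>B\<^esub> b \<in> mult_span R B (insert x Z)"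
    if "b \<in> carrier B" for b
    using \<pi>_mem_mult_span_iff[OF assms(1), of "z \<odot>\<^bsub>B\<^esub> b"] that assms(2) by (simp add: \<pi>_smult)
  then show ?thesis
    unfolding nzd_mod_def \<pi>_surj[symmetric] using \<pi>_mem_mult_span_iff[OF assms(1)] by auto
qed

lemma regular_sequence_quotient_iff:
  assumes "set zs \<subseteq> carrier R"
  shows "regular_sequence (map (\<lambda>r. res r) zs) D \<longleftrightarrow>
    (\<forall>i < length zs. nzd_mod R B (insert x (set (take i zs))) (zs ! i)) \<and>
    mult_span R B (insert x (set zs)) \<noteq> carrier B"
proof -
  have "set (map (\<lambda>r. res r) zs) \<subseteq> carrier quot" using assms by auto
  moreover have "nzd_mod quot D (set (take i (map (\<lambda>r. res r) zs))) (map (\<lambda>r. res r) zs ! i)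
      \<longleftrightarrow> nzd_mod R B (insert x (set (take i zs))) (zs ! i)" if "i < length zs" for i
  proof -
    have "set (take i zs) \<subseteq> carrier R" "zs ! i \<in> carrier R"
      using assms set_take_subset[of i zs] nth_mem[OF that] by auto
    then show ?thesis using nzd_mod_quotient_iff[of "set (take i zs)" "zs ! i"] that by (simp add: take_map)
  qed
  moreover have "mult_span quot D ((\<lambda>r. res r) ` set zs) = carrier D \<longleftrightarrow> mult_span R B (insert x (set zs)) = carrier B"
  proof -
    have 1: "mult_span quot D ((\<lambda>r. res r) ` set zs) = carrier D \<longleftrightarrow>
        (\<forall>d\<in>carrier D. d \<in> mult_span quot D ((\<lambda>r. res r) ` set zs))"
      using D.mult_span_in_carrier[of "(\<lambda>r. res r) ` set zs"] assms by auto
    have 2: "mult_span R B (insert x (set zs)) = carrier B \<longleftrightarrow> (\<forall>b\<in>carrier B. b \<in> mult_span R B (insert x (set zs)))"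
      using mult_span_in_carrier[of "insert x (set zs)"] assms x_carrier by auto
    have "(\<forall>d\<in>carrier D. d \<in> mult_span quot D ((\<lambda>r. res r) ` set zs)) \<longleftrightarrow>
        (\<forall>b\<in>carrier B. \<pi> b \<in> mult_span quot D ((\<lambda>r. res r) ` set zs))"
      unfolding \<pi>_surj[symmetric] by (simp only: ball_simps)
    then show ?thesis unfolding 1 2 using \<pi>_mem_mult_span_iff[OF assms] by simp
  qed
  ultimately show ?thesis by (simp add: D.regular_sequence_iff)
qed

lemma structure_map_res: "r \<in> carrier R \<Longrightarrow> structure_map D (res r) = \<pi> (structure_map B r)"
  unfolding structure_map_def by (simp add: \<pi>_smult \<pi>_one)

end

context principal_quotient
begin

text \<open>The case \<open>B = R\<close>: the dictionary for algebras then also serves the ideals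
  of \<open>R/xR\<close>.\<close>

lemma algebra_quotient_self: "algebra_quotient R x (self_algebra R) (self_algebra quot) (\<lambda>r. res r)"
proof -
  interpret S: algebra R "self_algebra R" by (rule algebra_self)
  show ?thesis
    by unfold_locales
      (simp_all add: carrier_quot res_zero_iff mult_span_self x_carrier cgenideal_eq_genideal[symmetric])
qed

lemma res_mem_Idl_iff:
  assumes "Z \<subseteq> carrier R" "u \<in> carrier R"
  shows "res u \<in> Idl\<^bsub>quot\<^esub> ((\<lambda>r. res r) ` Z) \<longleftrightarrow> u \<in> Idl (insert x Z)"
proof -
  interpret S: algebra_quotient R x "self_algebra R" "self_algebra quot" "\<lambda>r. res r"
    by (rule algebra_quotient_self)
  have "(\<lambda>r. res r) ` Z \<subseteq> carrier quot" using assms by auto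
  then show ?thesis
    using S.\<pi>_mem_mult_span_iff[OF assms(1), of u] assms x_carrier
    by (simp add: mult_span_self res.S.mult_span_self)
qed

end

lemma (in algebra_quotient) contracts_quotient_iff:
  assumes "Z \<subseteq> carrier R"
  shows "contracts quot D ((\<lambda>r. res r) ` Z) \<longleftrightarrow> contracts R B (insert x Z)"
proof -
  have "structure_map B u \<in> carrier B" if "u \<in> carrier R" for u using that by (simp add: structure_map_def)
  then show ?thesis
    unfolding contracts_def carrier_quot
    using structure_map_res \<pi>_mem_mult_span_iff[OF assms] res_mem_Idl_iff[OF assms] by auto
qed

text \<open>It matches the ideal used by \<open>quotient_algebra\<close> with the description of the
  kernel of \<pi> in \<open>algebra_quotient\<close>.\<close>

lemma (in algebra) extended_ideal_principal:
  assumes x: "x \<in> carrier R"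
  shows "extended_ideal M (PIdl\<^bsub>R\<^esub> x) = mult_span R M {x}"
proof
  have x': "{x} \<subseteq> carrier R" using x by simp
  have elems: "\<exists>b\<in>carrier M. a = x \<odot>\<^bsub>M\<^esub> b" if "a \<in> mult_span R M {x}" for a
    using mult_span_insertE[of a x "{}"] that x mult_span_empty by (metis M.r_zero empty_subsetI singletonD smult_closed)
  have ideal: "ideal (mult_span R M {x}) M"
  proof (rule idealI[OF ring_axioms])
    show "subgroup (mult_span R M {x}) (add_monoid M)" using submodule.axioms(1)[OF submodule_mult_span[OF x']] .
    fix a b assume "a \<in> mult_span R M {x}" and b: "b \<in> carrier M"
    then obtain c where c: "c \<in> carrier M" "a = x \<odot>\<^bsub>M\<^esub> c" using elems by blast
    have "a \<otimes>\<^bsub>M\<^esub> b = x \<odot>\<^bsub>M\<^esub> (c \<otimes>\<^bsub>M\<^esub> b)" using c b x by (simp add: smult_assoc2)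
    then show "a \<otimes>\<^bsub>M\<^esub> b \<in> mult_span R M {x}" using mult_span_mem[of x "{x}"] c b by simp
    then show "b \<otimes>\<^bsub>M\<^esub> a \<in> mult_span R M {x}" using c b x by (simp add: m_comm)
  qed
  have "structure_map M r \<in> mult_span R M {x}" if r: "r \<in> PIdl\<^bsub>R\<^esub> x" for r
  proof -
    obtain s where s: "s \<in> carrier R" "r = s \<otimes>\<^bsub>R\<^esub> x" using r unfolding cgenideal_def by auto
    have "structure_map M r = x \<odot>\<^bsub>M\<^esub> (s \<odot>\<^bsub>M\<^esub> \<one>\<^bsub>M\<^esub>)"
      unfolding structure_map_def s(2) using s(1) x by (simp add: smult_assoc1[symmetric] R.m_comm)
    then show ?thesis using mult_span_mem[of x "{x}"] s(1) by simp
  qed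
  then show "extended_ideal M (PIdl\<^bsub>R\<^esub> x) \<subseteq> mult_span R M {x}"
    unfolding extended_ideal_def by (intro genideal_minimal ideal) auto
  have PI: "PIdl\<^bsub>R\<^esub> x \<subseteq> carrier R" using x by (auto simp: cgenideal_def)
  have sub: "structure_map M ` (PIdl\<^bsub>R\<^esub> x) \<subseteq> carrier M" using PI by (auto simp: structure_map_def)
  show "mult_span R M {x} \<subseteq> extended_ideal M (PIdl\<^bsub>R\<^esub> x)"
  proof
    fix a assume "a \<in> mult_span R M {x}"
    then obtain b where b: "b \<in> carrier M" "a = x \<odot>\<^bsub>M\<^esub> b" using elems by blast
    have "a = structure_map M x \<otimes>\<^bsub>M\<^esub> b" unfolding b(2) structure_map_def using b x by (simp add: smult_assoc2)
    moreover have "structure_map M x \<in> extended_ideal M (PIdl\<^bsub>R\<^esub> x)"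
      unfolding extended_ideal_def using genideal_self[OF sub] R.cgenideal_self[OF x] by blast
    ultimately show "a \<in> extended_ideal M (PIdl\<^bsub>R\<^esub> x)"
      unfolding extended_ideal_def using ideal.I_r_closed[OF genideal_ideal[OF sub]] b(1) by simp
  qed
qed

lemma algebra_quotient_quotient_algebra:
  fixes B :: "('a, 'b) module"
  assumes "algebra R B" "x \<in> carrier R"
  shows "algebra_quotient R x B (quotient_algebra (PIdl\<^bsub>R\<^esub> x) B) (\<lambda>b. extended_ideal B (PIdl\<^bsub>R\<^esub> x) +>\<^bsub>B\<^esub> b)"
proof -
  interpret B: algebra R B by fact
  define J where "J = extended_ideal B (PIdl\<^bsub>R\<^esub> x)"
  have "structure_map B ` (PIdl\<^bsub>R\<^esub> x) \<subseteq> carrier B"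
    using assms(2) by (auto simp: structure_map_def cgenideal_def)
  then have J: "ideal J B" unfolding J_def extended_ideal_def by (rule B.genideal_ideal)
  interpret J: ideal J B by fact
  interpret I: ideal "PIdl\<^bsub>R\<^esub> x" R using B.R.cgenideal_ideal[OF assms(2)] .
  interpret h: ring_hom_ring B "B Quot J" "\<lambda>b. J +>\<^bsub>B\<^esub> b" using J.rcos_ring_hom_ring .
  let ?C = "quotient_algebra (PIdl\<^bsub>R\<^esub> x) B"
  have C: "carrier ?C = carrier (B Quot J)" "(\<otimes>\<^bsub>?C\<^esub>) = (\<otimes>\<^bsub>B Quot J\<^esub>)" "\<one>\<^bsub>?C\<^esub> = \<one>\<^bsub>B Quot J\<^esub>"
    "\<zero>\<^bsub>?C\<^esub> = \<zero>\<^bsub>B Quot J\<^esub>" "(\<oplus>\<^bsub>?C\<^esub>) = (\<oplus>\<^bsub>B Quot J\<^esub>)"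
    "(\<odot>\<^bsub>?C\<^esub>) = (\<lambda>U V. \<Union>u\<in>U. \<Union>v\<in>V. J +>\<^bsub>B\<^esub> (u \<odot>\<^bsub>B\<^esub> v))"
    unfolding quotient_algebra_def J_def by (simp_all add: Let_def)
  have IJ: "i \<odot>\<^bsub>B\<^esub> b \<in> J" if "i \<in> PIdl\<^bsub>R\<^esub> x" "b \<in> carrier B" for i b
  proof -
    have iR: "i \<in> carrier R" using that I.Icarr by blast
    have "structure_map B i \<in> J"
      unfolding J_def extended_ideal_def using B.genideal_self \<open>structure_map B ` (PIdl\<^bsub>R\<^esub> x) \<subseteq> carrier B\<close> that(1) by blast
    then have "structure_map B i \<otimes>\<^bsub>B\<^esub> b \<in> J" using J.I_r_closed that(2) by blast
    moreover have "structure_map B i \<otimes>\<^bsub>B\<^esub> b = i \<odot>\<^bsub>B\<^esub> b"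
      unfolding structure_map_def using iR that(2) by (simp add: B.smult_assoc2)
    ultimately show ?thesis by simp
  qed
  have rJ: "r \<odot>\<^bsub>B\<^esub> j \<in> J" if "r \<in> carrier R" "j \<in> J" for r j
  proof -
    have "(r \<odot>\<^bsub>B\<^esub> \<one>\<^bsub>B\<^esub>) \<otimes>\<^bsub>B\<^esub> j \<in> J" using that J.I_l_closed by simp
    then show ?thesis using that J.Icarr by (simp add: B.smult_assoc2)
  qed
  \<comment> \<open>The union defining the scalar multiplication is a single coset: changing the
    scalar by an element of \<open>(x)\<close> or the vector by an element of \<open>J\<close>
    changes the product by an element of \<open>J\<close>.\<close>
  have smult: "(PIdl\<^bsub>R\<^esub> x +>\<^bsub>R\<^esub> r) \<odot>\<^bsub>?C\<^esub> (J +>\<^bsub>B\<^esub> b) = J +>\<^bsub>B\<^esub> (r \<odot>\<^bsub>B\<^esub> b)"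
    if rb: "r \<in> carrier R" "b \<in> carrier B" for r b
  proof -
    have "J +>\<^bsub>B\<^esub> (u \<odot>\<^bsub>B\<^esub> v) = J +>\<^bsub>B\<^esub> (r \<odot>\<^bsub>B\<^esub> b)"
      if uv: "u \<in> PIdl\<^bsub>R\<^esub> x +>\<^bsub>R\<^esub> r" "v \<in> J +>\<^bsub>B\<^esub> b" for u v
    proof -
      obtain i where i: "i \<in> PIdl\<^bsub>R\<^esub> x" "u = i \<oplus>\<^bsub>R\<^esub> r" using uv(1) by (auto simp: a_r_coset_def')
      obtain j where j: "j \<in> J" "v = j \<oplus>\<^bsub>B\<^esub> b" using uv(2) by (auto simp: a_r_coset_def')
      have c: "i \<in> carrier R" "j \<in> carrier B" "u \<in> carrier R" "v \<in> carrier B"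
        using i j rb I.Icarr J.Icarr by auto
      have "u \<odot>\<^bsub>B\<^esub> v = (i \<odot>\<^bsub>B\<^esub> v \<oplus>\<^bsub>B\<^esub> r \<odot>\<^bsub>B\<^esub> j) \<oplus>\<^bsub>B\<^esub> r \<odot>\<^bsub>B\<^esub> b"
        unfolding i(2) using c rb by (simp add: B.smult_l_distr B.M.a_ac j(2) B.smult_r_distr)
      moreover have "i \<odot>\<^bsub>B\<^esub> v \<oplus>\<^bsub>B\<^esub> r \<odot>\<^bsub>B\<^esub> j \<in> J" using IJ[OF i(1) c(4)] rJ[OF rb(1) j(1)] by simp
      ultimately have "u \<odot>\<^bsub>B\<^esub> v \<ominus>\<^bsub>B\<^esub> r \<odot>\<^bsub>B\<^esub> b \<in> J"
        using rb J.Icarr by (simp add: B.M.minus_eq B.M.a_assoc B.M.r_neg)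
      then show ?thesis using B.quotient_eq_iff_same_a_r_cos[OF J, of "u \<odot>\<^bsub>B\<^esub> v" "r \<odot>\<^bsub>B\<^esub> b"] c rb by simp
    qed
    moreover have "r \<in> PIdl\<^bsub>R\<^esub> x +>\<^bsub>R\<^esub> r" "b \<in> J +>\<^bsub>B\<^esub> b" using I.a_rcos_self J.a_rcos_self rb by auto
    ultimately show ?thesis unfolding C(6) by blast
  qed
  show ?thesis
    unfolding J_def[symmetric]
  proof unfold_locales
    show "x \<in> carrier R" by fact
    show "(\<lambda>b. J +>\<^bsub>B\<^esub> b) ` carrier B = carrier ?C"
      unfolding C(1) by (auto simp: FactRing_def A_RCOSETS_def' a_r_coset_def')
    show "J +>\<^bsub>B\<^esub> \<one>\<^bsub>B\<^esub> = \<one>\<^bsub>?C\<^esub>" "J +>\<^bsub>B\<^esub> \<zero>\<^bsub>B\<^esub> = \<zero>\<^bsub>?C\<^esub>" unfolding C by simp_all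
    fix b assume b: "b \<in> carrier B"
    show "(J +>\<^bsub>B\<^esub> b = \<zero>\<^bsub>?C\<^esub>) = (b \<in> mult_span R B {x})"
      unfolding C(4) zero_FactRing B.extended_ideal_principal[OF assms(2), symmetric] J_def[symmetric]
      using J.rcos_const_imp_mem[OF b] B.a_rcos_zero[OF J, of b] by (rule iffI)
    fix r assume "r \<in> carrier R"
    then show "J +>\<^bsub>B\<^esub> (r \<odot>\<^bsub>B\<^esub> b) = (PIdl\<^bsub>R\<^esub> x +>\<^bsub>R\<^esub> r) \<odot>\<^bsub>?C\<^esub> (J +>\<^bsub>B\<^esub> b)" using smult b by simp
  qed (simp_all add: C)
qed

text \<open>\<^const>\<open>BCM_rational\<close> quantifies over algebras with carrier in a fixed type, so the copy of \<open>B/xB\<close>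
  to which it is applied has to live in the type of \<open>B\<close>; each coset is replaced by a representative.\<close>

lemma (in algebra_quotient) algebra_quotient_representatives:
  defines "h \<equiv> inv_into (carrier B) \<pi>"
  defines "D' \<equiv> \<lparr>carrier = h ` carrier D, monoid.mult = (\<lambda>a b. h (\<pi> a \<otimes>\<^bsub>D\<^esub> \<pi> b)), monoid.one = h \<one>\<^bsub>D\<^esub>,
     ring.zero = h \<zero>\<^bsub>D\<^esub>, ring.add = (\<lambda>a b. h (\<pi> a \<oplus>\<^bsub>D\<^esub> \<pi> b)), smult = (\<lambda>r a. h (r \<odot>\<^bsub>D\<^esub> \<pi> a))\<rparr>"
  shows "algebra_quotient R x B D' (\<lambda>b. h (\<pi> b))"
proof -
  have \<pi>h: "\<pi> (h d) = d" if "d \<in> carrier D" for d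
    unfolding h_def using f_inv_into_f[of d \<pi> "carrier B"] that \<pi>_surj by simp
  have "(h (\<pi> b) = h \<zero>\<^bsub>D\<^esub>) = (\<pi> b = \<zero>\<^bsub>D\<^esub>)" if "b \<in> carrier B" for b
    using \<pi>h[of "\<pi> b"] \<pi>h[of "\<zero>\<^bsub>D\<^esub>"] that by (metis D.M.zero_closed \<pi>_closed)
  then have ker: "(h (\<pi> b) = h \<zero>\<^bsub>D\<^esub>) = (b \<in> mult_span R B {x})" if "b \<in> carrier B" for b
    using \<pi>_ker that by simp
  show ?thesis
  proof unfold_locales
    show "(\<lambda>b. h (\<pi> b)) ` carrier B = carrier D'" unfolding D'_def \<pi>_surj[symmetric] by (simp add: image_image)
    fix b assume b: "b \<in> carrier B"
    then show "(h (\<pi> b) = \<zero>\<^bsub>D'\<^esub>) = (b \<in> mult_span R B {x})" using ker by (simp add: D'_def)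
  qed (simp_all add: D'_def \<pi>h \<pi>_add \<pi>_mult \<pi>_one \<pi>_zero \<pi>_smult)
qed

section \<open>Deformation of BCM-rationality\<close>

locale local_quotient = noetherian_local_ring R + principal_quotient R x for R (structure) and x +
  assumes x_in_max_ideal: "x \<in> max_ideal R"
begin

lemma res_ideal_vimage: "ideal J quot \<Longrightarrow> ideal {r \<in> carrier R. res r \<in> J} R"
  using ring_hom_ring.ideal_vimage[OF ideal.rcos_ring_hom_ring[OF cgenideal_ideal[OF x_carrier]]] .

lemma res_pow: "r \<in> carrier R \<Longrightarrow> res (r [^] (n::nat)) = res r [^]\<^bsub>quot\<^esub> n"
  by (induction n) simp_all

lemma PIdl_subset_max_ideal: "PIdl x \<subseteq> max_ideal R"
  using cgenideal_minimal[OF max_ideal.is_ideal x_in_max_ideal] .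

lemma res_mem_image_max_ideal_iff:
  assumes "r \<in> carrier R"
  shows "res r \<in> (\<lambda>r. res r) ` max_ideal R \<longleftrightarrow> r \<in> max_ideal R"
proof
  assume "res r \<in> (\<lambda>r. res r) ` max_ideal R"
  then obtain s where s: "s \<in> max_ideal R" "res r = res s" by auto
  have sR: "s \<in> carrier R" using s(1) max_ideal.Icarr by blast
  have "r \<ominus> s \<in> max_ideal R" using s(2) res_eq_iff[OF assms sR] PIdl_subset_max_ideal by auto
  then have "(r \<ominus> s) \<oplus> s \<in> max_ideal R" using s(1) max_ideal.a_closed by blast
  moreover have "(r \<ominus> s) \<oplus> s = r" using assms sR by algebra
  ultimately show "r \<in> max_ideal R" by simp
qed auto

lemma proper_quot_ideal_subset:
  assumes K: "ideal K quot" "\<one>\<^bsub>quot\<^esub> \<notin> K"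
  shows "K \<subseteq> (\<lambda>r. res r) ` max_ideal R"
proof
  interpret K: ideal K quot by fact
  fix c assume c: "c \<in> K"
  then obtain r where r: "r \<in> carrier R" "c = res r" using K.Icarr carrier_quot by blast
  have "r \<in> max_ideal R"
  proof (rule ccontr)
    assume "r \<notin> max_ideal R"
    then obtain s where s: "s \<in> carrier R" "s \<otimes> r = \<one>" using unit_if_notin_max_ideal r(1) by blast
    have "res s \<otimes>\<^bsub>quot\<^esub> c = \<one>\<^bsub>quot\<^esub>"
      unfolding r(2) using s r(1) res.hom_mult[of s r] res.hom_one by simp
    moreover have "res s \<otimes>\<^bsub>quot\<^esub> c \<in> K" using K.I_l_closed[OF c] s(1) by simp
    ultimately show False using K(2) by simp
  qed
  then show "c \<in> (\<lambda>r. res r) ` max_ideal R" using r(2) by blast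
qed

lemma maximalideal_quot: "maximalideal N quot \<longleftrightarrow> N = (\<lambda>r. res r) ` max_ideal R"
proof -
  let ?N = "(\<lambda>r. res r) ` max_ideal R"
  have id: "ideal ?N quot"
    using ring_ideal_imp_quot_ideal[OF cgenideal_ideal[OF x_carrier] max_ideal.is_ideal] .
  have one: "\<one>\<^bsub>quot\<^esub> \<notin> ?N"
    using res_mem_image_max_ideal_iff[of \<one>] max_ideal.one_notin res.hom_one by simp
  have max: "maximalideal ?N quot"
  proof (rule maximalidealI[OF id])
    show "carrier quot \<noteq> ?N" using one res.S.one_closed by metis
    fix J assume J: "ideal J quot" "?N \<subseteq> J" "J \<subseteq> carrier quot"
    show "J = ?N \<or> J = carrier quot"
    proof (cases "\<one>\<^bsub>quot\<^esub> \<in> J")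
      case True
      then show ?thesis using ideal.one_imp_carrier[OF J(1)] by blast
    next
      case False
      then show ?thesis using proper_quot_ideal_subset[OF J(1)] J(2) by blast
    qed
  qed
  have "N = ?N" if N: "maximalideal N quot"
  proof -
    interpret N: maximalideal N quot by fact
    have "\<one>\<^bsub>quot\<^esub> \<notin> N" using N.I_notcarr N.one_imp_carrier by metis
    then have "N \<subseteq> ?N" using proper_quot_ideal_subset[OF N.is_ideal] by blast
    then have "?N = N \<or> ?N = carrier quot"
      using N.I_maximal[OF id] ideal.Icarr[OF id] by blast
    then show ?thesis using one res.S.one_closed by metis
  qed
  then show ?thesis using max by blast
qed

lemma noetherian_quot: "noetherian_ring quot"
proof (rule res.S.noetherian_ringI)
  fix J assume J: "ideal J quot"
  let ?V = "{r \<in> carrier R. res r \<in> J}"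
  have V: "ideal ?V R" using res_ideal_vimage[OF J] .
  obtain F where F: "F \<subseteq> carrier R" "finite F" "?V = Idl F" using finetely_gen[OF V] by blast
  let ?F = "(\<lambda>r. res r) ` F"
  have Fc: "?F \<subseteq> carrier quot" using F(1) by auto
  have "F \<subseteq> ?V" using genideal_self[OF F(1)] F(3) by simp
  then have "Idl\<^bsub>quot\<^esub> ?F \<subseteq> J" by (intro res.S.genideal_minimal[OF J]) auto
  moreover have "J \<subseteq> Idl\<^bsub>quot\<^esub> ?F"
  proof
    fix c assume c: "c \<in> J"
    then obtain r where r: "r \<in> carrier R" "c = res r"
      using ideal.Icarr[OF J] carrier_quot by blast
    have "Idl F \<subseteq> {r \<in> carrier R. res r \<in> Idl\<^bsub>quot\<^esub> ?F}"
      using res_ideal_vimage[OF res.S.genideal_ideal[OF Fc]] res.S.genideal_self[OF Fc] F(1)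
      by (intro genideal_minimal) auto
    moreover have "r \<in> Idl F" using r c F(3) by auto
    ultimately show "c \<in> Idl\<^bsub>quot\<^esub> ?F" using r(2) by auto
  qed
  ultimately show "\<exists>A\<subseteq>carrier quot. finite A \<and> J = Idl\<^bsub>quot\<^esub> A"
    using Fc F(2) by (intro exI[of _ ?F]) auto
qed

lemma noetherian_local_ring_quot: "noetherian_local_ring quot"
proof -
  have "\<exists>!N. maximalideal N quot" using maximalideal_quot by simp
  then show ?thesis
    using noetherian_quot res.S.is_cring
    unfolding noetherian_local_ring_def noetherian_cring_def noetherian_local_ring_axioms_def by blast
qed

sublocale A: noetherian_local_ring quot
  by (rule noetherian_local_ring_quot)

lemma max_ideal_quot: "max_ideal quot = (\<lambda>r. res r) ` max_ideal R"
  using A.maximalideal_max_ideal maximalideal_quot by blast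

section \<open>Lifting systems of parameters from R/xR\<close>

lemma lift_max_ideal_list:
  assumes "set ws \<subseteq> max_ideal quot"
  obtains zs where "ws = map (\<lambda>r. res r) zs" "set zs \<subseteq> max_ideal R"
proof -
  have "ws \<in> lists ((\<lambda>r. res r) ` max_ideal R)" using assms max_ideal_quot by (simp add: in_lists_conv_set subset_iff)
  then have "ws \<in> map (\<lambda>r. res r) ` lists (max_ideal R)" by (simp add: lists_image)
  then show ?thesis using that by (auto simp: in_lists_conv_set)
qed

lemma min_prime_over_lift:
  assumes "Z \<subseteq> max_ideal R" "min_prime_over quot ((\<lambda>r. res r) ` Z) (max_ideal quot)"
  shows "min_prime_over R (insert x Z) (max_ideal R)"
  unfolding min_prime_over_max_ideal_iff
proof (intro conjI allI impI)
  have Z: "Z \<subseteq> carrier R" using assms(1) max_ideal.a_subset by blast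
  show "insert x Z \<subseteq> max_ideal R" using assms(1) x_in_max_ideal by blast
  fix P assume P: "primeideal P R \<and> insert x Z \<subseteq> P"
  then interpret P: primeideal P R by blast
  have IP: "Idl (insert x Z) \<subseteq> P" using genideal_minimal[OF P.is_ideal] P by blast
  have "max_ideal R \<subseteq> P"
  proof
    fix r assume r: "r \<in> max_ideal R"
    have rR: "r \<in> carrier R" using r max_ideal.Icarr by blast
    have "res r \<in> max_ideal quot" using r max_ideal_quot by blast
    then obtain n where "res r [^]\<^bsub>quot\<^esub> (n::nat) \<in> Idl\<^bsub>quot\<^esub> ((\<lambda>r. res r) ` Z)"
      using A.mem_max_ideal_pow[OF assms(2)] by blast
    then have "res (r [^] n) \<in> Idl\<^bsub>quot\<^esub> ((\<lambda>r. res r) ` Z)" using rR by (simp add: res_pow)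
    then have "r [^] n \<in> P" using res_mem_Idl_iff[OF Z, of "r [^] n"] rR IP by auto
    then show "r \<in> P" using P.pow_mem_imp_mem rR by blast
  qed
  then show "P = max_ideal R" using prime_subset_max_ideal[OF P.primeideal] by blast
qed

text \<open>The preimages of the chain all contain \<open>x\<close>. As \<open>x\<close> is a
  nonzerodivisor, \<open>s x^n\<close> is nonzero for every \<open>s\<close> outside the smallest
  preimage, so there is a prime below it that misses \<open>x\<close>. This extra prime is why the
  bound is \<open>card C\<close> and not \<open>card C - 1\<close>.\<close>

lemma quot_prime_chain_lift:
  assumes nzd: "nonzerodivisor R x"
    and C: "finite C" "C \<noteq> {}" "subset.chain {P. primeideal P quot} C"
  shows "enat (card C) \<le> krull_dim R"
proof -
  define V where "V P = {r \<in> carrier R. res r \<in> P}" for P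
  have prime: "primeideal P quot" if "P \<in> C" for P using C(3) that unfolding subset.chain_def by blast
  have Vp: "primeideal (V P) R \<and> x \<in> V P" if "P \<in> C" for P
  proof -
    interpret P: primeideal P quot using prime that by blast
    have "primeideal (V P) R"
    proof (rule primeidealI[OF _ is_cring])
      show "ideal (V P) R" unfolding V_def using res_ideal_vimage[OF P.is_ideal] .
      have "\<one> \<notin> V P" unfolding V_def using P.one_notin res.hom_one by simp
      then show "carrier R \<noteq> V P" by auto
      fix a b assume "a \<in> carrier R" "b \<in> carrier R" "a \<otimes> b \<in> V P"
      then show "a \<in> V P \<or> b \<in> V P" using P.I_prime[of "res a" "res b"] unfolding V_def by simp
    qed
    moreover have "res x = \<zero>\<^bsub>quot\<^esub>" using res_zero_iff[OF x_carrier] cgenideal_self[OF x_carrier] by simp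
    ultimately show ?thesis using P.zero_closed x_carrier unfolding V_def by simp
  qed
  have img: "(\<lambda>r. res r) ` V P = P" if "P \<in> C" for P
  proof -
    interpret P: primeideal P quot using prime that by blast
    show ?thesis
    proof
      show "P \<subseteq> (\<lambda>r. res r) ` V P"
      proof
        fix c assume c: "c \<in> P"
        then have "c \<in> (\<lambda>r. res r) ` carrier R" using P.Icarr carrier_quot by simp
        then show "c \<in> (\<lambda>r. res r) ` V P" using c unfolding V_def by auto
      qed
    qed (auto simp: V_def)
  qed
  have inj: "inj_on V C" by (rule inj_on_inverseI[where g = "\<lambda>N. (\<lambda>r. res r) ` N"]) (rule img)
  obtain P0 where P0: "P0 \<in> C" "\<And>P. P \<in> C \<Longrightarrow> P \<subseteq> P0 \<Longrightarrow> P0 = P"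
    using finite_has_minimal[OF C(1,2)] by blast
  have P0min: "V P0 \<subseteq> V P" if "P \<in> C" for P
  proof -
    have "P \<subseteq> P0 \<or> P0 \<subseteq> P" using C(3) that P0(1) unfolding subset.chain_def by blast
    then show ?thesis using P0(2)[OF that] unfolding V_def by auto
  qed
  interpret P0: primeideal "V P0" R using Vp[OF P0(1)] by blast
  have x0: "r = \<zero>" if "r \<in> carrier R" "r \<otimes> x = \<zero>" for r
    using nzd that m_comm[OF that(1) x_carrier] unfolding nonzerodivisor_def by simp
  have "s \<otimes> x [^] (n::nat) \<notin> {\<zero>}" if s: "s \<in> carrier R - V P0" for s n
  proof (induction n)
    case 0
    then show ?case using s P0.zero_closed by auto
  next
    case (Suc n)
    have "s \<otimes> x [^] Suc n = (s \<otimes> x [^] n) \<otimes> x" using s x_carrier by (simp add: m_assoc)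
    then show ?case using x0[of "s \<otimes> x [^] n"] s x_carrier Suc by auto
  qed
  then obtain Q where Q: "primeideal Q R" "Q \<subseteq> V P0" "x \<notin> Q"
    using prime_below_avoiding[OF zeroideal P0.primeideal x_carrier] by metis
  let ?C = "insert Q (V ` C)"
  have "Q \<notin> V ` C" using Q(3) Vp by blast
  then have "card ?C = Suc (card C)" using C(1) card_image[OF inj] by simp
  moreover have "subset.chain {P. primeideal P R} ?C"
  proof -
    have QV: "Q \<subseteq> V P" if "P \<in> C" for P using Q(2) P0min[OF that] by blast
    have VV: "V P \<subseteq> V P' \<or> V P' \<subseteq> V P" if "P \<in> C" "P' \<in> C" for P P'
    proof -
      have "P \<subseteq> P' \<or> P' \<subseteq> P" using C(3) that unfolding subset.chain_def by blast
      then show ?thesis unfolding V_def by blast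
    qed
    have "N \<subseteq> N' \<or> N' \<subseteq> N" if "N \<in> ?C" "N' \<in> ?C" for N N'
      using that by (elim insertE imageE) (simp_all add: QV VV)
    then have "\<forall>N\<in>?C. \<forall>N'\<in>?C. N \<subseteq> N' \<or> N' \<subseteq> N" by (intro ballI)
    moreover have "?C \<subseteq> {P. primeideal P R}" using Q(1) Vp by blast
    ultimately show ?thesis unfolding subset_chain_def by (rule conjI[rotated])
  qed
  ultimately show ?thesis using krull_dim_ge[of ?C R] C(1) by simp
qed

lemma krull_dim_quot_less:
  assumes "nonzerodivisor R x" "krull_dim R = enat d"
  obtains e where "krull_dim quot = enat e" "e < d"
proof -
  have b: "0 < card C \<and> card C \<le> d" if "finite C" "C \<noteq> {}" "subset.chain {P. primeideal P quot} C" for C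
    using quot_prime_chain_lift[OF assms(1) that] assms(2) that by (auto simp: card_gt_0_iff)
  \<comment> \<open>The chain consisting of the maximal ideal excludes \<open>d = 0\<close>, for
    which \<open>d - 1\<close> would be truncated.\<close>
  have "0 < d" using b[of "{max_ideal quot}"] A.max_ideal.primeideal by (auto simp: subset.chain_def)
  moreover have "krull_dim quot \<le> enat (d - 1)"
    unfolding krull_dim_def
  proof (rule SUP_least)
    fix C assume "C \<in> {C. finite C \<and> C \<noteq> {} \<and> subset.chain {P. primeideal P quot} C}"
    then have "card C \<le> d" using b[of C] by blast
    then show "enat (card C - 1) \<le> enat (d - 1)" by simp
  qed
  ultimately show ?thesis using that by (cases "krull_dim quot") auto
qed

text \<open>The length is pinned from both sides: \<open>d <= e + 1\<close>, since the maximal ideal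
  is minimal over \<open>x\<close> and the \<open>e\<close> lifted elements, and
  \<open>e < d\<close>, since \<open>x\<close> is a nonzerodivisor.\<close>

lemma system_of_parameters_lift:
  assumes "nonzerodivisor R x" "krull_dim R = enat d"
    and "set zs \<subseteq> max_ideal R" "system_of_parameters quot (map (\<lambda>r. res r) zs)"
  shows "system_of_parameters R (x # zs)"
proof -
  obtain e where e: "krull_dim quot = enat e" "e < d" using krull_dim_quot_less[OF assms(1,2)] .
  have sop: "length zs = e" "min_prime_over quot ((\<lambda>r. res r) ` set zs) (max_ideal quot)"
    using assms(4) e unfolding A.system_of_parameters_iff by auto
  have m: "min_prime_over R (set (x # zs)) (max_ideal R)" using min_prime_over_lift[OF assms(3) sop(2)] by simp
  have "d \<le> card (set (x # zs))" using krull_dim_le[OF _ m] assms(2) by simp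
  also have "\<dots> \<le> Suc e" using card_length[of "x # zs"] sop(1) by simp
  finally show ?thesis using m e sop assms(2) unfolding system_of_parameters_iff by simp
qed

end

section \<open>Cohen-Macaulay rings and the test for injectivity\<close>

context noetherian_local_ring
begin

lemma regular_sequence_length_le:
  assumes "set xs \<subseteq> max_ideal R" "regular_sequence xs (self_algebra R)"
  shows "enat (length xs) \<le> krull_dim R"
proof -
  have "set xs \<subseteq> carrier R" using assms(1) max_ideal.a_subset by blast
  then have "nzd_mod R (self_algebra R) (set (take i xs)) (xs ! i)" if "i < length xs" for i
    using assms(2) module.regular_sequence_iff[OF module_self] that by blast
  then obtain C where "finite C" "subset.chain {Q. primeideal Q R} C" "card C = Suc (length xs)"
    using regular_list_prime_chain[OF assms(1) max_ideal.primeideal] by metis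
  then show ?thesis using krull_dim_ge[of C R] by fastforce
qed

text \<open>If a prime \<open>P\<close> over \<open>xs\<close> were not maximal, the chain of primes
  below \<open>P\<close> supplied by the regular sequence could be extended by the maximal ideal and
  would be too long.\<close>

lemma regular_sequence_system_of_parameters:
  assumes "set xs \<subseteq> max_ideal R" "enat (length xs) = krull_dim R"
    and "\<And>i. i < length xs \<Longrightarrow> nzd_mod R (self_algebra R) (set (take i xs)) (xs ! i)"
  shows "system_of_parameters R xs"
proof -
  have "P = max_ideal R" if P: "primeideal P R" "set xs \<subseteq> P" for P
  proof (rule ccontr)
    assume ne: "P \<noteq> max_ideal R"
    obtain C where C: "finite C" "subset.chain {Q. primeideal Q R} C" "card C = Suc (length xs)" "\<forall>Q\<in>C. Q \<subseteq> P"
      using regular_list_prime_chain[OF P(2,1) assms(3)] by metis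
    have Pm: "P \<subseteq> max_ideal R" using prime_subset_max_ideal[OF P(1)] .
    have "max_ideal R \<notin> C" using C(4) Pm ne by blast
    moreover have "subset.chain {Q. primeideal Q R} (insert (max_ideal R) C)"
      using C(2,4) Pm max_ideal.primeideal unfolding subset.chain_def by blast
    ultimately have "enat (Suc (length xs)) \<le> krull_dim R"
      using krull_dim_ge[of "insert (max_ideal R) C" R] C(1,3) by simp
    then show False using assms(2) by (metis Suc_n_not_le_n enat_ord_simps(1))
  qed
  then show ?thesis
    using assms(1,2) unfolding system_of_parameters_iff min_prime_over_max_ideal_iff by blast
qed

lemma Cohen_Macaulay_regular_list:
  assumes "Cohen_Macaulay R" "krull_dim R = enat e"
  obtains xs where "set xs \<subseteq> max_ideal R" "length xs = e"
    "\<And>i. i < length xs \<Longrightarrow> nzd_mod R (self_algebra R) (set (take i xs)) (xs ! i)"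
proof (cases e)
  case 0
  then show ?thesis using that[of "[]"] by simp
next
  case (Suc k)
  have "depth R = enat e" using assms unfolding Cohen_Macaulay_def by simp
  \<comment> \<open>The depth is a supremum; since it exceeds \<open>k = e - 1\<close>, some regular
    sequence has at least \<open>e\<close> elements, and \<open>regular_sequence_length_le\<close>
    rules out more.\<close>
  then have "enat k < (SUP xs \<in> {xs. set xs \<subseteq> max_ideal R \<and> regular_sequence xs (self_algebra R)}. enat (length xs))"
    unfolding depth_def using Suc by simp
  then obtain xs where xs: "set xs \<subseteq> max_ideal R" "regular_sequence xs (self_algebra R)" "k < length xs"
    unfolding less_SUP_iff by auto
  have "length xs = e" using regular_sequence_length_le[OF xs(1,2)] xs(3) Suc assms(2) by simp
  moreover have "nzd_mod R (self_algebra R) (set (take i xs)) (xs ! i)" if "i < length xs" for i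
    using module.regular_sequence_iff[OF module_self, of xs] xs(1,2) max_ideal.a_subset that by blast
  ultimately show ?thesis using that[of xs] xs(1) by blast
qed

lemma Cohen_MacaulayI:
  assumes "system_of_parameters R xs"
    and "\<And>i. i < length xs \<Longrightarrow> nzd_mod R (self_algebra R) (set (take i xs)) (xs ! i)"
  shows "Cohen_Macaulay R"
proof -
  have xs: "set xs \<subseteq> max_ideal R" "enat (length xs) = krull_dim R"
    using assms(1) unfolding system_of_parameters_def by auto
  have c: "set xs \<subseteq> carrier R" using xs(1) max_ideal.a_subset by blast
  have "\<one> \<notin> Idl (set xs)" using genideal_minimal[OF max_ideal.is_ideal xs(1)] max_ideal.one_notin by blast
  then have "mult_span R (self_algebra R) (set xs) \<noteq> carrier (self_algebra R)"
    using mult_span_self[OF c] by auto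
  then have reg: "regular_sequence xs (self_algebra R)"
    using assms(2) module.regular_sequence_iff[OF module_self c] by blast
  have "depth R \<le> krull_dim R"
    unfolding depth_def using regular_sequence_length_le by (intro SUP_least) auto
  moreover have "krull_dim R \<le> depth R"
    unfolding depth_def xs(2)[symmetric] using xs(1) reg by (intro SUP_upper) auto
  ultimately show ?thesis
    unfolding Cohen_Macaulay_def local_ring_iff using noetherian_local_ring_axioms by simp
qed

lemma structure_map_linear:
  assumes "algebra R B"
  shows "u \<in> carrier R \<Longrightarrow> structure_map B u \<in> carrier B"
    and "r \<in> carrier R \<Longrightarrow> u \<in> carrier R \<Longrightarrow> structure_map B (r \<otimes> u) = r \<odot>\<^bsub>B\<^esub> structure_map B u"
    and "u \<in> carrier R \<Longrightarrow> v \<in> carrier R \<Longrightarrow> structure_map B (u \<oplus> v) = structure_map B u \<oplus>\<^bsub>B\<^esub> structure_map B v"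
proof -
  interpret B: algebra R B by fact
  show "u \<in> carrier R \<Longrightarrow> structure_map B u \<in> carrier B"
    and "r \<in> carrier R \<Longrightarrow> u \<in> carrier R \<Longrightarrow> structure_map B (r \<otimes> u) = r \<odot>\<^bsub>B\<^esub> structure_map B u"
    and "u \<in> carrier R \<Longrightarrow> v \<in> carrier R \<Longrightarrow> structure_map B (u \<oplus> v) = structure_map B u \<oplus>\<^bsub>B\<^esub> structure_map B v"
    unfolding structure_map_def by (simp_all add: B.smult_assoc1 B.smult_l_distr)
qed

lemma cech_modules:
  assumes "algebra R B" "set xs \<subseteq> max_ideal R"
  shows "cech_module R (self_algebra R) xs" "cech_module R B xs"
  using assms module_self algebra.module max_ideal.a_subset
  unfolding cech_module_def cech_module_axioms_def by blast+

lemma inj_structure_map_iff: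
  assumes "algebra R B" "set xs \<subseteq> max_ideal R"
  shows "inj_on (local_cohomology_map R xs B (length xs) (structure_map B))
      (carrier (local_cohomology R xs (self_algebra R) (length xs))) \<longleftrightarrow>
    (\<forall>u\<in>carrier R. \<forall>t>0.
      (\<exists>n. finprod R (\<lambda>i. xs ! i) {..<length xs} [^] n \<odot>\<^bsub>B\<^esub> structure_map B u \<in>
        mult_span R B ((\<lambda>i. (xs ! i) [^] (n + t :: nat)) ` {..<length xs})) \<longrightarrow>
      (\<exists>n. finprod R (\<lambda>i. xs ! i) {..<length xs} [^] n \<otimes> u \<in>
        mult_span R (self_algebra R) ((\<lambda>i. (xs ! i) [^] (n + t :: nat)) ` {..<length xs})))"
  using inj_on_local_cohomology_map_iff[OF cech_modules[OF assms], of "structure_map B"]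
    structure_map_linear[OF assms(1)] by simp

text \<open>If \<open>u\<close> lies in \<open>(xs)B\<close>, the class of \<open>u\<close> over
  \<open>x_1 ... x_e\<close> dies over \<open>B\<close>, hence already over \<open>R\<close>, and
  regularity on \<open>R\<close> brings \<open>u\<close> back into \<open>(xs)\<close>. Of
  \<open>B\<close> only the algebra structure enters.\<close>

lemma contracts_if_inj:
  assumes B: "algebra R B" and xs: "set xs \<subseteq> max_ideal R"
    and reg: "permutably_regular R (\<lambda>i. xs ! i) {..<length xs}"
    and inj: "inj_on (local_cohomology_map R xs B (length xs) (structure_map B))
      (carrier (local_cohomology R xs (self_algebra R) (length xs)))"
  shows "contracts R B (set xs)"
  unfolding contracts_def
proof (intro ballI impI)
  interpret B: algebra R B by fact
  interpret S: cech_module R "self_algebra R" xs using cech_modules[OF B xs] by blast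
  fix u assume u: "u \<in> carrier R" "structure_map B u \<in> mult_span R B (set xs)"
  have img: "(\<lambda>i. (xs ! i) [^] (1::nat)) ` {..<length xs} = set xs"
  proof -
    have "(\<lambda>i. (xs ! i) [^] (1::nat)) ` {..<length xs} = (\<lambda>i. xs ! i) ` {..<length xs}"
      by (intro image_cong) auto
    also have "\<dots> = set xs" by (auto simp: set_conv_nth)
    finally show ?thesis .
  qed
  have nz: "nzd_mod R (self_algebra R) ((\<lambda>j. (xs ! j) [^] (k j :: nat)) ` ({..<length xs} - {i})) (xs ! i)"
    if "i \<in> {..<length xs}" "\<forall>j\<in>{..<length xs}. k j > 0" for i k
  proof (rule permutably_regular_pow)
    show "(\<lambda>i. xs ! i) ` {..<length xs} \<subseteq> max_ideal R" using xs nth_mem by blast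
  qed (use reg that in auto)
  \<comment> \<open>Here \<open>t = 1\<close>, and \<open>n = 0\<close> is the witness over
    \<open>B\<close>, so nothing is cancelled there.\<close>
  have "finprod R (\<lambda>i. xs ! i) {..<length xs} [^] (0::nat) \<odot>\<^bsub>B\<^esub> structure_map B u \<in>
        mult_span R B ((\<lambda>i. (xs ! i) [^] (0 + 1 :: nat)) ` {..<length xs})"
    unfolding add_0 img using u(2) structure_map_linear(1)[OF B u(1)] by simp
  then obtain n where n: "finprod R (\<lambda>i. xs ! i) {..<length xs} [^] n \<otimes> u \<in>
        mult_span R (self_algebra R) ((\<lambda>i. (xs ! i) [^] (n + 1 :: nat)) ` {..<length xs})"
    using inj[unfolded inj_structure_map_iff[OF B xs], rule_format, OF u(1) zero_less_one] by blast
  have "u \<in> mult_span R (self_algebra R) ((\<lambda>i. (xs ! i) [^] (1::nat)) ` {..<length xs})"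
  proof (rule S.mult_span_monomial_colon[where n = n])
    show "(\<lambda>i. xs ! i) \<in> {..<length xs} \<rightarrow> carrier R" by simp
    show "u \<in> carrier (self_algebra R)" using u(1) by simp
    show "(\<Otimes>i\<in>{..<length xs}. (xs ! i) [^] n) \<odot>\<^bsub>self_algebra R\<^esub> u \<in>
        mult_span R (self_algebra R) ((\<lambda>i. (xs ! i) [^] (n + 1)) ` {..<length xs})"
      using n S.cprod_pow[of "{..<length xs}" n] by simp
  qed (use nz in simp_all)
  then show "u \<in> Idl (set xs)" unfolding img using mult_span_self[OF S.xs_carrier] by simp
qed

text \<open>If the class of \<open>u\<close> over \<open>(x_1 ... x_e)^t\<close> dies over
  \<open>B\<close>, regularity on \<open>B\<close> puts \<open>u\<close> into
  \<open>(x_1^t, ..., x_e^t)B\<close>. These powers form a parameter set, so \<open>u\<close> is in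
  the ideal they generate in \<open>R\<close> and its class is zero. Contraction is therefore needed
  for parameter sets other than \<open>set xs\<close>.\<close>

lemma inj_if_contracts:
  assumes B: "big_Cohen_Macaulay R B" and xs: "system_of_parameters R xs"
    and con: "\<And>Y. parameter_set R Y \<Longrightarrow> contracts R B Y"
  shows "inj_on (local_cohomology_map R xs B (length xs) (structure_map B))
      (carrier (local_cohomology R xs (self_algebra R) (length xs)))"
proof -
  have alg: "algebra R B" using B big_Cohen_Macaulay_def by blast
  have m: "set xs \<subseteq> max_ideal R" using xs unfolding system_of_parameters_def by blast
  let ?S = "{..<length xs}"
  have im: "(\<lambda>i. xs ! i) ` ?S = set xs" by (auto simp: set_conv_nth)
  have par: "inj_on (\<lambda>i. (xs ! i) [^] (k i :: nat)) ?S \<and> parameter_set R ((\<lambda>i. (xs ! i) [^] k i) ` ?S)"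
    if "\<forall>i\<in>?S. k i > 0" for k
  proof -
    have "min_prime_over R ((\<lambda>i. (xs ! i) [^] k i) ` ?S) (max_ideal R)"
      using xs that im unfolding system_of_parameters_iff by (intro min_prime_over_pow_image) auto
    then show ?thesis using parameter_family[of ?S] xs unfolding system_of_parameters_iff by simp
  qed
  interpret B: cech_module R B xs using cech_modules[OF alg m] by blast
  interpret S: cech_module R "self_algebra R" xs using cech_modules[OF alg m] by blast
  have nz: "nzd_mod R B ((\<lambda>j. (xs ! j) [^] (k j :: nat)) ` (?S - {i})) (xs ! i)"
    if i: "i \<in> ?S" and k: "\<forall>j\<in>?S. k j > 0" for i k
  proof -
    \<comment> \<open>With exponent 1 at \<open>i\<close>, the element \<open>x_i\<close> and the
      given powers of the others form a parameter set without repetitions, to which the big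
      Cohen-Macaulay hypothesis applies.\<close>
    let ?k = "k(i := 1)" and ?Z = "(\<lambda>j. (xs ! j) [^] (k j :: nat)) ` (?S - {i})"
    have p: "inj_on (\<lambda>j. (xs ! j) [^] ?k j) ?S" "parameter_set R ((\<lambda>j. (xs ! j) [^] ?k j) ` ?S)"
      using par[of ?k] k by auto
    have Z: "(\<lambda>j. (xs ! j) [^] ?k j) ` (?S - {i}) = ?Z" by (intro image_cong) auto
    have xi: "(xs ! i) [^] ?k i = xs ! i" using i by simp
    have "(\<lambda>j. (xs ! j) [^] ?k j) ` ?S = insert ((xs ! i) [^] ?k i) ((\<lambda>j. (xs ! j) [^] ?k j) ` (?S - {i}))"
      using image_insert[of "\<lambda>j. (xs ! j) [^] ?k j" i "?S - {i}"] unfolding insert_Diff[OF i] .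
    then have "parameter_set R (insert (xs ! i) ?Z)" using p(2) Z xi by simp
    moreover have "(xs ! i) [^] ?k i \<notin> (\<lambda>j. (xs ! j) [^] ?k j) ` (?S - {i})"
      using inj_on_image_mem_iff[OF p(1) i, of "?S - {i}"] by blast
    then have "xs ! i \<notin> ?Z" unfolding Z xi .
    ultimately show ?thesis using big_Cohen_Macaulay_nzd_mod[OF B] by blast
  qed
  show ?thesis
    unfolding inj_structure_map_iff[OF alg m]
  proof (intro ballI allI impI)
    fix u and t :: nat
    assume u: "u \<in> carrier R" and t: "t > 0" and "\<exists>n. B.ppow n \<odot>\<^bsub>B\<^esub> structure_map B u \<in> B.power_span (n + t)"
    then obtain n where n: "B.ppow n \<odot>\<^bsub>B\<^esub> structure_map B u \<in> B.power_span (n + t)" by blast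
    have "structure_map B u \<in> B.power_span t"
    proof (rule B.mult_span_monomial_colon[where n = n])
      show "(\<lambda>i. xs ! i) \<in> ?S \<rightarrow> carrier R" by simp
      show "structure_map B u \<in> carrier B" using structure_map_linear(1)[OF alg u] .
      show "(\<Otimes>i\<in>?S. (xs ! i) [^] n) \<odot>\<^bsub>B\<^esub> structure_map B u \<in> B.power_span (n + t)"
        using n B.cprod_pow[of ?S n] by simp
    qed (use nz t in simp_all)
    then have "u \<in> Idl ((\<lambda>i. (xs ! i) [^] t) ` ?S)"
      using con par[of "\<lambda>_. t"] t u unfolding contracts_def by blast
    then have "u \<in> S.power_span t" using mult_span_self[OF B.pow_img] by simp
    then show "\<exists>n. B.ppow n \<otimes> u \<in> S.power_span (n + t)"
      using u by (intro exI[of _ 0]) simp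
  qed
qed

end

section \<open>Transfer from R/xR to R\<close>

context local_quotient
begin

lemma BCM_rational_wrt_lift:
  fixes B :: "('a, 'c, 'n) module_scheme"
  assumes x: "nonzerodivisor R x" and d: "krull_dim R = enat d"
    and B: "big_Cohen_Macaulay R B" and D: "algebra_quotient R x B D \<pi>"
    and rat: "BCM_rational_wrt quot D"
  shows "BCM_rational_wrt R B"
proof -
  interpret D: algebra_quotient R x B D \<pi> by fact
  interpret S: algebra_quotient R x "self_algebra R" "self_algebra quot" "\<lambda>r. res r"
    by (rule algebra_quotient_self)
  obtain e where e: "krull_dim quot = enat e" "e < d" using krull_dim_quot_less[OF x d] .
  have CM: "Cohen_Macaulay quot" using rat unfolding BCM_rational_wrt_def by blast
  \<comment> \<open>Injectivity over \<open>R/xR\<close> is used for this one system of parameters.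
    It is taken to be a regular sequence, so that contraction can be read off from
    injectivity.\<close>
  obtain ws where ws: "set ws \<subseteq> max_ideal quot" "length ws = e"
    "\<And>i. i < length ws \<Longrightarrow> nzd_mod quot (self_algebra quot) (set (take i ws)) (ws ! i)"
    using A.Cohen_Macaulay_regular_list[OF CM e(1)] by metis
  have ws_sop: "system_of_parameters quot ws"
    using A.regular_sequence_system_of_parameters[OF ws(1) _ ws(3)] ws(2) e(1) by simp
  obtain zs where zs: "ws = map (\<lambda>r. res r) zs" "set zs \<subseteq> max_ideal R" using lift_max_ideal_list[OF ws(1)] .
  have zc: "set zs \<subseteq> carrier R" using zs(2) max_ideal.a_subset by blast
  have sop: "system_of_parameters R (x # zs)" using system_of_parameters_lift[OF x d zs(2)] ws_sop zs(1) by simp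
  have reg: "nzd_mod R (self_algebra R) (set (take i (x # zs))) ((x # zs) ! i)" if i: "i < length (x # zs)" for i
  proof (cases i)
    case 0
    have "Idl {} = {\<zero>}" using module.mult_span_empty[OF module_self] mult_span_self[of "{}"] by simp
    then show ?thesis using 0 x unfolding nonzerodivisor_def by (simp add: nzd_mod_self)
  next
    case (Suc j)
    have j: "j < length zs" using i Suc by simp
    have "set (take j zs) \<subseteq> carrier R" "zs ! j \<in> carrier R" using zc set_take_subset[of j zs] nth_mem[OF j] by auto
    then show ?thesis
      using S.nzd_mod_quotient_iff[of "set (take j zs)" "zs ! j"] ws(3)[of j] j Suc by (simp add: zs(1) take_map)
  qed
  have xzm: "set (x # zs) \<subseteq> max_ideal R" using zs(2) x_in_max_ideal by simp
  have "permutably_regular quot (\<lambda>i. ws ! i) {..<length ws}" using A.permutably_regular_list[OF ws(1,3)] .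
  moreover have "inj_on (local_cohomology_map quot ws D (length ws) (structure_map D))
      (carrier (local_cohomology quot ws (self_algebra quot) (length ws)))"
    using rat ws_sop unfolding BCM_rational_wrt_def by blast
  ultimately have "contracts quot D (set ws)"
    using A.contracts_if_inj[OF D.algebra_quotient_algebra ws(1)] by blast
  then have con: "contracts R B (set (x # zs))" using D.contracts_quotient_iff[OF zc] zs(1) by simp
  have "permutably_regular R (\<lambda>i. (x # zs) ! i) {..<length (x # zs)}" using permutably_regular_list[OF xzm reg] .
  then have "permutably_regular R (\<lambda>y. y) ((\<lambda>i. (x # zs) ! i) ` {..<length (x # zs)})"
    by (rule permutably_regular_image)
  moreover have "(\<lambda>i. (x # zs) ! i) ` {..<length (x # zs)} = set (x # zs)" unfolding set_conv_nth by auto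
  ultimately have preg: "permutably_regular R (\<lambda>y. y) (set (x # zs))" by simp
  \<comment> \<open>Regularity travels together with contraction, because the exchange step cancels
    modulo \<open>Z\<close> in \<open>R\<close> as well as in \<open>B\<close>.\<close>
  let ?\<Phi> = "\<lambda>Y. permutably_regular R (\<lambda>y. y) Y \<and> contracts R B Y"
  have "?\<Phi> Y" if Y: "parameter_set R Y" for Y
  proof (rule parameter_set_connected[where \<Phi> = ?\<Phi>, OF d _ parameter_set_list(1)[OF sop] Y])
    show "?\<Phi> (set (x # zs))" using preg con by blast
    show "?\<Phi> (insert v Z)"
      if "finite Z" "y \<notin> Z" "v \<notin> Z" "parameter_set R (insert y Z)" "parameter_set R (insert v Z)" "?\<Phi> (insert y Z)"
      for Z y v
      using regular_contracts_exchange[OF B that(1-5)] that(6) by blast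
  qed
  then show ?thesis
    unfolding BCM_rational_wrt_def using Cohen_MacaulayI[OF sop reg] inj_if_contracts[OF B] by blast
qed

text \<open>A system of parameters of \<open>R/xR\<close> lifts to one of \<open>R\<close> with
  \<open>x\<close> in front. That list is regular on \<open>B\<close>, and splitting off
  \<open>x\<close> leaves a regular sequence on \<open>B/xB\<close>, including properness. This
  makes BCM-rationality of \<open>R/xR\<close> applicable to \<open>B/xB\<close>.\<close>

lemma big_Cohen_Macaulay_quotient:
  fixes B :: "('a, 'c, 'n) module_scheme"
  assumes x: "nonzerodivisor R x" and d: "krull_dim R = enat d"
    and B: "big_Cohen_Macaulay R B" and D: "algebra_quotient R x B D \<pi>"
  shows "big_Cohen_Macaulay quot D"
  unfolding big_Cohen_Macaulay_def
proof (intro conjI allI impI)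
  interpret D: algebra_quotient R x B D \<pi> by fact
  show "algebra quot D" by (rule D.algebra_quotient_algebra)
  fix ws assume ws: "system_of_parameters quot ws"
  then obtain zs where zs: "ws = map (\<lambda>r. res r) zs" "set zs \<subseteq> max_ideal R"
    using lift_max_ideal_list unfolding system_of_parameters_def by metis
  have zc: "set zs \<subseteq> carrier R" using zs(2) max_ideal.a_subset by blast
  have "regular_sequence (x # zs) B"
    using system_of_parameters_lift[OF x d zs(2)] ws zs(1) B unfolding big_Cohen_Macaulay_def by blast
  then have reg: "\<forall>i<length (x # zs). nzd_mod R B (set (take i (x # zs))) ((x # zs) ! i)"
    "mult_span R B (set (x # zs)) \<noteq> carrier B"
    using D.regular_sequence_iff[of "x # zs"] zc x_carrier by auto
  have "nzd_mod R B (insert x (set (take i zs))) (zs ! i)" if "i < length zs" for i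
    using reg(1)[rule_format, of "Suc i"] that by simp
  then show "regular_sequence ws D"
    unfolding zs(1) D.regular_sequence_quotient_iff[OF zc] using reg(2) by simp
qed

end

theorem proposition3p4:
  fixes R :: "'a ring" and x :: 'a and d :: nat
  assumes "local_ring R" and "excellent_ring R" and "krull_dim R = enat d"
    and "x \<in> max_ideal R" and "nonzerodivisor R x"
  shows "(\<forall>B :: ('a, 'b) module. big_Cohen_Macaulay R B \<longrightarrow>
            BCM_rational_wrt (R Quot PIdl\<^bsub>R\<^esub> x) (quotient_algebra (PIdl\<^bsub>R\<^esub> x) B) \<longrightarrow>
            BCM_rational_wrt R B) \<and>
         (BCM_rational TYPE('b) (R Quot PIdl\<^bsub>R\<^esub> x) \<longrightarrow> BCM_rational TYPE('b) R)"
proof -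
  interpret noetherian_local_ring R using assms(1) local_ring_iff by blast
  have xR: "x \<in> carrier R" using assms(4) max_ideal.Icarr by blast
  interpret local_quotient R x by unfold_locales (fact xR assms(4))+
  have quot: "algebra_quotient R x B (quotient_algebra (PIdl\<^bsub>R\<^esub> x) B) (\<lambda>b. extended_ideal B (PIdl\<^bsub>R\<^esub> x) +>\<^bsub>B\<^esub> b)"
    if "big_Cohen_Macaulay R B" for B :: "('a, 'b) module"
  proof (rule algebra_quotient_quotient_algebra[OF _ xR])
    show "algebra R B" using that by (simp add: big_Cohen_Macaulay_def)
  qed
  show ?thesis
  proof (intro conjI allI impI)
    fix B :: "('a, 'b) module"
    assume "big_Cohen_Macaulay R B" "BCM_rational_wrt quot (quotient_algebra (PIdl\<^bsub>R\<^esub> x) B)"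
    then show "BCM_rational_wrt R B" using BCM_rational_wrt_lift[OF assms(5,3)] quot by blast
  next
    assume rat: "BCM_rational TYPE('b) quot"
    show "BCM_rational TYPE('b) R"
      unfolding BCM_rational_def
    proof (intro allI impI)
      fix B :: "('a, 'b) module" assume B: "big_Cohen_Macaulay R B"
      obtain D :: "('a set, 'b) module" and \<pi> where D: "algebra_quotient R x B D \<pi>"
        using algebra_quotient.algebra_quotient_representatives[OF quot[OF B]] by blast
      then have "BCM_rational_wrt quot D"
        using rat big_Cohen_Macaulay_quotient[OF assms(5,3) B] unfolding BCM_rational_def by blast
      then show "BCM_rational_wrt R B" using BCM_rational_wrt_lift[OF assms(5,3) B D] by blast
    qed
  qed
qed

end
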